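(* Assume $M_B:=\dfrac{\dot v_1^+}{\bar C_B}>\sqrt2$ and let $s\in\mathbb R$. There is a constant $C>0$ such that for all $\gamma\ge1$ and all $\mathcal K^-\in L^2(\mathbb R^-;H^s_\gamma(\mathbb R^2))$, $\mathcal K^+\in L^2(\mathbb R^+;H^s_\gamma(\mathbb R^2))$ (so $C$ is independent of $\mathcal K^\pm$ and $\gamma$), there exists a unique $f\in H^{s+1}_\gamma(\mathbb R^2)$ solving $$\Big(\tau^2-(\dot v_1^+)^2\eta^2-2i\tau\eta\,\dot v_1^+\frac{\mu^+-\mu^-}{\mu^++\mu^-}\Big)\hat f+\frac{\mu^+\mu^-}{\mu^++\mu^-}W=0,\qquad \tau=\gamma+i\delta,\ (\delta,\eta)\in\mathbb R^2,$$ and it satisfies the estimate $$\gamma^3\|f\|^2_{H^{s+1}_\gamma(\mathbb R^2)}\le C\Big(\|\mathcal K^+\|^2_{L^2(\mathbb R^+;H^s_\gamma(\mathbb R^2))}+\|\mathcal K^-\|^2_{L^2(\mathbb R^-;H^s_\gamma(\mathbb R^2))}\Big).$$ Here $$W=W(\tau,\eta)=\frac1{\mu^+}\int_0^\infty e^{-\mu^+y}\hat{\mathcal K}^+(\cdot,y)\,dy-\frac1{\mu^-}\int_0^\infty e^{-\mu^-y}\hat{\mathcal K}^-(\cdot,-y)\,dy .$$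
   Context: Constants: $\dot v_1^\pm\in\mathbb R$ with $\dot v_1^-=-\dot v_1^+$; $\bar C_B=\sqrt{c^2+c_A^2}>0$ with $c=\sqrt{p'(\dot\varrho)}>0$ the sound speed at the constant density $\dot\varrho>0$ and $c_A^2=(\dot B_2^\pm)^2/\dot\varrho$, where $\dot B_2^\pm\in\mathbb R$, $|\dot B_2^+|=|\dot B_2^-|$. For $\Re\tau>0$ and $\eta\in\mathbb R$, $\mu^\pm=\mu^\pm(\tau,\eta)$ is the square root of $\frac{(\tau+i\dot v_1^\pm\eta)^2}{\bar C_B^2}+\eta^2$ with $\Re\mu^\pm>0$. Function spaces: for $s\in\mathbb R$, $\gamma\ge1$, $\tau=\gamma+i\delta$, put $\Lambda(\tau,\eta)=(\gamma^2+\delta^2+\eta^2)^{1/2}=(|\tau|^2+\eta^2)^{1/2}$ and $$\|v\|_{s,\gamma}^2=\frac1{(2\pi)^2}\iint_{\mathbb R^2}\Lambda^{2s}(\tau,\eta)|\hat v(\delta,\eta)|^2\,d\delta\,d\eta ,$$ with $\hat v$ the Fourier transform of $v(t,x_1)$. $H^s_\gamma(\mathbb R^2)=\{u\in\mathcal D'(\mathbb R^2): e^{-\gamma t}u(t,x_1)\in H^s(\mathbb R^2)\}$, normed by $\|u\|_{H^s_\gamma(\mathbb R^2)}=\|e^{-\gamma t}u\|_{s,\gamma}$. $L^2(\mathbb R^\pm;H^s_\gamma(\mathbb R^2))$ is the space of $u=u(t,x_1,x_3)$, $\pm x_3>0$, with finite norm $\|u\|^2=\int_0^\infty\|u(\cdot,\pm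 x_3)\|^2_{H^s_\gamma(\mathbb R^2)}\,dx_3$. In the equation, $\hat f$ and $\hat{\mathcal K}^\pm(\cdot,x_3)$ denote the Fourier transforms in $(t,x_1)$, with dual variables $(\delta,\eta)$, of $e^{-\gamma t}f$ and $e^{-\gamma t}\mathcal K^\pm(\cdot,x_3)$; the equation holds for almost every $(\delta,\eta)$. *)

theory Defs
  imports "HOL-Analysis.Analysis"
begin

section \<open>Test functions and distributions on the plane\<close>

definition d1 :: "(real \<times> real \<Rightarrow> complex) \<Rightarrow> real \<times> real \<Rightarrow> complex"
  where "d1 \<phi> z = frechet_derivative \<phi> (at z) (1, 0)"

definition d2 :: "(real \<times> real \<Rightarrow> complex) \<Rightarrow> real \<times> real \<Rightarrow> complex"
  where "d2 \<phi> z = frechet_derivative \<phi> (at z) (0, 1)"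

definition partial :: "nat \<Rightarrow> nat \<Rightarrow> (real \<times> real \<Rightarrow> complex) \<Rightarrow> real \<times> real \<Rightarrow> complex"
  where "partial a b \<phi> = (d1 ^^ a) ((d2 ^^ b) \<phi>)"

definition supp :: "(real \<times> real \<Rightarrow> complex) \<Rightarrow> (real \<times> real) set"
  where "supp \<phi> = closure {z. \<phi> z \<noteq> 0}"

text \<open>Smoothness is total differentiability of all the \<open>partial a b \<phi>\<close>. This one order of
  differentiation suffices: a function with differentiable first partials has symmetric second ones.\<close>

definition test_functions :: "(real \<times> real \<Rightarrow> complex) set"
  where "test_functions =
    {\<phi>. (\<forall>a b z. partial a b \<phi> differentiable (at z)) \<and> compact (supp \<phi>)}"

text \<open>Functionals are made \<^const>\<open>extensional\<close> (a fixed value off the test functions), so that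
  equality in HOL is equality of distributions.\<close>

definition distributions :: "((real \<times> real \<Rightarrow> complex) \<Rightarrow> complex) set"
  where "distributions =
    {u \<in> extensional test_functions.
       (\<forall>\<phi>\<in>test_functions. \<forall>\<psi>\<in>test_functions. \<forall>a b.
          u (\<lambda>z. a * \<phi> z + b * \<psi> z) = a * u \<phi> + b * u \<psi>) \<and>
       (\<forall>K. compact K \<longrightarrow> (\<exists>C N. \<forall>\<phi>\<in>test_functions. supp \<phi> \<subseteq> K \<longrightarrow>
          cmod (u \<phi>) \<le> C * (\<Sum>(a, b) \<in> {(a, b). a + b \<le> N}. SUP z. cmod (partial a b \<phi> z))))}"

text \<open>The product of \<open>u\<close> with the smooth function \<open>exp (- \<gamma> * t)\<close>.\<close>

definition exp_mult ::
  "real \<Rightarrow> ((real \<times> real \<Rightarrow> complex) \<Rightarrow> complex) \<Rightarrow> (real \<times> real \<Rightarrow> complex) \<Rightarrow> complex"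
  where "exp_mult \<gamma> u =
    restrict (\<lambda>\<phi>. u (\<lambda>(t, x). of_real (exp (- \<gamma> * t)) * \<phi> (t, x))) test_functions"

section \<open>Fourier transform\<close>

text \<open>Convention: the transform of \<open>v\<close> is the integral of \<open>cis (- (z \<bullet> \<xi>)) * v z\<close> over \<open>z = (t, x\<^sub>1)\<close>,
  with \<open>\<xi> = (\<delta>, \<eta>)\<close>.\<close>

definition inv_fourier :: "(real \<times> real \<Rightarrow> complex) \<Rightarrow> real \<times> real \<Rightarrow> complex"
  where "inv_fourier \<phi> \<xi> = (1 / (2 * pi)\<^sup>2) * (LINT z|lborel. cis (z \<bullet> \<xi>) * \<phi> z)"

text \<open>\<open>has_fourier v g\<close>: the Fourier transform of the distribution \<open>v\<close> is the function \<open>g\<close>, that is,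
  \<open>v\<close> is the inverse Fourier transform of \<open>g\<close>, which acts on \<open>\<phi>\<close> as \<open>g\<close> acts on the inverse
  transform of \<open>\<phi>\<close>. The function \<open>g\<close> is determined by \<open>v\<close> up to a null set.\<close>

definition has_fourier ::
  "((real \<times> real \<Rightarrow> complex) \<Rightarrow> complex) \<Rightarrow> (real \<times> real \<Rightarrow> complex) \<Rightarrow> bool"
  where "has_fourier v g \<longleftrightarrow>
    v \<in> distributions \<and> g \<in> borel_measurable borel \<and>
    (\<forall>\<phi>\<in>test_functions.
       integrable lborel (\<lambda>\<xi>. g \<xi> * inv_fourier \<phi> \<xi>) \<and>
       v \<phi> = (LINT \<xi>|lborel. g \<xi> * inv_fourier \<phi> \<xi>))"

definition fourier :: "((real \<times> real \<Rightarrow> complex) \<Rightarrow> complex) \<Rightarrow> real \<times> real \<Rightarrow> complex"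
  where "fourier v = (SOME g. has_fourier v g)"

section \<open>Sobolev spaces\<close>

definition sobolev :: "real \<Rightarrow> ((real \<times> real \<Rightarrow> complex) \<Rightarrow> complex) set"
  where "sobolev s =
    {v. \<exists>g. has_fourier v g \<and>
       integrable lborel (\<lambda>(\<delta>, \<eta>). (1 + \<delta>\<^sup>2 + \<eta>\<^sup>2) powr s * (cmod (g (\<delta>, \<eta>)))\<^sup>2)}"

definition Lambda :: "complex \<Rightarrow> real \<Rightarrow> real"
  where "Lambda \<tau> \<eta> = sqrt ((cmod \<tau>)\<^sup>2 + \<eta>\<^sup>2)"

definition norm_s :: "real \<Rightarrow> real \<Rightarrow> ((real \<times> real \<Rightarrow> complex) \<Rightarrow> complex) \<Rightarrow> real"
  where "norm_s s \<gamma> v =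
    sqrt ((1 / (2 * pi)\<^sup>2) *
      (LINT (\<delta>, \<eta>)|lborel. Lambda (Complex \<gamma> \<delta>) \<eta> powr (2 * s) * (cmod (fourier v (\<delta>, \<eta>)))\<^sup>2))"

definition H :: "real \<Rightarrow> real \<Rightarrow> ((real \<times> real \<Rightarrow> complex) \<Rightarrow> complex) set"
  where "H s \<gamma> = {u \<in> distributions. exp_mult \<gamma> u \<in> sobolev s}"

definition norm_H :: "real \<Rightarrow> real \<Rightarrow> ((real \<times> real \<Rightarrow> complex) \<Rightarrow> complex) \<Rightarrow> real"
  where "norm_H s \<gamma> u = norm_s s \<gamma> (exp_mult \<gamma> u)"

text \<open>An element of \<open>L\<^sup>2(J; H\<^sup>s\<^sub>\<gamma>)\<close> is a family of distributions in \<open>(t, x\<^sub>1)\<close> indexed by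
  \<open>x\<^sub>3 \<in> J\<close>. Its transform in \<open>(t, x\<^sub>1)\<close> has to be chosen measurable in all three variables jointly
  (choosing a version for each \<open>x\<^sub>3\<close> separately would make integrals in \<open>x\<^sub>3\<close> at fixed \<open>(\<delta>, \<eta>)\<close>
  meaningless); such a choice is unique up to null sets of \<open>J \<times> \<real>\<^sup>2\<close>. Its existence is the
  measurability requirement on the family. The norm is integrated over \<^const>\<open>lebesgue\<close> because
  families that agree for almost every \<open>x\<^sub>3\<close> are not distinguished.\<close>

definition has_partial_fourier ::
  "real set \<Rightarrow> real \<Rightarrow> (real \<Rightarrow> (real \<times> real \<Rightarrow> complex) \<Rightarrow> complex) \<Rightarrow>
   (real \<times> real \<times> real \<Rightarrow> complex) \<Rightarrow> bool"
  where "has_partial_fourier J \<gamma> u G \<longleftrightarrow>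
    G \<in> borel_measurable borel \<and>
    (AE x3 in lborel. x3 \<in> J \<longrightarrow> has_fourier (exp_mult \<gamma> (u x3)) (\<lambda>\<xi>. G (x3, \<xi>)))"

definition partial_fourier ::
  "real set \<Rightarrow> real \<Rightarrow> (real \<Rightarrow> (real \<times> real \<Rightarrow> complex) \<Rightarrow> complex) \<Rightarrow>
   real \<times> real \<times> real \<Rightarrow> complex"
  where "partial_fourier J \<gamma> u = (SOME G. has_partial_fourier J \<gamma> u G)"

definition L2H :: "real set \<Rightarrow> real \<Rightarrow> real \<Rightarrow> (real \<Rightarrow> (real \<times> real \<Rightarrow> complex) \<Rightarrow> complex) set"
  where "L2H J s \<gamma> =
    {u. (\<exists>G. has_partial_fourier J \<gamma> u G) \<and>
        (AE x3 in lborel. x3 \<in> J \<longrightarrow> u x3 \<in> H s \<gamma>) \<and>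
        set_integrable lebesgue J (\<lambda>x3. (norm_H s \<gamma> (u x3))\<^sup>2)}"

definition norm_L2H ::
  "real set \<Rightarrow> real \<Rightarrow> real \<Rightarrow> (real \<Rightarrow> (real \<times> real \<Rightarrow> complex) \<Rightarrow> complex) \<Rightarrow> real"
  where "norm_L2H J s \<gamma> u = sqrt (LINT x3:J|lebesgue. (norm_H s \<gamma> (u x3))\<^sup>2)"

section \<open>The front equation\<close>

text \<open>\<open>C\<^sub>B\<close> from the pressure law \<open>p\<close>, the density \<open>\<rho>\<close> and the magnetic field component \<open>B2\<close>.\<close>

definition sound_speed :: "(real \<Rightarrow> real) \<Rightarrow> real \<Rightarrow> real"
  where "sound_speed p \<rho> = sqrt (deriv p \<rho>)"

definition C_B :: "(real \<Rightarrow> real) \<Rightarrow> real \<Rightarrow> real \<Rightarrow> real"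
  where "C_B p \<rho> B2 = sqrt ((sound_speed p \<rho>)\<^sup>2 + B2\<^sup>2 / \<rho>)"

definition mu :: "real \<Rightarrow> real \<Rightarrow> complex \<Rightarrow> real \<Rightarrow> complex"
  where "mu CB v \<tau> \<eta> = csqrt ((\<tau> + \<i> * v * \<eta>)\<^sup>2 / CB\<^sup>2 + \<eta>\<^sup>2)"

text \<open>For \<open>Re \<tau> > 0\<close> the principal root is the root with positive real part.\<close>

lemma mu_unique:
  assumes "CB > 0" "Re \<tau> > 0"
  shows "m = mu CB v \<tau> \<eta> \<longleftrightarrow>
    m\<^sup>2 = (\<tau> + \<i> * v * \<eta>)\<^sup>2 / CB\<^sup>2 + \<eta>\<^sup>2 \<and> Re m > 0"
proof -
  define w where "w = (\<tau> + \<i> * v * \<eta>)\<^sup>2 / CB\<^sup>2 + \<eta>\<^sup>2"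
  have im: "Im w = 2 * Re \<tau> * (Im \<tau> + v * \<eta>) / CB\<^sup>2"
    and re: "Re w = ((Re \<tau>)\<^sup>2 - (Im \<tau> + v * \<eta>)\<^sup>2) / CB\<^sup>2 + \<eta>\<^sup>2"
  proof -
    have eq: "w = (\<tau> + \<i> * v * \<eta>)\<^sup>2 / of_real (CB\<^sup>2) + of_real (\<eta>\<^sup>2)"
      by (simp add: w_def)
    show "Im w = 2 * Re \<tau> * (Im \<tau> + v * \<eta>) / CB\<^sup>2"
      unfolding eq plus_complex.sel Im_divide_of_real Im_complex_of_real by (simp add: Im_power2)
    show "Re w = ((Re \<tau>)\<^sup>2 - (Im \<tau> + v * \<eta>)\<^sup>2) / CB\<^sup>2 + \<eta>\<^sup>2"
      unfolding eq plus_complex.sel Re_divide_of_real Re_complex_of_real by (simp add: Re_power2)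
  qed
  have "Re w > 0" if "Im w = 0"
  proof -
    have "Im \<tau> + v * \<eta> = 0" using that assms im by auto
    then show ?thesis using assms re by (simp add: add_pos_nonneg)
  qed
  moreover have "Im w = 0 \<and> Re w \<le> 0" if "Re (csqrt w) = 0"
  proof -
    have "Im w = 0" using Im_power2[of "csqrt w"] that unfolding power2_csqrt by (simp only: mult_zero_left mult_zero_right)
    moreover have "Re w \<le> 0"
      using Re_power2[of "csqrt w"] zero_le_power2[of "Im (csqrt w)"] that
      unfolding power2_csqrt by (simp only: power_zero_numeral)
    ultimately show ?thesis by blast
  qed
  ultimately have "Re (csqrt w) \<noteq> 0"
    by (meson not_le)
  then have pos: "Re (csqrt w) > 0"
    using csqrt_principal[of w] by blast
  have "m = csqrt w" if "m\<^sup>2 = w" "Re m > 0"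
    using csqrt_unique[OF that(1)] that(2) by blast
  then show ?thesis using pos power2_csqrt[of w] unfolding mu_def w_def[symmetric] by blast
qed

definition W ::
  "real \<Rightarrow> real \<Rightarrow> real \<Rightarrow> real \<Rightarrow> (real \<Rightarrow> (real \<times> real \<Rightarrow> complex) \<Rightarrow> complex) \<Rightarrow>
   (real \<Rightarrow> (real \<times> real \<Rightarrow> complex) \<Rightarrow> complex) \<Rightarrow> real \<Rightarrow> real \<Rightarrow> complex"
  where "W CB vp vm \<gamma> Kp Km \<delta> \<eta> =
    (let \<tau> = Complex \<gamma> \<delta>; \<mu>p = mu CB vp \<tau> \<eta>; \<mu>m = mu CB vm \<tau> \<eta> in
      1 / \<mu>p * (LINT y:{0<..}|lborel. exp (- \<mu>p * y) * partial_fourier {0<..} \<gamma> Kp (y, \<delta>, \<eta>))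
      - 1 / \<mu>m * (LINT y:{0<..}|lborel. exp (- \<mu>m * y) * partial_fourier {..<0} \<gamma> Km (- y, \<delta>, \<eta>)))"

definition solves_front ::
  "real \<Rightarrow> real \<Rightarrow> real \<Rightarrow> real \<Rightarrow> (real \<Rightarrow> (real \<times> real \<Rightarrow> complex) \<Rightarrow> complex) \<Rightarrow>
   (real \<Rightarrow> (real \<times> real \<Rightarrow> complex) \<Rightarrow> complex) \<Rightarrow>
   ((real \<times> real \<Rightarrow> complex) \<Rightarrow> complex) \<Rightarrow> bool"
  where "solves_front CB vp vm \<gamma> Kp Km f \<longleftrightarrow>
    (AE (\<delta>, \<eta>) in lborel.
      let \<tau> = Complex \<gamma> \<delta>; \<mu>p = mu CB vp \<tau> \<eta>; \<mu>m = mu CB vm \<tau> \<eta> in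
        (\<tau>\<^sup>2 - vp\<^sup>2 * \<eta>\<^sup>2 - 2 * \<i> * \<tau> * \<eta> * vp * ((\<mu>p - \<mu>m) / (\<mu>p + \<mu>m)))
            * fourier (exp_mult \<gamma> f) (\<delta>, \<eta>)
          + \<mu>p * \<mu>m / (\<mu>p + \<mu>m) * W CB vp vm \<gamma> Kp Km \<delta> \<eta> = 0)"

end

theory Submission
  imports Defs "HOL-Probability.Levy"
begin

text \<open>
  On the Fourier side the front equation is multiplication by a symbol, so the theorem is a lower
  bound for that symbol together with the passage between distributions and their transforms.

  \<^bold>\<open>The symbol.\<close> Write \<open>v\<close> for \<open>v1p\<close>, \<open>X = \<tau> / C\<^sub>B\<close>, \<open>M = v / C\<^sub>B\<close>, and \<open>mp\<close>, \<open>mm\<close> for the two values of \<open>\<mu>\<close>; then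
  \<open>mp\<^sup>2 = (X + \<i>M\<eta>)\<^sup>2 + \<eta>\<^sup>2\<close> and \<open>mm\<^sup>2 = (X - \<i>M\<eta>)\<^sup>2 + \<eta>\<^sup>2\<close>. Because
  \<open>(mp - mm) (mp + mm) = 4\<i>M X \<eta>\<close>, the quotient in the equation can be removed, and the whole coefficient of the
  transform of \<open>f\<close> collapses to \<open>C\<^sub>B\<^sup>2 (mp mm - \<eta>\<^sup>2)\<close> (\<open>front_symbol_eq\<close>). Multiplied by the conjugate factor
  \<open>mp mm + \<eta>\<^sup>2\<close> it becomes \<open>(X\<^sup>2 + y\<^sub>1 \<eta>\<^sup>2) (X\<^sup>2 + y\<^sub>2 \<eta>\<^sup>2)\<close> with \<open>y\<^sub>1 < y\<^sub>2\<close> the numbers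
  \<open>1 + M\<^sup>2 \<mp> sqrt (1 + 4M\<^sup>2)\<close>. The hypothesis \<open>M > sqrt 2\<close> says exactly that \<open>y\<^sub>1 > 0\<close>: all roots \<open>X\<close> then lie
  on the imaginary axis and are simple, so a factor \<open>X\<^sup>2 + y \<eta>\<^sup>2\<close> is at least a constant times \<open>Re X\<close> times
  \<open>\<Lambda> = (|X|\<^sup>2 + \<eta>\<^sup>2)\<^bsup>1/2\<^esup>\<close>. The second pair of roots is spurious: where \<open>X\<^sup>2 + y\<^sub>2 \<eta>\<^sup>2\<close> is small, \<open>Im X\<close> is so large
  that \<open>mp\<close> and \<open>mm\<close> are close to the same half of the imaginary axis, \<open>mp mm\<close> has negative real part, and
  it is the factor \<open>mp mm + \<eta>\<^sup>2\<close> that vanishes. Hence \<open>|mp mm - \<eta>\<^sup>2|\<close> is bounded below by \<open>Re X \<Lambda>\<close>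
  (\<open>symbol_weakly_elliptic\<close>).

  The source term carries the quotients of \<open>mp\<close> and \<open>mm\<close> by \<open>mp + mm\<close>, and \<open>mp + mm\<close> degenerates too, but only for \<open>X\<close>
  near \<open>0\<close>, where the symbol has size \<open>\<Lambda>\<^sup>2\<close>; the two degenerations never meet, and together they
  cost no more than one of them (\<open>symbol_estimate\<close>). Finally \<open>Re mp\<close> and \<open>Re mm\<close> are at least \<open>Re X\<close>, so the
  Cauchy--Schwarz inequality in \<open>x\<^sub>3\<close> bounds the two Laplace integrals at the price of \<open>\<gamma>\<close> to the power \<open>-1/2\<close>. The total is
  the pointwise estimate \<open>\<gamma>\<^sup>3 \<Lambda>\<^sup>2 |f|\<^sup>2 \<le> C \<integral> |K|\<^sup>2\<close> for transforms (\<open>front_solution_bound\<close>), which is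
  multiplied by \<open>\<Lambda>\<close> to the power \<open>2s\<close> and integrated.

  \<^bold>\<open>Distributions.\<close> The equation prescribes the transform of \<open>f\<close> almost everywhere. Three facts make
  this a statement about distributions. Inverse transforms of test functions decay faster than any power,
  so every function in a weighted \<open>L\<^sup>2\<close> space is the transform of a distribution (\<open>has_fourier_exists\<close>).
  A distribution determines its transform up to null sets: pairing with all
  translates of a test function reduces this to injectivity of the Fourier transform on \<open>L\<^sup>1\<close>, which
  comes from Levy's uniqueness theorem (\<open>has_fourier_unique\<close>). And
  multiplication by \<open>exp (- \<gamma> t)\<close> is a bijection of the distributions (\<open>exp_mult_distributions\<close>, \<open>exp_mult_inverse\<close>).
\<close>

section \<open>The reduced symbol\<close>

text \<open>With \<open>r + \<i>q\<close> the root and \<open>g + \<i>w\<close> the base, real and imaginary parts give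
  \<open>(r\<^sup>2 - g\<^sup>2) (r\<^sup>2 + w\<^sup>2) = r\<^sup>2 \<eta>\<^sup>2\<close>: adding \<open>\<eta>\<^sup>2\<close> under the root only increases the real part.\<close>

lemma Re_root_ge_Re:
  fixes m X :: complex and k \<eta> :: real
  assumes sq: "m\<^sup>2 = (X + \<i> * k)\<^sup>2 + (of_real \<eta>)\<^sup>2" and X: "Re X > 0" and m: "Re m > 0"
  shows "Re X \<le> Re m"
proof -
  define g w r q where "g = Re X" and "w = Im X + k" and "r = Re m" and "q = Im m"
  have re: "r\<^sup>2 - q\<^sup>2 = g\<^sup>2 - w\<^sup>2 + \<eta>\<^sup>2" and im: "r * q = g * w"
    using arg_cong[OF sq, of Re] arg_cong[OF sq, of Im]
    by (simp_all add: power2_eq_square g_def w_def r_def q_def algebra_simps)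
  have "(r\<^sup>2 - g\<^sup>2) * (r\<^sup>2 + w\<^sup>2) = r\<^sup>2 * \<eta>\<^sup>2"
    using re im by algebra
  moreover have "r\<^sup>2 * \<eta>\<^sup>2 \<ge> 0" by simp
  ultimately have "0 * (r\<^sup>2 + w\<^sup>2) \<le> (r\<^sup>2 - g\<^sup>2) * (r\<^sup>2 + w\<^sup>2)" by simp
  then have "0 \<le> r\<^sup>2 - g\<^sup>2"
    by (rule mult_right_le_imp_le) (use m in \<open>simp add: r_def add_pos_nonneg\<close>)
  then show ?thesis using m power2_le_imp_le[of g r] by (simp add: g_def r_def)
qed

text \<open>The distances of \<open>X\<close> to the zeros \<open>\<plusminus>\<i>a\<close> are both at least \<open>Re X\<close>, and by the parallelogram law the sum of
  their squares is \<open>2 (|X|\<^sup>2 + a\<^sup>2)\<close>, so one of them is at least the square root on the left.\<close>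

lemma cmod_sq_add_ge:
  fixes X :: complex and a :: real
  assumes "Re X > 0"
  shows "Re X * sqrt ((cmod X)\<^sup>2 + a\<^sup>2) \<le> cmod (X\<^sup>2 + (of_real a)\<^sup>2)"
proof (rule power2_le_imp_le)
  define g d where "g = Re X" and "d = Im X"
  have l: "(cmod (X\<^sup>2 + (of_real a)\<^sup>2))\<^sup>2 = (g\<^sup>2 - d\<^sup>2 + a\<^sup>2)\<^sup>2 + (2 * g * d)\<^sup>2"
    unfolding cmod_power2 by (simp add: g_def d_def power2_eq_square algebra_simps)
  have r: "(Re X * sqrt ((cmod X)\<^sup>2 + a\<^sup>2))\<^sup>2 = g\<^sup>2 * (g\<^sup>2 + d\<^sup>2 + a\<^sup>2)"
    unfolding power_mult_distrib by (simp add: cmod_power2 g_def d_def add_nonneg_nonneg)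
  have "(g\<^sup>2 - d\<^sup>2 + a\<^sup>2)\<^sup>2 + (2 * g * d)\<^sup>2 - g\<^sup>2 * (g\<^sup>2 + d\<^sup>2 + a\<^sup>2)
     = (d\<^sup>2 - a\<^sup>2)\<^sup>2 + g\<^sup>2 * d\<^sup>2 + g\<^sup>2 * a\<^sup>2"
    by algebra
  also have "\<dots> \<ge> 0" by simp
  finally show "(Re X * sqrt ((cmod X)\<^sup>2 + a\<^sup>2))\<^sup>2 \<le> (cmod (X\<^sup>2 + (of_real a)\<^sup>2))\<^sup>2"
    unfolding l r by (simp only: diff_ge_0_iff_ge)
qed (use assms in \<open>simp add: cmod_power2\<close>)

text \<open>The roots are characterized rather than computed, so that the estimates involve no branch of the square root.\<close>

definition root_pair :: "real \<Rightarrow> complex \<Rightarrow> real \<Rightarrow> complex \<Rightarrow> complex \<Rightarrow> bool"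
  where "root_pair M X \<eta> mp mm \<longleftrightarrow> Re X > 0 \<and> Re mp > 0 \<and> Re mm > 0 \<and>
    mp\<^sup>2 = (X + \<i> * of_real (M * \<eta>))\<^sup>2 + (of_real \<eta>)\<^sup>2 \<and>
    mm\<^sup>2 = (X - \<i> * of_real (M * \<eta>))\<^sup>2 + (of_real \<eta>)\<^sup>2"

lemma root_pair_swap: "root_pair M X \<eta> mp mm \<Longrightarrow> root_pair M X (- \<eta>) mm mp"
  by (simp add: root_pair_def)

lemma root_pair_upper1:
  assumes "root_pair M X \<eta> mp mm" "M > 0"
  shows "(cmod mp)\<^sup>2 \<le> 2 * (1 + M\<^sup>2) * (Lambda X \<eta>)\<^sup>2"
proof -
  have "(cmod mp)\<^sup>2 = cmod ((X + \<i> * of_real (M * \<eta>))\<^sup>2 + (of_real \<eta>)\<^sup>2)"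
    using assms by (simp add: root_pair_def norm_power[symmetric])
  also have "\<dots> \<le> (cmod (X + \<i> * of_real (M * \<eta>)))\<^sup>2 + \<eta>\<^sup>2"
    by (rule order_trans[OF norm_triangle_ineq]) (simp add: norm_power)
  also have "\<dots> \<le> (cmod X + M * \<bar>\<eta>\<bar>)\<^sup>2 + \<eta>\<^sup>2"
  proof -
    have "cmod (X + \<i> * of_real (M * \<eta>)) \<le> cmod X + M * \<bar>\<eta>\<bar>"
      using norm_triangle_ineq[of X "\<i> * of_real (M * \<eta>)"] assms(2)
      by (simp add: norm_mult abs_mult)
    then show ?thesis by (intro add_right_mono power_mono norm_ge_zero)
  qed
  also have "\<dots> \<le> 2 * (cmod X)\<^sup>2 + 2 * M\<^sup>2 * \<eta>\<^sup>2 + \<eta>\<^sup>2"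
  proof -
    have "2 * (cmod X)\<^sup>2 + 2 * M\<^sup>2 * \<eta>\<^sup>2 - (cmod X + M * \<bar>\<eta>\<bar>)\<^sup>2 = (cmod X - M * \<bar>\<eta>\<bar>)\<^sup>2"
      by (simp add: power2_eq_square algebra_simps)
    moreover have "(cmod X - M * \<bar>\<eta>\<bar>)\<^sup>2 \<ge> 0" by simp
    ultimately show ?thesis by linarith
  qed
  also have "\<dots> \<le> 2 * (1 + M\<^sup>2) * ((cmod X)\<^sup>2 + \<eta>\<^sup>2)"
    by (simp add: algebra_simps)
  finally show ?thesis by (simp add: Lambda_def)
qed

lemma root_pair_upper:
  assumes "root_pair M X \<eta> mp mm" "M > 0"
  shows "cmod mp \<le> sqrt (2 * (1 + M\<^sup>2)) * Lambda X \<eta>" (is ?p)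
    and "cmod mm \<le> sqrt (2 * (1 + M\<^sup>2)) * Lambda X \<eta>" (is ?m)
proof -
  have J: "Lambda X \<eta> \<ge> 0" "Lambda X (- \<eta>) = Lambda X \<eta>" by (simp_all add: Lambda_def)
  have "sqrt ((cmod mp)\<^sup>2) \<le> sqrt (2 * (1 + M\<^sup>2) * (Lambda X \<eta>)\<^sup>2)"
    by (rule real_sqrt_le_mono) (rule root_pair_upper1[OF assms])
  then show ?p using J by (simp add: real_sqrt_mult)
  have "sqrt ((cmod mm)\<^sup>2) \<le> sqrt (2 * (1 + M\<^sup>2) * (Lambda X \<eta>)\<^sup>2)"
    using root_pair_upper1[OF root_pair_swap[OF assms(1)] assms(2)] J
    by (intro real_sqrt_le_mono) simp
  then show ?m using J by (simp add: real_sqrt_mult)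
qed

text \<open>The product of the two roots squared is a polynomial, namely \<open>(X\<^sup>2 + (1 + M\<^sup>2) \<eta>\<^sup>2)\<^sup>2 - 4 M\<^sup>2 \<eta>\<^sup>4\<close>, so
  subtracting \<open>\<eta>\<^sup>4\<close> leaves a difference of squares.\<close>

lemma product_roots_factor:
  fixes M \<eta> :: real
  assumes "root_pair M X \<eta> mp mm"
  defines "k \<equiv> sqrt (1 + 4 * M\<^sup>2)"
  shows "(mp * mm - of_real (\<eta>\<^sup>2)) * (mp * mm + of_real (\<eta>\<^sup>2))
    = (X\<^sup>2 + of_real ((1 + M\<^sup>2 - k) * \<eta>\<^sup>2)) * (X\<^sup>2 + of_real ((1 + M\<^sup>2 + k) * \<eta>\<^sup>2))"
proof -
  define w e K :: complex where "w = of_real M * of_real \<eta>" and "e = of_real \<eta>" and "K = of_real k"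
  have k: "K\<^sup>2 * e\<^sup>2 = e\<^sup>2 + 4 * w\<^sup>2"
  proof -
    have "k\<^sup>2 = 1 + 4 * M\<^sup>2" by (simp add: k_def add_nonneg_nonneg)
    then have "K\<^sup>2 = 1 + 4 * (of_real M)\<^sup>2"
      by (simp add: K_def flip: of_real_power)
    then show ?thesis by (simp add: w_def e_def power_mult_distrib algebra_simps)
  qed
  have "(mp * mm - e\<^sup>2) * (mp * mm + e\<^sup>2) = mp\<^sup>2 * mm\<^sup>2 - e ^ 4"
    by (simp add: algebra_simps power2_eq_square power4_eq_xxxx)
  also have "\<dots> = (X\<^sup>2 + 2 * \<i> * X * w - w\<^sup>2 + e\<^sup>2) * (X\<^sup>2 - 2 * \<i> * X * w - w\<^sup>2 + e\<^sup>2) - e ^ 4"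
  proof -
    have "(X + \<i> * w)\<^sup>2 = X\<^sup>2 + 2 * \<i> * X * w - w\<^sup>2" "(X - \<i> * w)\<^sup>2 = X\<^sup>2 - 2 * \<i> * X * w - w\<^sup>2"
      by (simp_all add: power2_sum power2_diff power_mult_distrib)
    moreover have "mp\<^sup>2 = (X + \<i> * w)\<^sup>2 + e\<^sup>2" "mm\<^sup>2 = (X - \<i> * w)\<^sup>2 + e\<^sup>2"
      using assms(1) by (simp_all add: root_pair_def w_def e_def)
    ultimately show ?thesis by simp
  qed
  also have "\<dots> = (X\<^sup>2 - w\<^sup>2 + e\<^sup>2)\<^sup>2 - (2 * \<i> * X * w)\<^sup>2 - e ^ 4"
    by (simp add: algebra_simps power2_eq_square power4_eq_xxxx)
  also have "\<dots> = (X\<^sup>2 - w\<^sup>2 + e\<^sup>2)\<^sup>2 + 4 * X\<^sup>2 * w\<^sup>2 - e ^ 4"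
    by (simp add: power_mult_distrib)
  also have "\<dots> = (X\<^sup>2 + e\<^sup>2 + w\<^sup>2)\<^sup>2 - (K\<^sup>2 * e\<^sup>2) * e\<^sup>2"
    unfolding k by (simp add: algebra_simps power2_eq_square power4_eq_xxxx)
  also have "\<dots> = (X\<^sup>2 + e\<^sup>2 + w\<^sup>2 - K * e\<^sup>2) * (X\<^sup>2 + e\<^sup>2 + w\<^sup>2 + K * e\<^sup>2)"
    by (simp add: algebra_simps power2_eq_square)
  finally show ?thesis
    by (simp add: w_def e_def K_def algebra_simps power_mult_distrib)
qed

lemma product_roots_upper:
  assumes "root_pair M X \<eta> mp mm" "M > 0"
  shows "cmod (mp * mm + of_real (\<eta>\<^sup>2)) \<le> (3 + 2 * M\<^sup>2) * (Lambda X \<eta>)\<^sup>2"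
proof -
  have "cmod (mp * mm) \<le> (sqrt (2 * (1 + M\<^sup>2)) * Lambda X \<eta>) * (sqrt (2 * (1 + M\<^sup>2)) * Lambda X \<eta>)"
    unfolding norm_mult using root_pair_upper[OF assms]
    by (intro mult_mono) (auto simp: Lambda_def)
  also have "\<dots> = 2 * (1 + M\<^sup>2) * (Lambda X \<eta>)\<^sup>2"
  proof -
    have "sqrt (2 * (1 + M\<^sup>2)) * sqrt (2 * (1 + M\<^sup>2)) = 2 * (1 + M\<^sup>2)"
      using zero_le_power2[of M] by (intro real_sqrt_mult_self[THEN trans]) simp
    then show ?thesis unfolding power2_eq_square by (metis mult.assoc mult.commute)
  qed
  finally have "cmod (mp * mm) \<le> 2 * (1 + M\<^sup>2) * (Lambda X \<eta>)\<^sup>2" .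
  moreover have "\<eta>\<^sup>2 \<le> (Lambda X \<eta>)\<^sup>2" by (simp add: Lambda_def)
  moreover have "cmod (mp * mm + of_real (\<eta>\<^sup>2)) \<le> cmod (mp * mm) + \<eta>\<^sup>2"
    by (rule order_trans[OF norm_triangle_ineq]) (simp add: norm_power)
  ultimately show ?thesis by (simp add: algebra_simps)
qed

lemma quadratic_factor_lower:
  fixes y \<eta> :: real
  assumes "Re X > 0" "y > 0"
  shows "min 1 (sqrt y) * Re X * Lambda X \<eta> \<le> cmod (X\<^sup>2 + of_real (y * \<eta>\<^sup>2))"
proof -
  have y: "(sqrt y * \<eta>)\<^sup>2 = y * \<eta>\<^sup>2" using assms by (simp add: power_mult_distrib)
  have "min 1 (sqrt y) * Lambda X \<eta> \<le> sqrt ((cmod X)\<^sup>2 + (sqrt y * \<eta>)\<^sup>2)"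
  proof (rule real_le_rsqrt)
    have "(min 1 (sqrt y))\<^sup>2 \<le> 1" "(min 1 (sqrt y))\<^sup>2 \<le> y"
      using assms(2) power_mono[of "min 1 (sqrt y)" 1 2] power_mono[of "min 1 (sqrt y)" "sqrt y" 2] by auto
    then have "(min 1 (sqrt y))\<^sup>2 * (cmod X)\<^sup>2 \<le> 1 * (cmod X)\<^sup>2" "(min 1 (sqrt y))\<^sup>2 * \<eta>\<^sup>2 \<le> y * \<eta>\<^sup>2"
      by (blast intro: mult_right_mono zero_le_power2)+
    then show "(min 1 (sqrt y) * Lambda X \<eta>)\<^sup>2 \<le> (cmod X)\<^sup>2 + (sqrt y * \<eta>)\<^sup>2"
      unfolding power_mult_distrib y[unfolded power_mult_distrib] Lambda_def
      by (simp add: algebra_simps)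
  qed
  then have "Re X * (min 1 (sqrt y) * Lambda X \<eta>) \<le> Re X * sqrt ((cmod X)\<^sup>2 + (sqrt y * \<eta>)\<^sup>2)"
    using assms(1) by (intro mult_left_mono) auto
  also have "\<dots> \<le> cmod (X\<^sup>2 + (of_real (sqrt y * \<eta>))\<^sup>2)"
    by (rule cmod_sq_add_ge[OF assms(1)])
  also have "(of_real (sqrt y * \<eta>) :: complex)\<^sup>2 = of_real (y * \<eta>\<^sup>2)"
    unfolding y[symmetric] by simp
  finally show ?thesis by (simp add: mult_ac)
qed

lemma root_pair_Re_Im:
  assumes "root_pair M X \<eta> mp mm"
  shows "(Re mp)\<^sup>2 - (Im mp)\<^sup>2 = (Re X)\<^sup>2 + \<eta>\<^sup>2 - (Im X + M * \<eta>)\<^sup>2"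
    and "(Re mm)\<^sup>2 - (Im mm)\<^sup>2 = (Re X)\<^sup>2 + \<eta>\<^sup>2 - (Im X - M * \<eta>)\<^sup>2"
    and "Re mp * Im mp = Re X * (Im X + M * \<eta>)"
    and "Re mm * Im mm = Re X * (Im X - M * \<eta>)"
proof -
  have p: "mp\<^sup>2 = (X + \<i> * of_real (M * \<eta>))\<^sup>2 + (of_real \<eta>)\<^sup>2"
    and m: "mm\<^sup>2 = (X - \<i> * of_real (M * \<eta>))\<^sup>2 + (of_real \<eta>)\<^sup>2"
    using assms by (simp_all add: root_pair_def)
  show "(Re mp)\<^sup>2 - (Im mp)\<^sup>2 = (Re X)\<^sup>2 + \<eta>\<^sup>2 - (Im X + M * \<eta>)\<^sup>2"
    "Re mp * Im mp = Re X * (Im X + M * \<eta>)"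
    using arg_cong[OF p, of Re] arg_cong[OF p, of Im]
    by (simp_all add: power2_eq_square algebra_simps)
  show "(Re mm)\<^sup>2 - (Im mm)\<^sup>2 = (Re X)\<^sup>2 + \<eta>\<^sup>2 - (Im X - M * \<eta>)\<^sup>2"
    "Re mm * Im mm = Re X * (Im X - M * \<eta>)"
    using arg_cong[OF m, of Re] arg_cong[OF m, of Im]
    by (simp_all add: power2_eq_square algebra_simps)
qed

text \<open>Each of \<open>mp\<close>, \<open>mm\<close> has an imaginary part with the sign of \<open>Im X \<plusminus> M\<eta>\<close>, and these signs agree as soon as \<open>Im X\<close> dominates.\<close>

lemma root_pair_Im_product:
  assumes "root_pair M X \<eta> mp mm" "M > 0" "M * \<bar>\<eta>\<bar> \<le> \<bar>Im X\<bar>"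
  shows "Im mp * Im mm \<ge> 0"
proof -
  have pos: "Re X > 0" "Re mp * Re mm > 0" using assms(1) by (simp_all add: root_pair_def)
  have "(M * \<eta>)\<^sup>2 \<le> (Im X)\<^sup>2"
    using assms(2,3) by (subst abs_le_square_iff[symmetric]) (simp add: abs_mult)
  then have "0 \<le> (Re X)\<^sup>2 * ((Im X)\<^sup>2 - (M * \<eta>)\<^sup>2)" by simp
  also have "\<dots> = (Re X * (Im X + M * \<eta>)) * (Re X * (Im X - M * \<eta>))"
    by (simp add: power2_eq_square algebra_simps)
  also have "\<dots> = (Re mp * Re mm) * (Im mp * Im mm)"
    unfolding root_pair_Re_Im(3,4)[OF assms(1), symmetric] by (simp add: mult_ac)
  finally show ?thesis using pos(2) by (simp add: zero_le_mult_iff)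
qed

text \<open>This is the region that contains the spurious roots. Both squares \<open>mp\<^sup>2\<close>, \<open>mm\<^sup>2\<close> have real part
  at most \<open>- \<theta>\<^sup>2/2 (Im X)\<^sup>2\<close>, so \<open>mp\<close> and \<open>mm\<close> are closer to the imaginary than to the real axis, on the same side of
  the real axis; the real part of their product is then nonpositive, and subtracting \<open>\<eta>\<^sup>2\<close> moves it away from \<open>0\<close>.\<close>

lemma elliptic_high_frequency:
  fixes M r \<eta> :: real
  assumes rp: "root_pair M X \<eta> mp mm" and M: "M > 0" and r: "r > M + 1"
    and high: "r * \<bar>\<eta>\<bar> \<le> \<bar>Im X\<bar>"
  defines "\<theta> \<equiv> 1 - (M + 1) / r"
  assumes small: "(Re X)\<^sup>2 \<le> \<theta>\<^sup>2 / 2 * (Im X)\<^sup>2"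
  shows "\<theta>\<^sup>2 / 6 * (Lambda X \<eta>)\<^sup>2 \<le> cmod (mp * mm - of_real (\<eta>\<^sup>2))"
proof -
  define d h where "d = \<bar>Im X\<bar>" and "h = \<bar>\<eta>\<bar>"
  have \<theta>: "0 < \<theta>" "\<theta> \<le> 1" using M r by (simp_all add: \<theta>_def)
  have h: "0 \<le> h" "(M + 1) * h \<le> (1 - \<theta>) * d" "h \<le> d"
  proof -
    show "0 \<le> h" by (simp add: h_def)
    have "h \<le> d / r" using high M r by (simp add: d_def h_def field_simps)
    then have "(M + 1) * h \<le> (M + 1) * (d / r)" using M by (intro mult_left_mono) auto
    then show "(M + 1) * h \<le> (1 - \<theta>) * d" by (simp add: \<theta>_def)
    also have "\<dots> \<le> 1 * d" using \<theta> by (intro mult_right_mono) (auto simp: d_def)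
    finally have "(M + 1) * h \<le> d" by simp
    moreover have "1 * h \<le> (M + 1) * h" using M by (intro mult_right_mono) (auto simp: h_def)
    ultimately show "h \<le> d" by linarith
  qed
  have gap: "\<theta>\<^sup>2 / 2 * d\<^sup>2 \<le> w\<^sup>2 - (Re X)\<^sup>2 - \<eta>\<^sup>2" if w: "\<bar>w\<bar> \<ge> d - M * h" for w
  proof -
    \<comment> \<open>\<open>\<theta>\<close> measures how far \<open>(M + 1) h\<close> stays below \<open>d\<close>; one \<open>h\<close> of it pays for \<open>\<eta>\<^sup>2\<close>\<close>
    have "\<theta> * d + h \<le> d - M * h" using h(2) by (simp add: algebra_simps)
    then have "\<theta> * d + h \<le> \<bar>w\<bar>" using w by linarith
    then have "(\<theta> * d + h)\<^sup>2 \<le> \<bar>w\<bar>\<^sup>2"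
      using \<theta> h by (intro power_mono) (auto simp: d_def)
    moreover have "(\<theta> * d)\<^sup>2 + h\<^sup>2 \<le> (\<theta> * d + h)\<^sup>2"
      using \<theta> h by (simp add: power2_sum d_def)
    ultimately show ?thesis using small by (simp add: power_mult_distrib d_def h_def)
  qed
  have wp: "\<bar>Im X + M * \<eta>\<bar> \<ge> d - M * h" and wm: "\<bar>Im X - M * \<eta>\<bar> \<ge> d - M * h"
    using abs_triangle_ineq2[of "Im X" "- (M * \<eta>)"] abs_triangle_ineq2[of "Im X" "M * \<eta>"] M
    by (simp_all add: d_def h_def abs_mult)
  have gp: "\<theta>\<^sup>2 / 2 * d\<^sup>2 \<le> (Im mp)\<^sup>2 - (Re mp)\<^sup>2" and gm: "\<theta>\<^sup>2 / 2 * d\<^sup>2 \<le> (Im mm)\<^sup>2 - (Re mm)\<^sup>2"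
    using gap[OF wp] gap[OF wm] root_pair_Re_Im(1,2)[OF rp] by linarith+
  have "0 \<le> \<theta>\<^sup>2 / 2 * d\<^sup>2" by simp
  then have "(Re mp)\<^sup>2 \<le> (Im mp)\<^sup>2" "(Re mm)\<^sup>2 \<le> (Im mm)\<^sup>2" using gp gm by linarith+
  then have "\<bar>Re mp\<bar> * \<bar>Re mm\<bar> \<le> \<bar>Im mp\<bar> * \<bar>Im mm\<bar>"
    unfolding abs_le_square_iff[symmetric] by (intro mult_mono) auto
  moreover have "M * h \<le> d"
  proof -
    have "(1 - \<theta>) * d \<le> 1 * d" using \<theta> by (intro mult_right_mono) (auto simp: d_def)
    then show ?thesis using h(1,2) by (simp add: algebra_simps)
  qed
  then have "Im mp * Im mm \<ge> 0"
    using root_pair_Im_product[OF rp M] by (simp add: d_def h_def)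
  ultimately have neg: "Re (mp * mm) \<le> 0" using rp
    by (simp add: root_pair_def flip: abs_mult)
  have "(cmod (mp * mm))\<^sup>2 \<le> (cmod (mp * mm - of_real (\<eta>\<^sup>2)))\<^sup>2"
  proof -
    have "(cmod (z - of_real a))\<^sup>2 = (cmod z)\<^sup>2 + 2 * (- Re z) * a + a\<^sup>2" for z a
      unfolding cmod_power2 by (simp add: power2_eq_square algebra_simps)
    from this[of "mp * mm" "\<eta>\<^sup>2"]
    have "(cmod (mp * mm - of_real (\<eta>\<^sup>2)))\<^sup>2
        = (cmod (mp * mm))\<^sup>2 + 2 * (- Re (mp * mm)) * \<eta>\<^sup>2 + (\<eta>\<^sup>2)\<^sup>2" .
    moreover have "0 \<le> 2 * (- Re (mp * mm)) * \<eta>\<^sup>2"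
      using neg by (intro mult_nonneg_nonneg) auto
    ultimately show ?thesis using zero_le_power2[of "\<eta>\<^sup>2"] by linarith
  qed
  then have "cmod (mp * mm) \<le> cmod (mp * mm - of_real (\<eta>\<^sup>2))"
    by (rule power2_le_imp_le) simp
  moreover have "\<theta>\<^sup>2 / 2 * d\<^sup>2 \<le> cmod (mp * mm)"
  proof (rule power2_le_imp_le)
    have "\<theta>\<^sup>2 / 2 * d\<^sup>2 \<le> (cmod mp)\<^sup>2" "\<theta>\<^sup>2 / 2 * d\<^sup>2 \<le> (cmod mm)\<^sup>2"
      using gp gm zero_le_power2[of "Re mp"] zero_le_power2[of "Re mm"] unfolding cmod_power2 by linarith+
    then have "(\<theta>\<^sup>2 / 2 * d\<^sup>2) * (\<theta>\<^sup>2 / 2 * d\<^sup>2) \<le> (cmod mp)\<^sup>2 * (cmod mm)\<^sup>2"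
      by (intro mult_mono) auto
    then show "(\<theta>\<^sup>2 / 2 * d\<^sup>2)\<^sup>2 \<le> (cmod (mp * mm))\<^sup>2"
      by (simp only: norm_mult power_mult_distrib power2_eq_square mult_ac)
  qed simp
  moreover have "\<theta>\<^sup>2 / 6 * (Lambda X \<eta>)\<^sup>2 \<le> \<theta>\<^sup>2 / 6 * (3 * d\<^sup>2)"
  proof (rule mult_left_mono)
    have "\<theta>\<^sup>2 / 2 * (Im X)\<^sup>2 \<le> 1 * (Im X)\<^sup>2"
      using \<theta> power_mono[of \<theta> 1 2] by (intro mult_right_mono) auto
    moreover have "\<eta>\<^sup>2 \<le> d\<^sup>2" using h power_mono[of h d 2] by (simp add: h_def)
    ultimately show "(Lambda X \<eta>)\<^sup>2 \<le> 3 * d\<^sup>2"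
      using small by (simp add: Lambda_def cmod_power2 d_def)
  qed simp
  ultimately show ?thesis by simp
qed

text \<open>Outside the region of \<open>elliptic_high_frequency\<close>, either \<open>Im X\<close> stays below the root \<open>sqrt y |\<eta>|\<close> by a fixed
  factor and the real part alone suffices, or \<open>Re X\<close> is comparable with \<open>\<Lambda>\<close> and there is no loss in
  \<open>quadratic_factor_lower\<close>.\<close>

lemma second_factor_elliptic:
  fixes r \<theta> y \<eta> :: real
  assumes X: "Re X > 0" and r: "r > 1" "r\<^sup>2 < y" and \<theta>: "\<theta> > 0"
    and region: "\<bar>Im X\<bar> < r * \<bar>\<eta>\<bar> \<or> (Re X)\<^sup>2 > \<theta>\<^sup>2 / 2 * (Im X)\<^sup>2"
  shows "min (min 1 ((y - r\<^sup>2) / (1 + r\<^sup>2))) (1 / sqrt (1 + 4 / \<theta>\<^sup>2)) * (Lambda X \<eta>)\<^sup>2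
    \<le> cmod (X\<^sup>2 + of_real (y * \<eta>\<^sup>2))"
proof (cases "\<bar>Im X\<bar> < r * \<bar>\<eta>\<bar>")
  case True
  define c where "c = min 1 ((y - r\<^sup>2) / (1 + r\<^sup>2))"
  have c: "0 \<le> c" "c \<le> 1" "c * (1 + r\<^sup>2) \<le> y - r\<^sup>2"
  proof -
    have p: "1 + r\<^sup>2 > 0" by (simp add: add_pos_nonneg)
    show "0 \<le> c" using r p by (simp add: c_def)
    show "c \<le> 1" by (simp add: c_def)
    have "c \<le> (y - r\<^sup>2) / (1 + r\<^sup>2)" by (simp add: c_def)
    then show "c * (1 + r\<^sup>2) \<le> y - r\<^sup>2" using p by (simp add: pos_le_divide_eq)
  qed
  have d: "(Im X)\<^sup>2 \<le> r\<^sup>2 * \<eta>\<^sup>2"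
    using power_mono[OF less_imp_le[OF True], of 2] by (simp add: power_mult_distrib)
  have "c * (Lambda X \<eta>)\<^sup>2 = c * (Re X)\<^sup>2 + c * ((Im X)\<^sup>2 + \<eta>\<^sup>2)"
    by (simp add: Lambda_def cmod_power2 algebra_simps)
  also have "\<dots> \<le> 1 * (Re X)\<^sup>2 + c * (r\<^sup>2 * \<eta>\<^sup>2 + \<eta>\<^sup>2)"
    using c d by (intro add_mono mult_right_mono mult_left_mono) auto
  also have "c * (r\<^sup>2 * \<eta>\<^sup>2 + \<eta>\<^sup>2) = (c * (1 + r\<^sup>2)) * \<eta>\<^sup>2" by (simp add: algebra_simps)
  also have "\<dots> \<le> (y - r\<^sup>2) * \<eta>\<^sup>2" using c by (intro mult_right_mono) auto
  also have "1 * (Re X)\<^sup>2 + (y - r\<^sup>2) * \<eta>\<^sup>2 \<le> (Re X)\<^sup>2 - (Im X)\<^sup>2 + y * \<eta>\<^sup>2"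
    using d by (simp add: algebra_simps)
  also have "\<dots> = Re (X\<^sup>2 + of_real (y * \<eta>\<^sup>2))"
    by (simp only: plus_complex.sel Re_complex_of_real Re_power2)
  also have "\<dots> \<le> cmod (X\<^sup>2 + of_real (y * \<eta>\<^sup>2))" by (rule complex_Re_le_cmod)
  finally have "c * (Lambda X \<eta>)\<^sup>2 \<le> cmod (X\<^sup>2 + of_real (y * \<eta>\<^sup>2))" by simp
  moreover have "min c (1 / sqrt (1 + 4 / \<theta>\<^sup>2)) * (Lambda X \<eta>)\<^sup>2 \<le> c * (Lambda X \<eta>)\<^sup>2"
    by (intro mult_right_mono) auto
  ultimately show ?thesis unfolding c_def by linarith
next
  case False
  define q where "q = sqrt (1 + 4 / \<theta>\<^sup>2)"
  have q: "q > 0" by (simp add: q_def add_pos_nonneg)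
  have big: "(Im X)\<^sup>2 \<le> 2 / \<theta>\<^sup>2 * (Re X)\<^sup>2" using region False \<theta> by (simp add: field_simps)
  have "1 * \<bar>\<eta>\<bar> \<le> r * \<bar>\<eta>\<bar>" using r by (intro mult_right_mono) auto
  then have "\<eta>\<^sup>2 \<le> (Im X)\<^sup>2" using False by (subst abs_le_square_iff[symmetric]) linarith
  then have "(Lambda X \<eta>)\<^sup>2 \<le> (Re X)\<^sup>2 + 2 * (2 / \<theta>\<^sup>2 * (Re X)\<^sup>2)"
    using big by (simp add: Lambda_def cmod_power2)
  also have "\<dots> = (q * Re X)\<^sup>2"
  proof -
    have "q\<^sup>2 = 1 + 4 / \<theta>\<^sup>2" by (simp add: q_def add_nonneg_nonneg)
    then show ?thesis by (simp add: power_mult_distrib algebra_simps)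
  qed
  finally have "Lambda X \<eta> \<le> q * Re X"
    by (rule power2_le_imp_le) (use q X in simp)
  then have "Lambda X \<eta> * Lambda X \<eta> \<le> q * Re X * Lambda X \<eta>"
    by (rule mult_right_mono) (simp add: Lambda_def)
  then have "(1 / q) * (Lambda X \<eta>)\<^sup>2 \<le> Re X * Lambda X \<eta>"
    using q by (simp add: field_simps power2_eq_square)
  also have "\<dots> \<le> cmod (X\<^sup>2 + of_real (y * \<eta>\<^sup>2))"
  proof -
    have "1 < r\<^sup>2" using r(1) by (simp add: one_less_power)
    then have "y > 1" using r(2) by linarith
    then show ?thesis using quadratic_factor_lower[OF X, of y \<eta>] by simp
  qed
  finally have "1 / q * (Lambda X \<eta>)\<^sup>2 \<le> cmod (X\<^sup>2 + of_real (y * \<eta>\<^sup>2))" .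
  moreover have "min (min 1 ((y - r\<^sup>2) / (1 + r\<^sup>2))) (1 / q) * (Lambda X \<eta>)\<^sup>2 \<le> 1 / q * (Lambda X \<eta>)\<^sup>2"
    by (intro mult_right_mono) auto
  ultimately show ?thesis unfolding q_def by linarith
qed

lemma root_pair_Lambda_pos: "root_pair M X \<eta> mp mm \<Longrightarrow> Lambda X \<eta> > 0"
  by (cases "X = 0") (auto simp: root_pair_def Lambda_def intro!: add_pos_nonneg)

lemma root_pair_Lambda_ge: "root_pair M X \<eta> mp mm \<Longrightarrow> Re X \<le> Lambda X \<eta>"
  using complex_Re_le_cmod[of X] unfolding Lambda_def
  by (intro order_trans[OF complex_Re_le_cmod] real_le_rsqrt) simp

text \<open>The product of the two numbers \<open>1 + M\<^sup>2 \<mp> k\<close> is \<open>M\<^sup>2 (M\<^sup>2 - 2)\<close>; this is where the hypothesis on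
  the Mach number enters. The last inequality leaves room for the ratio \<open>r\<close> of \<open>elliptic_high_frequency\<close>.\<close>

lemma reduced_roots_location:
  fixes M :: real
  assumes M: "M > sqrt 2"
  defines "k \<equiv> sqrt (1 + 4 * M\<^sup>2)"
  shows "M > 0" "k > 0" "1 + M\<^sup>2 - k > 0" "(M + 1)\<^sup>2 < 1 + M\<^sup>2 + k"
proof -
  show M0: "M > 0" using M real_sqrt_gt_zero[of 2] by linarith
  have M2: "M\<^sup>2 > 2" using power_strict_mono[OF M, of 2] by simp
  have k2: "k\<^sup>2 = 1 + 4 * M\<^sup>2" by (simp add: k_def add_nonneg_nonneg)
  show k0: "k > 0" by (simp add: k_def add_pos_nonneg)
  have "(1 + M\<^sup>2)\<^sup>2 - k\<^sup>2 = M\<^sup>2 * (M\<^sup>2 - 2)"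
    unfolding k2 by (simp add: power2_eq_square algebra_simps)
  also have "\<dots> > 0" using M2 by (intro mult_pos_pos) auto
  finally have "k\<^sup>2 < (1 + M\<^sup>2)\<^sup>2" by simp
  then have "k < 1 + M\<^sup>2" by (rule power_less_imp_less_base) (simp add: add_nonneg_nonneg)
  then show "1 + M\<^sup>2 - k > 0" by simp
  have "(2 * M)\<^sup>2 < k\<^sup>2" unfolding k2 by (simp add: power_mult_distrib)
  then have "2 * M < k" using k0 by (intro power_less_imp_less_base[of "2*M" 2 k]) auto
  then show "(M + 1)\<^sup>2 < 1 + M\<^sup>2 + k" by (simp add: power2_sum)
qed

text \<open>Weak ellipticity: the symbol is of order two, and the bound loses exactly one power of \<open>\<Lambda>\<close> to
  \<open>Re X\<close>, because of the simple roots \<open>X = \<plusminus>\<i> sqrt y\<^sub>1 \<eta>\<close>.\<close>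

lemma symbol_weakly_elliptic:
  assumes M: "M > sqrt 2"
  shows "\<exists>c>0. \<forall>X \<eta> mp mm. root_pair M X \<eta> mp mm \<longrightarrow>
    c * Re X * Lambda X \<eta> \<le> cmod (mp * mm - of_real (\<eta>\<^sup>2))"
proof -
  define k where "k = sqrt (1 + 4 * M\<^sup>2)"
  define y1 y2 where "y1 = 1 + M\<^sup>2 - k" and "y2 = 1 + M\<^sup>2 + k"
  note roots = reduced_roots_location[OF M, folded k_def]
  have M0: "M > 0" by (rule roots(1))
  have y1: "y1 > 0" and y2: "(M + 1)\<^sup>2 < y2" using roots(3,4) by (simp_all add: y1_def y2_def)
  \<comment> \<open>any ratio strictly between \<open>M + 1\<close> and \<open>sqrt y2\<close> separates the two regions\<close>
  define r where "r = (M + 1 + sqrt y2) / 2"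
  have s: "M + 1 < sqrt y2" using y2 M0 by (simp add: real_less_rsqrt)
  have r: "M + 1 < r" "r\<^sup>2 < y2" "r > 1"
  proof -
    show "M + 1 < r" using s by (simp add: r_def)
    then show "r > 1" using M0 by simp
    have "r < sqrt y2" using s by (simp add: r_def)
    then have "r\<^sup>2 < (sqrt y2)\<^sup>2" using \<open>r > 1\<close> by (intro power_strict_mono) auto
    moreover have "y2 > 0" using y2 zero_le_power2[of "M + 1"] by linarith
    ultimately show "r\<^sup>2 < y2" by simp
  qed
  define \<theta> where "\<theta> = 1 - (M + 1) / r"
  have \<theta>: "\<theta> > 0" using r M0 by (simp add: \<theta>_def)
  define c1 where "c1 = min 1 (sqrt y1)"
  define c2 where "c2 = min (min 1 ((y2 - r\<^sup>2) / (1 + r\<^sup>2))) (1 / sqrt (1 + 4 / \<theta>\<^sup>2))"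
  define K where "K = 3 + 2 * M\<^sup>2"
  have pos: "c1 > 0" "c2 > 0" "K > 0"
    using y1 r \<theta> by (simp_all add: c1_def c2_def K_def add_pos_nonneg)
  define c where "c = min (\<theta>\<^sup>2 / 6) (c1 * c2 / K)"
  have c: "c > 0" using pos \<theta> by (simp add: c_def)
  have c6: "c \<le> \<theta>\<^sup>2 / 6" and cK: "c \<le> c1 * c2 / K"
    unfolding c_def by (rule min.cobounded1, rule min.cobounded2)
  have "c * Re X * Lambda X \<eta> \<le> cmod (mp * mm - of_real (\<eta>\<^sup>2))"
    if rp: "root_pair M X \<eta> mp mm" for X \<eta> mp mm
  proof (cases "r * \<bar>\<eta>\<bar> \<le> \<bar>Im X\<bar> \<and> (Re X)\<^sup>2 \<le> \<theta>\<^sup>2 / 2 * (Im X)\<^sup>2")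
    case True
    have "c * (Re X * Lambda X \<eta>) \<le> \<theta>\<^sup>2 / 6 * (Lambda X \<eta> * Lambda X \<eta>)"
      using root_pair_Lambda_ge[OF rp] root_pair_Lambda_pos[OF rp] rp c c6
      by (intro mult_mono) (auto simp: root_pair_def)
    also have "\<dots> \<le> cmod (mp * mm - of_real (\<eta>\<^sup>2))"
      using elliptic_high_frequency[OF rp M0 r(1)] True by (simp add: \<theta>_def power2_eq_square)
    finally show ?thesis by (simp add: mult_ac)
  next
    case False
    let ?L = "Lambda X \<eta>"
    have X: "Re X > 0" using rp by (simp add: root_pair_def)
    have L: "?L > 0" by (rule root_pair_Lambda_pos[OF rp])
    have "(c1 * Re X * ?L) * (c2 * ?L\<^sup>2) \<le> cmod (X\<^sup>2 + of_real (y1 * \<eta>\<^sup>2)) * cmod (X\<^sup>2 + of_real (y2 * \<eta>\<^sup>2))"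
      unfolding c1_def c2_def
      using quadratic_factor_lower[OF X y1, of \<eta>] second_factor_elliptic[OF X r(3,2) \<theta>, of \<eta>] False pos L
      unfolding c1_def c2_def by (intro mult_mono) auto
    also have "\<dots> = cmod (mp * mm - of_real (\<eta>\<^sup>2)) * cmod (mp * mm + of_real (\<eta>\<^sup>2))"
      unfolding norm_mult[symmetric] product_roots_factor[OF rp] y1_def y2_def k_def ..
    also have "\<dots> \<le> cmod (mp * mm - of_real (\<eta>\<^sup>2)) * (K * ?L\<^sup>2)"
      unfolding K_def by (intro mult_left_mono product_roots_upper[OF rp M0]) simp
    finally have "(c1 * c2 * Re X * ?L) * ?L\<^sup>2 \<le> (K * cmod (mp * mm - of_real (\<eta>\<^sup>2))) * ?L\<^sup>2"
      by (simp only: mult_ac)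
    then have "c1 * c2 * Re X * ?L \<le> K * cmod (mp * mm - of_real (\<eta>\<^sup>2))"
      by (rule mult_right_le_imp_le) (use L in simp)
    then have "c1 * c2 / K * (Re X * ?L) \<le> cmod (mp * mm - of_real (\<eta>\<^sup>2))"
      using pos by (simp add: field_simps)
    moreover have "c * (Re X * ?L) \<le> c1 * c2 / K * (Re X * ?L)"
      using cK X L by (intro mult_right_mono) auto
    ultimately show ?thesis by (simp add: mult_ac)
  qed
  with c show ?thesis by blast
qed

text \<open>In these regions the two roots form an angle of at most ninety degrees: either their
  imaginary parts have equal sign, or both lie in the sector around the positive real axis.\<close>

lemma root_le_sum:
  assumes rp: "root_pair M X \<eta> mp mm" and M: "M > 0"
    and region: "M * \<bar>\<eta>\<bar> \<le> \<bar>Im X\<bar> \<or> 4 * M\<^sup>2 * \<eta>\<^sup>2 \<le> (Re X)\<^sup>2"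
  shows "cmod mp \<le> cmod (mp + mm)" "cmod mm \<le> cmod (mp + mm)"
proof -
  have pos: "Re mp > 0" "Re mm > 0" using rp by (simp_all add: root_pair_def)
  have cross: "0 \<le> Re mp * Re mm + Im mp * Im mm"
  proof (cases "M * \<bar>\<eta>\<bar> \<le> \<bar>Im X\<bar>")
    case True
    then have "0 \<le> Im mp * Im mm" by (rule root_pair_Im_product[OF rp M])
    moreover have "0 \<le> Re mp * Re mm" using pos by simp
    ultimately show ?thesis by simp
  next
    case False
    have "(Im X + e)\<^sup>2 \<le> (Re X)\<^sup>2 + \<eta>\<^sup>2" if "\<bar>e\<bar> = M * \<bar>\<eta>\<bar>" for e
    proof -
      have "\<bar>Im X + e\<bar> \<le> \<bar>2 * M * \<eta>\<bar>" using False that M by (simp add: abs_mult)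
      then have "(Im X + e)\<^sup>2 \<le> (2 * M * \<eta>)\<^sup>2" by (simp only: abs_le_square_iff)
      then have "(Im X + e)\<^sup>2 \<le> 4 * M\<^sup>2 * \<eta>\<^sup>2" by (simp add: power_mult_distrib)
      moreover have "4 * M\<^sup>2 * \<eta>\<^sup>2 \<le> (Re X)\<^sup>2" using region False by blast
      ultimately show ?thesis using zero_le_power2[of \<eta>] by linarith
    qed
    from this[of "M * \<eta>"] this[of "- (M * \<eta>)"] M
    have "(Im mp)\<^sup>2 \<le> (Re mp)\<^sup>2" "(Im mm)\<^sup>2 \<le> (Re mm)\<^sup>2"
      using root_pair_Re_Im(1,2)[OF rp] by (simp_all add: abs_mult)
    then have "\<bar>Im mp\<bar> * \<bar>Im mm\<bar> \<le> \<bar>Re mp\<bar> * \<bar>Re mm\<bar>"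
      unfolding abs_le_square_iff[symmetric] by (intro mult_mono) auto
    then have "\<bar>Im mp * Im mm\<bar> \<le> Re mp * Re mm" using pos by (simp add: abs_mult)
    then show ?thesis by linarith
  qed
  have sum: "(cmod (mp + mm))\<^sup>2 = (cmod mp)\<^sup>2 + (cmod mm)\<^sup>2 + 2 * (Re mp * Re mm + Im mp * Im mm)"
    unfolding cmod_power2 by (simp add: power2_eq_square algebra_simps)
  have "(cmod mp)\<^sup>2 \<le> (cmod (mp + mm))\<^sup>2" "(cmod mm)\<^sup>2 \<le> (cmod (mp + mm))\<^sup>2"
    using cross unfolding sum by simp_all
  then show "cmod mp \<le> cmod (mp + mm)" "cmod mm \<le> cmod (mp + mm)"
    by (auto intro: power2_le_imp_le)
qed

lemma cmod_add_of_real_ge: "\<bar>a\<bar> - cmod z \<le> cmod (z + of_real a)"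
  using norm_triangle_ineq4[of "z + of_real a" z] by simp

text \<open>Outside the regions of \<open>root_le_sum\<close>, \<open>\<Lambda>\<close> is comparable with \<open>|\<eta>|\<close>, and \<open>(mp + mm) (mp - mm) = 4\<i>M X \<eta>\<close> shows that
  \<open>|mp + mm|\<close> is at least of size \<open>|X|\<close>. For \<open>|X|\<close> small compared with \<open>|\<eta>|\<close> both quadratic factors, and with
  them the symbol, are of size \<open>\<eta>\<^sup>2\<close>, while \<open>|X| \<ge> Re X\<close>; otherwise \<open>|X|\<close> has size \<open>\<Lambda>\<close> and the weak bound is enough.\<close>

lemma symbol_estimate:
  assumes M: "M > sqrt 2"
  shows "\<exists>c>0. \<forall>X \<eta> mp mm. root_pair M X \<eta> mp mm \<longrightarrow>
    c * Re X * Lambda X \<eta> * cmod mp \<le> cmod (mp * mm - of_real (\<eta>\<^sup>2)) * cmod (mp + mm) \<and>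
    c * Re X * Lambda X \<eta> * cmod mm \<le> cmod (mp * mm - of_real (\<eta>\<^sup>2)) * cmod (mp + mm)"
proof -
  obtain c0 where c0: "c0 > 0" and weak: "\<And>X \<eta> mp mm. root_pair M X \<eta> mp mm \<Longrightarrow>
    c0 * Re X * Lambda X \<eta> \<le> cmod (mp * mm - of_real (\<eta>\<^sup>2))"
    using symbol_weakly_elliptic[OF M] by blast
  define k where "k = sqrt (1 + 4 * M\<^sup>2)"
  define y1 y2 where "y1 = 1 + M\<^sup>2 - k" and "y2 = 1 + M\<^sup>2 + k"
  note roots = reduced_roots_location[OF M, folded k_def]
  have M0: "M > 0" and k0: "k > 0" by (rule roots)+
  have y1: "y1 > 0" using roots(3) by (simp add: y1_def)
  define B where "B = sqrt (2 * (1 + M\<^sup>2))"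
  define K where "K = 3 + 2 * M\<^sup>2"
  define R where "R = 1 + 5 * M\<^sup>2"
  define b where "b = 2 * M / (B * sqrt R)"
  \<comment> \<open>\<open>e0\<close> is the ellipticity constant for small \<open>|X|\<close>, \<open>e1\<close> the ratio \<open>|X| / \<Lambda>\<close> otherwise\<close>
  define e0 where "e0 = y1\<^sup>2 / (4 * R\<^sup>2 * K)"
  define e1 where "e1 = sqrt (y1 / (2 * R))"
  have BKR: "B > 0" "K > 0" "R > 0"
    by (simp_all add: B_def K_def R_def add_pos_nonneg)
  have pos: "B > 0" "K > 0" "R > 0" "b > 0" "e0 > 0" "e1 > 0"
    using M0 y1 BKR by (simp_all add: b_def e0_def e1_def)
  define c1 where "c1 = min (e0 * b) (c0 * b * e1)"
  define c where "c = min c0 (c1 / B)"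
  have c: "c > 0" "c \<le> c0" "c * B \<le> e0 * b" "c * B \<le> c0 * b * e1"
  proof -
    have "c1 > 0" using pos c0 by (simp add: c1_def)
    then show "c > 0" using pos c0 by (simp add: c_def)
    show "c \<le> c0" by (simp add: c_def)
    have "c \<le> c1 / B" by (simp add: c_def)
    then have "c * B \<le> c1" using pos by (simp add: pos_le_divide_eq)
    then show "c * B \<le> e0 * b" "c * B \<le> c0 * b * e1" by (simp_all add: c1_def)
  qed
  have main: "c * Re X * Lambda X \<eta> * cmod mp \<le> cmod (mp * mm - of_real (\<eta>\<^sup>2)) * cmod (mp + mm) \<and>
    c * Re X * Lambda X \<eta> * cmod mm \<le> cmod (mp * mm - of_real (\<eta>\<^sup>2)) * cmod (mp + mm)"
    if rp: "root_pair M X \<eta> mp mm" for X \<eta> mp mm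
  proof -
    let ?L = "Lambda X \<eta>" and ?S = "cmod (mp * mm - of_real (\<eta>\<^sup>2))"
    have X: "Re X > 0" using rp by (simp add: root_pair_def)
    have L: "?L > 0" by (rule root_pair_Lambda_pos[OF rp])
    have wk: "c * Re X * ?L \<le> ?S"
      by (rule order_trans[OF _ weak[OF rp]]) (use X L c in \<open>intro mult_right_mono, auto\<close>)
    show ?thesis
    proof (cases "M * \<bar>\<eta>\<bar> \<le> \<bar>Im X\<bar> \<or> 4 * M\<^sup>2 * \<eta>\<^sup>2 \<le> (Re X)\<^sup>2")
      case True
      then show ?thesis using root_le_sum[OF rp M0 True] wk X L c
        by (auto intro!: mult_mono)
    next
      case False
      have d: "(Im X)\<^sup>2 \<le> M\<^sup>2 * \<eta>\<^sup>2"
      proof -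
        have "\<bar>Im X\<bar> \<le> \<bar>M * \<eta>\<bar>" using False M0 by (simp add: abs_mult)
        then have "(Im X)\<^sup>2 \<le> (M * \<eta>)\<^sup>2" by (simp only: abs_le_square_iff)
        then show ?thesis by (simp add: power_mult_distrib)
      qed
      have LR: "?L\<^sup>2 \<le> R * \<eta>\<^sup>2" using False d
        by (simp add: Lambda_def cmod_power2 R_def algebra_simps)
      have \<eta>: "\<eta>\<^sup>2 > 0"
      proof (rule ccontr)
        assume "\<not> \<eta>\<^sup>2 > 0"
        then have "?L\<^sup>2 \<le> 0" using LR by simp
        then show False using L by simp
      qed
      have L\<eta>: "?L \<le> sqrt R * \<bar>\<eta>\<bar>"
        using real_sqrt_le_mono[OF LR] L by (simp add: real_sqrt_mult)
      have sum: "b * cmod X \<le> cmod (mp + mm)"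
      proof -
        have "(mp + mm) * (mp - mm) = mp\<^sup>2 - mm\<^sup>2" by (simp add: power2_eq_square algebra_simps)
        also have "\<dots> = 4 * \<i> * X * of_real (M * \<eta>)"
        proof -
          have "mp\<^sup>2 - mm\<^sup>2 = (X + \<i> * of_real (M * \<eta>))\<^sup>2 - (X - \<i> * of_real (M * \<eta>))\<^sup>2"
            using rp by (simp add: root_pair_def)
          also have "\<dots> = 4 * \<i> * X * of_real (M * \<eta>)"
            by (simp add: power2_sum power2_diff)
          finally show ?thesis .
        qed
        finally have "cmod (mp + mm) * cmod (mp - mm) = 4 * cmod X * (M * \<bar>\<eta>\<bar>)"
          using M0 by (simp add: norm_mult[symmetric]) (simp add: norm_mult)
        moreover have "cmod (mp - mm) \<le> 2 * B * ?L"
          using norm_triangle_ineq4[of mp mm] root_pair_upper[OF rp M0] unfolding B_def by linarith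
        then have "cmod (mp + mm) * cmod (mp - mm) \<le> cmod (mp + mm) * (2 * B * (sqrt R * \<bar>\<eta>\<bar>))"
          using L\<eta> pos by (intro mult_left_mono order_trans[OF _ mult_left_mono[OF L\<eta>]]) auto
        ultimately have "(4 * cmod X * M) * \<bar>\<eta>\<bar> \<le> (cmod (mp + mm) * (2 * B * sqrt R)) * \<bar>\<eta>\<bar>"
          by (simp only: mult_ac)
        then have "4 * cmod X * M \<le> cmod (mp + mm) * (2 * B * sqrt R)"
          by (rule mult_right_le_imp_le) (use \<eta> in simp)
        then show ?thesis using pos by (simp add: b_def field_simps)
      qed
      have "c * B * (Re X * ?L\<^sup>2) \<le> ?S * cmod (mp + mm)"
      proof (cases "(cmod X)\<^sup>2 \<le> y1 / 2 * \<eta>\<^sup>2")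
        case True
        have "y1 / 2 * \<eta>\<^sup>2 \<le> cmod (X\<^sup>2 + of_real (y * \<eta>\<^sup>2))" if "y \<ge> y1" for y
        proof -
          have "y1 * \<eta>\<^sup>2 \<le> y * \<eta>\<^sup>2" using that by (intro mult_right_mono) auto
          moreover have "\<bar>y * \<eta>\<^sup>2\<bar> = y * \<eta>\<^sup>2" using that y1 by simp
          ultimately show ?thesis
            using True cmod_add_of_real_ge[of "y * \<eta>\<^sup>2" "X\<^sup>2"] by (simp add: norm_power)
        qed
        note this[OF order_refl] this[of y2]
        moreover have "y1 \<le> y2" using k0 by (simp add: y1_def y2_def)
        ultimately have "(y1 / 2 * \<eta>\<^sup>2) * (y1 / 2 * \<eta>\<^sup>2)
            \<le> cmod (X\<^sup>2 + of_real (y1 * \<eta>\<^sup>2)) * cmod (X\<^sup>2 + of_real (y2 * \<eta>\<^sup>2))"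
          using y1 by (intro mult_mono) (simp_all del: of_real_mult)
        also have "\<dots> = ?S * cmod (mp * mm + of_real (\<eta>\<^sup>2))"
          unfolding norm_mult[symmetric] product_roots_factor[OF rp] y1_def y2_def k_def ..
        also have "\<dots> \<le> ?S * (K * ?L\<^sup>2)"
          unfolding K_def by (intro mult_left_mono product_roots_upper[OF rp M0]) simp
        finally have S: "(y1 / 2)\<^sup>2 * (\<eta>\<^sup>2)\<^sup>2 \<le> ?S * K * ?L\<^sup>2" by (simp only: power2_eq_square mult_ac)
        have "(?L\<^sup>2)\<^sup>2 \<le> (R * \<eta>\<^sup>2)\<^sup>2" using LR by (intro power_mono) auto
        then have "(y1 / 2)\<^sup>2 / R\<^sup>2 * (?L\<^sup>2)\<^sup>2 \<le> (y1 / 2)\<^sup>2 / R\<^sup>2 * (R * \<eta>\<^sup>2)\<^sup>2"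
          by (intro mult_left_mono) auto
        also have "\<dots> = (y1 / 2)\<^sup>2 * (\<eta>\<^sup>2)\<^sup>2" using pos by (simp add: power_mult_distrib)
        also note S
        finally have "((y1 / 2)\<^sup>2 / R\<^sup>2 * ?L\<^sup>2) * ?L\<^sup>2 \<le> (?S * K) * ?L\<^sup>2"
          by (simp only: power2_eq_square mult_ac)
        then have "(y1 / 2)\<^sup>2 / R\<^sup>2 * ?L\<^sup>2 \<le> ?S * K"
          by (rule mult_right_le_imp_le) (use L in simp)
        then have "e0 * ?L\<^sup>2 \<le> ?S" using pos
          by (simp add: e0_def field_simps power_divide)
        then have "(e0 * ?L\<^sup>2) * (b * Re X) \<le> ?S * cmod (mp + mm)"
          using pos X order_trans[OF mult_left_mono[OF complex_Re_le_cmod[of X], of b] sum]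
          by (intro mult_mono) auto
        moreover have "c * B * (Re X * ?L\<^sup>2) \<le> e0 * b * (Re X * ?L\<^sup>2)"
          using c X by (intro mult_right_mono) auto
        ultimately show ?thesis by (simp add: mult_ac)
      next
        case False
        have "(e1 * ?L)\<^sup>2 \<le> (cmod X)\<^sup>2"
        proof -
          have "(e1 * ?L)\<^sup>2 = y1 / (2 * R) * ?L\<^sup>2"
            using y1 pos by (simp add: e1_def power_mult_distrib)
          also have "\<dots> \<le> y1 / (2 * R) * (R * \<eta>\<^sup>2)"
            using y1 pos LR by (intro mult_left_mono) auto
          also have "\<dots> = y1 / 2 * \<eta>\<^sup>2" using pos by simp
          finally show ?thesis using False by linarith
        qed
        then have "e1 * ?L \<le> cmod X" by (rule power2_le_imp_le) simp
        then have "b * (e1 * ?L) \<le> cmod (mp + mm)"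
          using pos by (intro order_trans[OF mult_left_mono sum]) auto
        then have "(c0 * Re X * ?L) * (b * (e1 * ?L)) \<le> ?S * cmod (mp + mm)"
          using weak[OF rp] pos L c0 X by (intro mult_mono) auto
        moreover have "c * B * (Re X * ?L\<^sup>2) \<le> c0 * b * e1 * (Re X * ?L\<^sup>2)"
          using c X by (intro mult_right_mono) auto
        ultimately show ?thesis by (simp add: mult_ac power2_eq_square)
      qed
      moreover have "c * Re X * ?L * cmod m \<le> c * B * (Re X * ?L\<^sup>2)" if "cmod m \<le> B * ?L" for m
      proof -
        have "c * Re X * ?L * cmod m \<le> c * Re X * ?L * (B * ?L)"
          using that c X L by (intro mult_left_mono) auto
        then show ?thesis by (simp add: power2_eq_square mult_ac)
      qed
      ultimately show ?thesis
        using root_pair_upper[OF rp M0] unfolding B_def by (meson order_trans)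
    qed
  qed
  with c(1) show ?thesis by blast
qed

section \<open>Test functions and multiplication by exponentials\<close>

lemma partial_0_0 [simp]: "partial 0 0 \<phi> = \<phi>"
  by (simp add: partial_def)

lemma partial_Suc: "partial (Suc a) b \<phi> = d1 (partial a b \<phi>)"
  by (simp add: partial_def)

lemma partial_0_Suc: "partial 0 (Suc b) \<phi> = d2 (partial 0 b \<phi>)"
  by (simp add: partial_def)

lemma d1_eq: "(f has_derivative D) (at z) \<Longrightarrow> d1 f z = D (1, 0)"
  unfolding d1_def by (metis frechet_derivative_at)

lemma d2_eq: "(f has_derivative D) (at z) \<Longrightarrow> d2 f z = D (0, 1)"
  unfolding d2_def by (metis frechet_derivative_at)

text \<open>Iterated partials are found by guessing the whole family at once.\<close>

lemma partial_eqI: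
  assumes "\<And>a b. d1 (F a b) = F (Suc a) b" "\<And>b. d2 (F 0 b) = F 0 (Suc b)"
  shows "partial a b (F 0 0) = F a b"
proof -
  have "partial 0 b (F 0 0) = F 0 b" for b
    by (induction b) (simp_all add: partial_0_Suc assms)
  then show ?thesis by (induction a) (simp_all add: partial_Suc assms)
qed

lemma test_functionsD:
  assumes "\<phi> \<in> test_functions"
  shows "partial a b \<phi> differentiable (at z)" "compact (supp \<phi>)"
  using assms[unfolded test_functions_def, THEN CollectD]
  by (rule conjE, iprover)+

lemma test_functionsI:
  assumes "\<And>a b z. partial a b \<phi> differentiable (at z)" "\<And>z. z \<notin> K \<Longrightarrow> \<phi> z = 0" "compact K"
  shows "\<phi> \<in> test_functions"
proof -
  have "{z. \<phi> z \<noteq> 0} \<subseteq> K" using assms(2) by blast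
  then have "supp \<phi> \<subseteq> K"
    unfolding supp_def by (rule closure_minimal) (rule compact_imp_closed[OF assms(3)])
  moreover have "closed (supp \<phi>)" by (simp add: supp_def)
  ultimately have "compact (supp \<phi>)"
    using assms(3) compact_eq_bounded_closed bounded_subset by metis
  then show ?thesis
    unfolding test_functions_def by (intro CollectI conjI allI assms(1))
qed

text \<open>The complement of the support is open, so vanishing there passes to derivatives.\<close>

lemma partial_outside_supp:
  assumes z: "z \<notin> supp \<phi>"
  shows "partial a b \<phi> z = 0"
proof -
  define U where "U = - supp \<phi>"
  have U: "open U" by (simp add: U_def supp_def open_Compl)
  have zero: "D f z = 0" if f: "\<And>z. z \<in> U \<Longrightarrow> f z = 0" and "z \<in> U" and D: "D = d1 \<or> D = d2" for f z D
  proof -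
    have "(f has_derivative (\<lambda>_. 0)) (at z)"
      by (rule has_derivative_transform_within_open[OF _ U \<open>z \<in> U\<close>, of "\<lambda>_. 0"]) (auto simp: f)
    from d1_eq[OF this] d2_eq[OF this] show ?thesis using D by blast
  qed
  have start: "\<phi> z = 0" if "z \<in> U" for z
    using that closure_subset[of "{z. \<phi> z \<noteq> 0}"] by (auto simp: U_def supp_def)
  have "\<forall>z\<in>U. partial 0 b \<phi> z = 0" for b
    by (induction b) (use start zero in \<open>auto simp: partial_0_Suc\<close>)
  then have "\<forall>z\<in>U. partial a b \<phi> z = 0" for b
    by (induction a) (use zero in \<open>auto simp: partial_Suc\<close>)
  then show ?thesis using z by (simp add: U_def)
qed

lemma partial_continuous:
  "\<phi> \<in> test_functions \<Longrightarrow> continuous_on S (partial a b \<phi>)"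
  by (intro continuous_at_imp_continuous_on ballI differentiable_imp_continuous_within test_functionsD(1))

definition sup_partial :: "nat \<Rightarrow> nat \<Rightarrow> (real \<times> real \<Rightarrow> complex) \<Rightarrow> real"
  where "sup_partial a b \<phi> = (SUP z. cmod (partial a b \<phi> z))"

lemma norm_partial_le_sup:
  assumes "\<phi> \<in> test_functions"
  shows "cmod (partial a b \<phi> z) \<le> sup_partial a b \<phi>"
proof -
  have "compact ((\<lambda>z. cmod (partial a b \<phi> z)) ` supp \<phi>)"
    by (intro compact_continuous_image continuous_on_norm partial_continuous test_functionsD(2) assms)
  then have "bounded ((\<lambda>z. cmod (partial a b \<phi> z)) ` supp \<phi>)" by (rule compact_imp_bounded)
  then obtain B where "\<forall>y\<in>(\<lambda>z. cmod (partial a b \<phi> z)) ` supp \<phi>. norm y \<le> B"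
    by (auto simp: bounded_iff)
  then have B: "cmod (partial a b \<phi> z) \<le> B" if "z \<in> supp \<phi>" for z
    using that by auto
  have "cmod (partial a b \<phi> z) \<le> max B 0" for z
    using B[of z] partial_outside_supp[of z \<phi> a b] by (cases "z \<in> supp \<phi>") auto
  then have "bdd_above (range (\<lambda>z. cmod (partial a b \<phi> z)))" by (auto intro!: bdd_aboveI)
  then show ?thesis unfolding sup_partial_def by (rule cSUP_upper2) auto
qed

lemma sup_partial_nonneg: "\<phi> \<in> test_functions \<Longrightarrow> 0 \<le> sup_partial a b \<phi>"
  using norm_partial_le_sup[of \<phi> a b 0] norm_ge_zero order_trans by blast

lemma sup_partial_le: "(\<And>z. cmod (partial a b \<phi> z) \<le> B) \<Longrightarrow> sup_partial a b \<phi> \<le> B"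
  unfolding sup_partial_def by (rule cSUP_least) auto

definition sum_sup :: "nat \<Rightarrow> (real \<times> real \<Rightarrow> complex) \<Rightarrow> real"
  where "sum_sup N \<phi> = (\<Sum>(a, b) \<in> {(a, b). a + b \<le> N}. sup_partial a b \<phi>)"

lemma finite_orders: "finite {(a, b). a + b \<le> (N::nat)}"
  by (rule finite_subset[of _ "{..N} \<times> {..N}"]) auto

lemma sup_partial_le_sum_sup:
  assumes "\<phi> \<in> test_functions" "a + b \<le> N"
  shows "sup_partial a b \<phi> \<le> sum_sup N \<phi>"
  using member_le_sum[of "(a, b)" "{(a, b). a + b \<le> N}" "\<lambda>(a, b). sup_partial a b \<phi>"] assms
  by (auto simp: sum_sup_def finite_orders sup_partial_nonneg)

lemma sum_sup_nonneg: "\<phi> \<in> test_functions \<Longrightarrow> 0 \<le> sum_sup N \<phi>"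
  unfolding sum_sup_def by (intro sum_nonneg) (auto simp: sup_partial_nonneg)

lemma distributions_iff:
  "u \<in> distributions \<longleftrightarrow> u \<in> extensional test_functions \<and>
    (\<forall>\<phi>\<in>test_functions. \<forall>\<psi>\<in>test_functions. \<forall>a b.
       u (\<lambda>z. a * \<phi> z + b * \<psi> z) = a * u \<phi> + b * u \<psi>) \<and>
    (\<forall>K. compact K \<longrightarrow> (\<exists>C N. \<forall>\<phi>\<in>test_functions. supp \<phi> \<subseteq> K \<longrightarrow>
       cmod (u \<phi>) \<le> C * sum_sup N \<phi>))"
  unfolding distributions_def sum_sup_def sup_partial_def by simp

lemma distributions_extensional: "u \<in> distributions \<Longrightarrow> u \<in> extensional test_functions"
  unfolding distributions_iff by (rule conjunct1)

lemma distributions_linear: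
  assumes u: "u \<in> distributions" and T: "\<phi> \<in> test_functions" "\<psi> \<in> test_functions"
  shows "u (\<lambda>z. a * \<phi> z + b * \<psi> z) = a * u \<phi> + b * u \<psi>"
proof -
  have "\<forall>\<phi>\<in>test_functions. \<forall>\<psi>\<in>test_functions. \<forall>a b. u (\<lambda>z. a * \<phi> z + b * \<psi> z) = a * u \<phi> + b * u \<psi>"
    using u unfolding distributions_iff by (elim conjE)
  from this[rule_format, OF T] show ?thesis .
qed

lemma distributions_bound:
  assumes u: "u \<in> distributions" and K: "compact K"
  shows "\<exists>C N. \<forall>\<phi>\<in>test_functions. supp \<phi> \<subseteq> K \<longrightarrow> cmod (u \<phi>) \<le> C * sum_sup N \<phi>"
proof -
  have "\<forall>K. compact K \<longrightarrow> (\<exists>C N. \<forall>\<phi>\<in>test_functions. supp \<phi> \<subseteq> K \<longrightarrow>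
       cmod (u \<phi>) \<le> C * sum_sup N \<phi>)"
    using u unfolding distributions_iff by (elim conjE)
  with K show ?thesis by (elim allE impE)
qed

lemma has_derivative_partial:
  assumes "\<phi> \<in> test_functions"
  shows "(partial a b \<phi> has_derivative frechet_derivative (partial a b \<phi>) (at z)) (at z)"
  using frechet_derivative_works test_functionsD(1)[OF assms] by blast

lemma partial_linear:
  assumes \<phi>: "\<phi> \<in> test_functions" and \<psi>: "\<psi> \<in> test_functions"
  shows "partial a b (\<lambda>z. c * \<phi> z + d * \<psi> z) = (\<lambda>z. c * partial a b \<phi> z + d * partial a b \<psi> z)"
proof -
  let ?F = "\<lambda>a b z. c * partial a b \<phi> z + d * partial a b \<psi> z"
  have der: "(?F a b has_derivative (\<lambda>h. c * frechet_derivative (partial a b \<phi>) (at z) h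
       + d * frechet_derivative (partial a b \<psi>) (at z) h)) (at z)" for a b z
    by (intro has_derivative_add has_derivative_mult_right has_derivative_partial \<phi> \<psi>)
  have "partial a b (?F 0 0) = ?F a b"
  proof (rule partial_eqI)
    show "d1 (?F a b) = ?F (Suc a) b" for a b
      by (rule ext) (simp add: d1_eq[OF der] partial_Suc d1_def)
    show "d2 (?F 0 b) = ?F 0 (Suc b)" for b
      by (rule ext) (simp add: d2_eq[OF der] partial_0_Suc d2_def)
  qed
  then show ?thesis by simp
qed

lemma test_functions_linear:
  assumes "\<phi> \<in> test_functions" "\<psi> \<in> test_functions"
  shows "(\<lambda>z. c * \<phi> z + d * \<psi> z) \<in> test_functions"
proof (rule test_functionsI)
  show "partial a b (\<lambda>z. c * \<phi> z + d * \<psi> z) differentiable (at z)" for a b z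
    unfolding partial_linear[OF assms]
    by (intro differentiable_add differentiable_mult differentiable_const test_functionsD(1) assms)
  show "compact (supp \<phi> \<union> supp \<psi>)" using assms by (auto simp: test_functions_def)
  show "c * \<phi> z + d * \<psi> z = 0" if "z \<notin> supp \<phi> \<union> supp \<psi>" for z
    using that partial_outside_supp[of z \<phi> 0 0] partial_outside_supp[of z \<psi> 0 0] by simp
qed

lemma test_functions_translate:
  assumes \<phi>: "\<phi> \<in> test_functions"
  shows "(\<lambda>z. \<phi> (z - p)) \<in> test_functions"
proof (rule test_functionsI)
  let ?F = "\<lambda>a b z. partial a b \<phi> (z - p)"
  have der: "(?F a b has_derivative frechet_derivative (partial a b \<phi>) (at (z - p))) (at z)" for a b z
    by (rule has_derivative_compose[of "\<lambda>z. z - p" "\<lambda>h. h" z UNIV "partial a b \<phi>", simplified])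
      (auto intro!: derivative_eq_intros has_derivative_partial \<phi>)
  have F: "partial a b (?F 0 0) = ?F a b" for a b
  proof (rule partial_eqI)
    show "d1 (?F a b) = ?F (Suc a) b" for a b
      by (rule ext) (simp add: d1_eq[OF der] partial_Suc d1_def)
    show "d2 (?F 0 b) = ?F 0 (Suc b)" for b
      by (rule ext) (simp add: d2_eq[OF der] partial_0_Suc d2_def)
  qed
  show "partial a b (\<lambda>z. \<phi> (z - p)) differentiable (at z)" for a b z
    using F[of a b] der[of a b z] by (simp add: differentiable_def) blast
  show "compact ((+) p ` supp \<phi>)"
    by (intro compact_translation test_functionsD \<phi>)
  show "\<phi> (z - p) = 0" if "z \<notin> (+) p ` supp \<phi>" for z
  proof -
    have "z - p \<notin> supp \<phi>" using that by (metis add.commute diff_add_cancel imageI)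
    then show ?thesis using partial_outside_supp[of "z - p" \<phi> 0 0] by simp
  qed
qed

definition exp_times :: "real \<Rightarrow> (real \<times> real \<Rightarrow> complex) \<Rightarrow> real \<times> real \<Rightarrow> complex"
  where "exp_times \<gamma> \<phi> = (\<lambda>(t, x). of_real (exp (- \<gamma> * t)) * \<phi> (t, x))"

lemma exp_times_apply: "exp_times \<gamma> \<phi> z = of_real (exp (- \<gamma> * fst z)) * \<phi> z"
  by (simp add: exp_times_def case_prod_beta)

lemma exp_mult_exp_times: "exp_mult \<gamma> u = restrict (\<lambda>\<phi>. u (exp_times \<gamma> \<phi>)) test_functions"
  by (simp add: exp_mult_def exp_times_def)

lemma exp_times_has_derivative:
  assumes "(\<psi> has_derivative D) (at z)"
  shows "(exp_times \<gamma> \<psi> has_derivative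
    (\<lambda>h. of_real (exp (- \<gamma> * fst z)) * (D h - of_real (\<gamma> * fst h) * \<psi> z))) (at z)"
proof -
  have e: "((\<lambda>z. complex_of_real (exp (- \<gamma> * fst z))) has_derivative
      (\<lambda>h. of_real (exp (- \<gamma> * fst z) * (- \<gamma> * fst h)))) (at z)"
    by (auto intro!: derivative_eq_intros)
  have "exp_times \<gamma> \<psi> = (\<lambda>z. complex_of_real (exp (- \<gamma> * fst z)) * \<psi> z)"
    by (rule ext) (rule exp_times_apply)
  then show ?thesis
    using has_derivative_mult[OF e assms]
    by (simp add: algebra_simps)
qed

lemma exp_times_differentiable: "\<psi> differentiable (at z) \<Longrightarrow> exp_times \<gamma> \<psi> differentiable (at z)"
  unfolding differentiable_def by (erule exE, rule exI, rule exp_times_has_derivative)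

lemma d_exp_times:
  assumes "\<And>z. \<psi> differentiable (at z)"
  shows "d1 (exp_times \<gamma> \<psi>) = exp_times \<gamma> (\<lambda>z. d1 \<psi> z - of_real \<gamma> * \<psi> z)"
    and "d2 (exp_times \<gamma> \<psi>) = exp_times \<gamma> (d2 \<psi>)"
proof -
  have D: "(\<psi> has_derivative frechet_derivative \<psi> (at z)) (at z)" for z
    using assms frechet_derivative_works by blast
  show "d1 (exp_times \<gamma> \<psi>) = exp_times \<gamma> (\<lambda>z. d1 \<psi> z - of_real \<gamma> * \<psi> z)"
    by (rule ext, subst d1_eq[OF exp_times_has_derivative[OF D]]) (simp add: exp_times_apply d1_def)
  show "d2 (exp_times \<gamma> \<psi>) = exp_times \<gamma> (d2 \<psi>)"
    by (rule ext, subst d2_eq[OF exp_times_has_derivative[OF D]]) (simp add: exp_times_apply d2_def)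
qed

lemma d1_lincomb:
  assumes "\<phi> \<in> test_functions"
  shows "d1 (\<lambda>z. \<Sum>j\<le>n. c j * partial j b \<phi> z) = (\<lambda>z. \<Sum>j\<le>n. c j * partial (Suc j) b \<phi> z)"
proof
  fix z
  have "((\<lambda>z. \<Sum>j\<le>n. c j * partial j b \<phi> z) has_derivative
      (\<lambda>h. \<Sum>j\<le>n. c j * frechet_derivative (partial j b \<phi>) (at z) h)) (at z)"
    by (intro has_derivative_sum has_derivative_mult_right has_derivative_partial assms)
  from d1_eq[OF this] show "d1 (\<lambda>z. \<Sum>j\<le>n. c j * partial j b \<phi> z) z = (\<Sum>j\<le>n. c j * partial (Suc j) b \<phi> z)"
    by (simp add: partial_Suc d1_def)
qed

lemma lincomb_differentiable:
  assumes "\<phi> \<in> test_functions"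
  shows "(\<lambda>z. \<Sum>j\<le>(n::nat). c j * partial j b \<phi> z) differentiable (at z)"
  by (intro differentiable_sum ballI differentiable_mult differentiable_const test_functionsD(1) assms) simp

text \<open>A Leibniz rule whose coefficients matter only through being independent of \<open>\<phi>\<close> and \<open>b\<close>. The derivatives
  \<^const>\<open>d1\<close> are applied last in \<^const>\<open>partial\<close>, so the second variable passes through untouched.
  \<close>

lemma partial_exp_times:
  "\<exists>c. \<forall>\<phi>\<in>test_functions. \<forall>b. partial a b (exp_times \<gamma> \<phi>) = exp_times \<gamma> (\<lambda>z. \<Sum>j\<le>a. c j * partial j b \<phi> z)"
proof (induction a)
  case 0
  have "partial 0 b (exp_times \<gamma> \<phi>) = exp_times \<gamma> (partial 0 b \<phi>)" if "\<phi> \<in> test_functions" for \<phi> b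
    by (induction b) (simp_all add: partial_0_Suc d_exp_times(2) test_functionsD(1)[OF that])
  then show ?case by (intro exI[of _ "\<lambda>_. 1"]) simp
next
  case (Suc a)
  then obtain c where c: "\<And>\<phi> b. \<phi> \<in> test_functions \<Longrightarrow>
      partial a b (exp_times \<gamma> \<phi>) = exp_times \<gamma> (\<lambda>z. \<Sum>j\<le>a. c j * partial j b \<phi> z)" by blast
  \<comment> \<open>the product rule shifts the old coefficients by one and adds \<open>- \<gamma>\<close> times them\<close>
  define c' where "c' j = (if j = 0 then 0 else c (j - 1)) - of_real \<gamma> * (if j \<le> a then c j else 0)" for j
  have "partial (Suc a) b (exp_times \<gamma> \<phi>) = exp_times \<gamma> (\<lambda>z. \<Sum>j\<le>Suc a. c' j * partial j b \<phi> z)"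
    if \<phi>: "\<phi> \<in> test_functions" for \<phi> b
  proof -
    have *: "(\<Sum>j\<le>Suc a. c' j * partial j b \<phi> z) =
      (\<Sum>j\<le>a. c j * partial (Suc j) b \<phi> z) - of_real \<gamma> * (\<Sum>j\<le>a. c j * partial j b \<phi> z)" for z
    proof -
      have "(\<Sum>j\<le>Suc a. c' j * partial j b \<phi> z)
        = (\<Sum>j\<le>Suc a. (if j = 0 then 0 else c (j - 1)) * partial j b \<phi> z)
          - (\<Sum>j\<le>Suc a. of_real \<gamma> * (if j \<le> a then c j else 0) * partial j b \<phi> z)"
        by (simp add: c'_def sum_subtractf[symmetric] left_diff_distrib del: sum.atMost_Suc)
      also have "(\<Sum>j\<le>Suc a. (if j = 0 then 0 else c (j - 1)) * partial j b \<phi> z)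
          = (\<Sum>j\<le>a. c j * partial (Suc j) b \<phi> z)"
        by (subst sum.atMost_Suc_shift) simp
      also have "(\<Sum>j\<le>Suc a. of_real \<gamma> * (if j \<le> a then c j else 0) * partial j b \<phi> z)
          = of_real \<gamma> * (\<Sum>j\<le>a. c j * partial j b \<phi> z)"
        by (simp add: sum_distrib_left mult.assoc)
      finally show ?thesis .
    qed
    show ?thesis
      unfolding partial_Suc c[OF \<phi>]
      by (subst d_exp_times(1)) (simp_all only: * d1_lincomb[OF \<phi>] lincomb_differentiable[OF \<phi>])
  qed
  then show ?case by blast
qed

lemma exp_times_eq_0_iff [simp]: "exp_times \<gamma> \<phi> z = 0 \<longleftrightarrow> \<phi> z = 0"
  by (simp add: exp_times_apply)

lemma supp_exp_times [simp]: "supp (exp_times \<gamma> \<phi>) = supp \<phi>"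
  by (simp add: supp_def)

lemma exp_times_test_functions:
  assumes "\<phi> \<in> test_functions"
  shows "exp_times \<gamma> \<phi> \<in> test_functions"
proof -
  have "partial a b (exp_times \<gamma> \<phi>) differentiable (at z)" for a b z
  proof -
    obtain c where "partial a b (exp_times \<gamma> \<phi>) = exp_times \<gamma> (\<lambda>z. \<Sum>j\<le>a. c j * partial j b \<phi> z)"
      using partial_exp_times[of a \<gamma>] assms by (elim exE) (drule bspec, auto)
    then show ?thesis
      by (simp only: exp_times_differentiable lincomb_differentiable[OF assms])
  qed
  moreover have "compact (supp (exp_times \<gamma> \<phi>))" unfolding supp_exp_times by (rule test_functionsD(2)[OF assms])
  ultimately show ?thesis
    unfolding test_functions_def by (intro CollectI conjI allI)
qed

lemma exp_times_inverse: "exp_times \<gamma> (exp_times (- \<gamma>) \<phi>) = \<phi>"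
proof
  fix z :: "real \<times> real"
  have "exp (- \<gamma> * fst z) * exp (- (- \<gamma>) * fst z) = 1"
    unfolding exp_add[symmetric] by simp
  then have "complex_of_real (exp (- \<gamma> * fst z)) * of_real (exp (- (- \<gamma>) * fst z)) = 1"
    unfolding of_real_mult[symmetric] by (simp only: of_real_1)
  then show "exp_times \<gamma> (exp_times (- \<gamma>) \<phi>) z = \<phi> z"
    unfolding exp_times_apply mult.assoc[symmetric] by (simp only: mult_1_left)
qed

text \<open>The exponential is bounded on \<open>K\<close> only; this is why the seminorm bounds of a distribution are local.\<close>

lemma sup_partial_exp_times_le:
  assumes K: "compact K"
  shows "\<exists>C\<ge>0. \<forall>\<phi>\<in>test_functions. supp \<phi> \<subseteq> K \<longrightarrow> sup_partial a b (exp_times \<gamma> \<phi>) \<le> C * sum_sup (a + b) \<phi>"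
proof -
  obtain c where c: "\<And>\<phi> b. \<phi> \<in> test_functions \<Longrightarrow>
      partial a b (exp_times \<gamma> \<phi>) = exp_times \<gamma> (\<lambda>z. \<Sum>j\<le>a. c j * partial j b \<phi> z)"
    using partial_exp_times[of a \<gamma>] by blast
  obtain R where R: "\<And>z. z \<in> K \<Longrightarrow> norm z \<le> R"
    using compact_imp_bounded[OF K] by (auto simp: bounded_iff)
  define E where "E = exp (\<bar>\<gamma>\<bar> * R)"
  define S where "S = (\<Sum>j\<le>a. cmod (c j))"
  have S: "S \<ge> 0" by (auto simp: S_def intro: sum_nonneg)
  have "sup_partial a b (exp_times \<gamma> \<phi>) \<le> E * S * sum_sup (a + b) \<phi>"
    if \<phi>: "\<phi> \<in> test_functions" and sK: "supp \<phi> \<subseteq> K" for \<phi>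
  proof (rule sup_partial_le)
    fix z
    show "cmod (partial a b (exp_times \<gamma> \<phi>) z) \<le> E * S * sum_sup (a + b) \<phi>"
    proof (cases "z \<in> supp \<phi>")
      case False
      then have "partial a b (exp_times \<gamma> \<phi>) z = 0" by (intro partial_outside_supp) simp
      then show ?thesis using S sum_sup_nonneg[OF \<phi>] by (simp add: E_def)
    next
      case True
      have "\<bar>fst z\<bar> \<le> R"
        using R[of z] True sK norm_fst_le[of "fst z" "snd z"] by (auto intro: order_trans)
      then have "\<bar>\<gamma>\<bar> * \<bar>fst z\<bar> \<le> \<bar>\<gamma>\<bar> * R" by (intro mult_left_mono) auto
      then have "- \<gamma> * fst z \<le> \<bar>\<gamma>\<bar> * R" using abs_ge_self[of "- \<gamma> * fst z"] by (simp add: abs_mult)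
      then have e: "exp (- \<gamma> * fst z) \<le> E" by (simp add: E_def)
      have "cmod (\<Sum>j\<le>a. c j * partial j b \<phi> z) \<le> (\<Sum>j\<le>a. cmod (c j) * sum_sup (a + b) \<phi>)"
        by (intro sum_norm_le) (auto simp: norm_mult intro!: mult_left_mono
            order_trans[OF norm_partial_le_sup[OF \<phi>] sup_partial_le_sum_sup[OF \<phi>]])
      also have "\<dots> = S * sum_sup (a + b) \<phi>" by (simp add: S_def sum_distrib_right)
      finally have "exp (- \<gamma> * fst z) * cmod (\<Sum>j\<le>a. c j * partial j b \<phi> z) \<le> E * (S * sum_sup (a + b) \<phi>)"
        using e by (intro mult_mono) (auto simp: E_def)
      then show ?thesis by (simp add: c[OF \<phi>] exp_times_apply norm_mult mult.assoc)
    qed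
  qed
  then show ?thesis using S by (intro exI[of _ "E * S"]) (auto simp: E_def)
qed

lemma sum_sup_mono: "\<phi> \<in> test_functions \<Longrightarrow> m \<le> n \<Longrightarrow> sum_sup m \<phi> \<le> sum_sup n \<phi>"
  unfolding sum_sup_def by (intro sum_mono2 finite_orders) (auto simp: sup_partial_nonneg)

lemma sum_sup_exp_times_le:
  assumes K: "compact K"
  shows "\<exists>C\<ge>0. \<forall>\<phi>\<in>test_functions. supp \<phi> \<subseteq> K \<longrightarrow> sum_sup N (exp_times \<gamma> \<phi>) \<le> C * sum_sup N \<phi>"
proof -
  have "\<forall>a b. \<exists>C\<ge>0. \<forall>\<phi>\<in>test_functions. supp \<phi> \<subseteq> K \<longrightarrow>
      sup_partial a b (exp_times \<gamma> \<phi>) \<le> C * sum_sup (a + b) \<phi>"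
    using sup_partial_exp_times_le[OF K] by blast
  then obtain C where C: "\<And>a b. C a b \<ge> 0" "\<And>a b \<phi>. \<phi> \<in> test_functions \<Longrightarrow> supp \<phi> \<subseteq> K \<Longrightarrow>
      sup_partial a b (exp_times \<gamma> \<phi>) \<le> C a b * sum_sup (a + b) \<phi>"
    by metis
  let ?C = "\<Sum>(a, b) \<in> {(a, b). a + b \<le> N}. C a b"
  have "sum_sup N (exp_times \<gamma> \<phi>) \<le> ?C * sum_sup N \<phi>"
    if \<phi>: "\<phi> \<in> test_functions" "supp \<phi> \<subseteq> K" for \<phi>
    unfolding sum_sup_def[of N "exp_times \<gamma> \<phi>"] sum_distrib_right
    by (intro sum_mono) (auto intro!: order_trans[OF C(2)[OF \<phi>]] mult_left_mono C(1) sum_sup_mono[OF \<phi>(1)])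
  moreover have "?C \<ge> 0" by (intro sum_nonneg) (auto simp: C)
  ultimately show ?thesis by blast
qed

lemma exp_mult_distributions:
  assumes u: "u \<in> distributions"
  shows "exp_mult \<gamma> u \<in> distributions"
  unfolding distributions_iff
proof (intro conjI ballI allI impI)
  show "exp_mult \<gamma> u \<in> extensional test_functions" by (simp add: exp_mult_exp_times)
next
  fix \<phi> \<psi> :: "real \<times> real \<Rightarrow> complex" and a b
  assume T: "\<phi> \<in> test_functions" "\<psi> \<in> test_functions"
  have "exp_times \<gamma> (\<lambda>z. a * \<phi> z + b * \<psi> z) = (\<lambda>z. a * exp_times \<gamma> \<phi> z + b * exp_times \<gamma> \<psi> z)"
    by (rule ext) (simp add: exp_times_apply algebra_simps)
  moreover have "u (\<lambda>z. a * exp_times \<gamma> \<phi> z + b * exp_times \<gamma> \<psi> z) = a * u (exp_times \<gamma> \<phi>) + b * u (exp_times \<gamma> \<psi>)"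
    by (intro distributions_linear u exp_times_test_functions T)
  ultimately show "exp_mult \<gamma> u (\<lambda>z. a * \<phi> z + b * \<psi> z) = a * exp_mult \<gamma> u \<phi> + b * exp_mult \<gamma> u \<psi>"
    using T test_functions_linear[OF T, of a b] by (simp only: exp_mult_exp_times restrict_apply' if_True)
next
  fix K :: "(real \<times> real) set"
  assume K: "compact K"
  then obtain C N where C: "\<And>\<phi>. \<phi> \<in> test_functions \<Longrightarrow> supp \<phi> \<subseteq> K \<Longrightarrow> cmod (u \<phi>) \<le> C * sum_sup N \<phi>"
    using distributions_bound[OF u] by meson
  obtain C' where C': "C' \<ge> 0" "\<And>\<phi>. \<phi> \<in> test_functions \<Longrightarrow> supp \<phi> \<subseteq> K \<Longrightarrow>
      sum_sup N (exp_times \<gamma> \<phi>) \<le> C' * sum_sup N \<phi>"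
    using sum_sup_exp_times_le[OF K] by blast
  have "cmod (exp_mult \<gamma> u \<phi>) \<le> (\<bar>C\<bar> * C') * sum_sup N \<phi>"
    if \<phi>: "\<phi> \<in> test_functions" "supp \<phi> \<subseteq> K" for \<phi>
  proof -
    have "cmod (exp_mult \<gamma> u \<phi>) = cmod (u (exp_times \<gamma> \<phi>))" by (simp add: exp_mult_exp_times \<phi>)
    also have "\<dots> \<le> C * sum_sup N (exp_times \<gamma> \<phi>)"
      using \<phi> by (intro C exp_times_test_functions) auto
    also have "\<dots> \<le> \<bar>C\<bar> * sum_sup N (exp_times \<gamma> \<phi>)"
      by (intro mult_right_mono sum_sup_nonneg exp_times_test_functions \<phi>) auto
    also have "\<dots> \<le> \<bar>C\<bar> * (C' * sum_sup N \<phi>)" by (intro mult_left_mono C' \<phi>) auto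
    finally show ?thesis by simp
  qed
  then show "\<exists>C N. \<forall>\<phi>\<in>test_functions. supp \<phi> \<subseteq> K \<longrightarrow> cmod (exp_mult \<gamma> u \<phi>) \<le> C * sum_sup N \<phi>"
    by (intro exI ballI impI)
qed

lemma exp_mult_inverse:
  assumes "u \<in> distributions"
  shows "exp_mult (- \<gamma>) (exp_mult \<gamma> u) = u"
proof (rule extensionalityI)
  show "exp_mult (- \<gamma>) (exp_mult \<gamma> u) \<in> extensional test_functions"
    unfolding exp_mult_exp_times by (rule restrict_extensional)
  show "u \<in> extensional test_functions"
    by (rule distributions_extensional[OF assms])
  show "exp_mult (- \<gamma>) (exp_mult \<gamma> u) \<phi> = u \<phi>" if "\<phi> \<in> test_functions" for \<phi>
    by (simp only: exp_mult_exp_times restrict_apply' that exp_times_test_functions[OF that] exp_times_inverse)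
qed

section \<open>Smooth bump functions\<close>

text \<open>The derivatives of \<open>exp (- 1 / w)\<close> are combinations of these functions.\<close>

definition flat :: "nat \<Rightarrow> real \<Rightarrow> real"
  where "flat k w = (if w > 0 then exp (- (1 / w)) / w ^ k else 0)"

lemma flat_shift: "flat k w = w * flat (Suc k) w"
  by (simp add: flat_def)

lemma exp_neg_inverse_le:
  fixes h :: real
  assumes "h > 0"
  shows "exp (- (1 / h)) \<le> fact n * h ^ n"
proof -
  have s: "summable (\<lambda>n. (1 / h) ^ n /\<^sub>R fact n)" by (rule summable_exp_generic)
  have "(\<Sum>n\<in>{n}. (1 / h) ^ n /\<^sub>R fact n) \<le> (\<Sum>n. (1 / h) ^ n /\<^sub>R fact n)"
    by (rule sum_le_suminf[OF s]) (use assms in auto)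
  then have "(1 / h) ^ n / fact n \<le> exp (1 / h)"
    by (simp add: exp_def field_simps)
  then show ?thesis using assms by (simp add: exp_minus field_simps)
qed

lemma flat_bound: "\<bar>flat k h\<bar> \<le> fact (k + 2) * h\<^sup>2"
proof (cases "h > 0")
  case True
  have "exp (- (1 / h)) / h ^ k \<le> (fact (k + 2) * h ^ (k + 2)) / h ^ k"
    using True by (intro divide_right_mono exp_neg_inverse_le) auto
  also have "\<dots> = fact (k + 2) * h\<^sup>2"
    using True by (simp only: power_add times_divide_eq_right[symmetric]) simp
  finally show ?thesis using True by (simp add: flat_def)
qed (simp add: flat_def)

text \<open>At \<open>0\<close> the quadratic bound makes the difference quotient tend to \<open>0\<close>.\<close>

lemma flat_DERIV: "(flat k has_real_derivative flat (k + 2) w - real k * flat (k + 1) w) (at w)"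
proof (cases w "0 :: real" rule: linorder_cases)
  case less
  have "((\<lambda>_. 0) has_real_derivative 0) (at w)" by simp
  then have "(flat k has_real_derivative 0) (at w)"
    by (rule has_field_derivative_transform_within_open[of _ _ _ "{..<0}"]) (use less in \<open>auto simp: flat_def\<close>)
  then show ?thesis using less by (simp add: flat_def)
next
  case equal
  have "((\<lambda>h. (flat k (0 + h) - flat k 0) / h) \<longlongrightarrow> 0) (at 0)"
  proof (rule Lim_null_comparison)
    show "((\<lambda>h. fact (k + 2) * \<bar>h\<bar>) \<longlongrightarrow> 0) (at (0::real))"
      by (auto intro!: tendsto_eq_intros)
    have "\<bar>flat k h / h\<bar> \<le> fact (k + 2) * \<bar>h\<bar>" if "h \<noteq> 0" for h
    proof -
      have "\<bar>flat k h\<bar> \<le> (fact (k + 2) * \<bar>h\<bar>) * \<bar>h\<bar>"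
        using flat_bound[of k h] by (simp add: power2_eq_square abs_mult_self_eq mult.assoc)
      then show ?thesis using that by (simp add: pos_divide_le_eq abs_divide)
    qed
    then show "\<forall>\<^sub>F h in at 0. norm ((flat k (0 + h) - flat k 0) / h) \<le> fact (k + 2) * \<bar>h\<bar>"
      by (auto simp: eventually_at_filter flat_def[of k 0])
  qed
  then show ?thesis using equal by (simp add: DERIV_def flat_def[of _ 0])
next
  case greater
  have "((\<lambda>w. exp (- (1 / w)) / w ^ k) has_real_derivative
      exp (- (1 / w)) / w ^ (k + 2) - real k * (exp (- (1 / w)) / w ^ (k + 1))) (at w)"
  proof (cases k)
    case 0
    with greater show ?thesis
      by (auto intro!: derivative_eq_intros simp: power2_eq_square divide_simps)
  next
    case (Suc n)
    with greater show ?thesis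
      by (auto intro!: derivative_eq_intros simp: divide_simps) (cases n; simp add: algebra_simps power2_eq_square)
  qed
  then have "(flat k has_real_derivative
      exp (- (1 / w)) / w ^ (k + 2) - real k * (exp (- (1 / w)) / w ^ (k + 1))) (at w)"
    by (rule has_field_derivative_transform_within_open[of _ _ _ "{0<..}"]) (use greater in \<open>auto simp: flat_def\<close>)
  then show ?thesis using greater by (simp add: flat_def)
qed

text \<open>The \<open>n\<close>-th derivative of \<open>exp (- 1 / (r\<^sup>2 - t\<^sup>2))\<close> is a polynomial times \<open>flat (2 * n) (r\<^sup>2 - t\<^sup>2)\<close>. The
  identity \<open>flat_shift\<close> allows a single term instead of a sum; the recursion is the product rule after
  all three terms have been expressed by the flat function of highest index.\<close>

primrec bump_poly :: "real \<Rightarrow> nat \<Rightarrow> real poly"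
  where "bump_poly r 0 = 1"
  | "bump_poly r (Suc n) = pderiv (bump_poly r n) * [:r\<^sup>2, 0, -1:]\<^sup>2
      - [:0, 2:] * bump_poly r n * (1 - [:2 * real n:] * [:r\<^sup>2, 0, -1:])"

definition bump_deriv :: "real \<Rightarrow> nat \<Rightarrow> real \<Rightarrow> real"
  where "bump_deriv r n t = poly (bump_poly r n) t * flat (2 * n) (r\<^sup>2 - t\<^sup>2)"

lemma bump_deriv_DERIV: "(bump_deriv r n has_real_derivative bump_deriv r (Suc n) t) (at t)"
proof -
  let ?w = "r\<^sup>2 - t\<^sup>2" and ?P = "poly (bump_poly r n)" and ?Q = "poly (pderiv (bump_poly r n))"
  have "((\<lambda>t. flat (2 * n) (r\<^sup>2 - t\<^sup>2)) has_real_derivative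
      (flat (2 * n + 2) ?w - real (2 * n) * flat (2 * n + 1) ?w) * (- 2 * t)) (at t)"
    by (rule DERIV_chain2[OF flat_DERIV]) (auto intro!: derivative_eq_intros)
  from DERIV_mult[OF poly_DERIV this]
  have "(bump_deriv r n has_real_derivative ?Q t * flat (2 * n) ?w
      + (flat (2 * n + 2) ?w - real (2 * n) * flat (2 * n + 1) ?w) * (- 2 * t) * ?P t) (at t)"
    by (simp add: bump_deriv_def[abs_def])
  also have "?Q t * flat (2 * n) ?w
      + (flat (2 * n + 2) ?w - real (2 * n) * flat (2 * n + 1) ?w) * (- 2 * t) * ?P t
      = bump_deriv r (Suc n) t"
  proof -
    \<comment> \<open>all three terms are rewritten with the flat function of index \<open>2n + 2\<close>\<close>
    have 1: "flat (2 * n + 1) ?w = ?w * flat (2 * n + 2) ?w" using flat_shift[of "2 * n + 1" ?w] by simp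
    have 2: "flat (2 * n) ?w = ?w * (?w * flat (2 * n + 2) ?w)" using flat_shift[of "2 * n" ?w] 1 by simp
    show ?thesis
      unfolding bump_deriv_def 1 2 by (simp add: algebra_simps power2_eq_square)
  qed
  finally show ?thesis .
qed

definition bump :: "real \<Rightarrow> real \<times> real \<Rightarrow> real"
  where "bump r z = bump_deriv r 0 (fst z) * bump_deriv r 0 (snd z)"

lemma bump_nonneg: "0 \<le> bump r z"
  by (simp add: bump_def bump_deriv_def flat_def)

lemma bump_nonzero_iff:
  assumes "r > 0"
  shows "bump r z \<noteq> 0 \<longleftrightarrow> \<bar>fst z\<bar> < r \<and> \<bar>snd z\<bar> < r"
proof -
  have "bump_deriv r 0 t \<noteq> 0 \<longleftrightarrow> \<bar>t\<bar> < r" for t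
  proof -
    have "\<not> \<bar>r\<bar> \<le> \<bar>t\<bar> \<longleftrightarrow> \<not> r\<^sup>2 \<le> t\<^sup>2" by (simp only: abs_le_square_iff)
    then have "t\<^sup>2 < r\<^sup>2 \<longleftrightarrow> \<bar>t\<bar> < r" using assms by (simp add: not_le)
    then show ?thesis by (simp add: bump_deriv_def flat_def)
  qed
  then show ?thesis by (simp add: bump_def)
qed

lemma bump_test_function:
  assumes r: "r > 0"
  shows "(\<lambda>z. complex_of_real (bump r z)) \<in> test_functions"
proof (rule test_functionsI)
  define F where "F a b z = complex_of_real (bump_deriv r a (fst z) * bump_deriv r b (snd z))" for a b and z :: "real \<times> real"
  have D: "((\<lambda>t. bump_deriv r n t) has_derivative (\<lambda>h. bump_deriv r (Suc n) t * h)) (at t)" for n t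
    using bump_deriv_DERIV[of r n t] by (simp add: has_field_derivative_def)
  have D1: "((\<lambda>z. bump_deriv r n (fst z)) has_derivative (\<lambda>h. bump_deriv r (Suc n) (fst z) * fst h)) (at z)" for n and z :: "real \<times> real"
    by (rule has_derivative_compose[OF _ D]) (auto intro!: derivative_eq_intros)
  have D2: "((\<lambda>z. bump_deriv r n (snd z)) has_derivative (\<lambda>h. bump_deriv r (Suc n) (snd z) * snd h)) (at z)" for n and z :: "real \<times> real"
    by (rule has_derivative_compose[OF _ D]) (auto intro!: derivative_eq_intros)
  have der: "(F a b has_derivative (\<lambda>h. of_real (bump_deriv r a (fst z) * (bump_deriv r (Suc b) (snd z) * snd h)
      + (bump_deriv r (Suc a) (fst z) * fst h) * bump_deriv r b (snd z)))) (at z)" for a b z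
    unfolding F_def[abs_def] by (rule has_derivative_of_real[OF has_derivative_mult[OF D1 D2]])
  have F: "partial a b (F 0 0) = F a b" for a b
  proof (rule partial_eqI)
    show "d1 (F a b) = F (Suc a) b" for a b
      by (rule ext) (simp add: d1_eq[OF der], simp add: F_def)
    show "d2 (F 0 b) = F 0 (Suc b)" for b
      by (rule ext) (simp add: d2_eq[OF der], simp add: F_def)
  qed
  have F0: "(\<lambda>z. complex_of_real (bump r z)) = F 0 0"
    by (simp add: F_def bump_def fun_eq_iff)
  show "partial a b (\<lambda>z. complex_of_real (bump r z)) differentiable (at z)" for a b z
    unfolding F0 F differentiable_def by (rule exI) (rule der)
  show "compact (cbox (- r, - r) (r, r))" by (rule compact_cbox)
  show "complex_of_real (bump r z) = 0" if "z \<notin> cbox (- r, - r) (r, r)" for z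
  proof -
    have "\<not> (\<bar>fst z\<bar> < r \<and> \<bar>snd z\<bar> < r)"
      using that by (cases z) (auto simp: cbox_Pair_eq)
    then show ?thesis using bump_nonzero_iff[OF r, of z] by (simp only: of_real_eq_0_iff) blast
  qed
qed

section \<open>Inverse Fourier transforms of test functions\<close>

lemma integrable_mult_partial:
  assumes \<phi>: "\<phi> \<in> test_functions" and k: "continuous_on UNIV k"
  shows "integrable lborel (\<lambda>z. k z * partial a b \<phi> z)"
proof -
  have "integrable lborel (\<lambda>z. indicator (supp \<phi>) z *\<^sub>R (k z * partial a b \<phi> z))"
    by (intro borel_integrable_compact test_functionsD(2) \<phi> continuous_on_mult
        continuous_on_subset[OF k] partial_continuous) auto
  also have "(\<lambda>z. indicator (supp \<phi>) z *\<^sub>R (k z * partial a b \<phi> z)) = (\<lambda>z. k z * partial a b \<phi> z)"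
    by (rule ext) (simp add: indicator_def partial_outside_supp)
  finally show ?thesis .
qed

lemma continuous_cis_inner: "continuous_on S (\<lambda>z. cis (z \<bullet> \<xi>))"
  by (intro continuous_intros)

lemma inv_fourier_alt:
  "inv_fourier \<phi> \<xi> = complex_of_real (1 / (2 * pi)\<^sup>2) * (LINT z|lborel. cis (z \<bullet> \<xi>) * \<phi> z)"
  by (simp add: inv_fourier_def)

lemma inv_fourier_linear:
  assumes "\<phi> \<in> test_functions" "\<psi> \<in> test_functions"
  shows "inv_fourier (\<lambda>z. a * \<phi> z + b * \<psi> z) \<xi> = a * inv_fourier \<phi> \<xi> + b * inv_fourier \<psi> \<xi>"
proof -
  have i: "integrable lborel (\<lambda>z. cis (z \<bullet> \<xi>) * \<phi> z)" if "\<phi> \<in> test_functions" for \<phi>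
    using integrable_mult_partial[OF that continuous_cis_inner, where a = 0 and b = 0] by simp
  have "(LINT z|lborel. cis (z \<bullet> \<xi>) * (a * \<phi> z + b * \<psi> z))
      = (LINT z|lborel. a * (cis (z \<bullet> \<xi>) * \<phi> z) + b * (cis (z \<bullet> \<xi>) * \<psi> z))"
    by (simp add: algebra_simps)
  also have "\<dots> = a * (LINT z|lborel. cis (z \<bullet> \<xi>) * \<phi> z) + b * (LINT z|lborel. cis (z \<bullet> \<xi>) * \<psi> z)"
    by (subst Bochner_Integration.integral_add) (auto intro!: i assms integrable_mult_right)
  finally show ?thesis by (simp only: inv_fourier_alt distrib_left mult.left_commute)
qed

lemma inv_fourier_bound:
  assumes \<phi>: "\<phi> \<in> test_functions" and K: "compact K" "supp \<phi> \<subseteq> K"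
  shows "cmod (inv_fourier (partial a b \<phi>) \<xi>) \<le> measure lborel K * sup_partial a b \<phi>"
proof -
  have iK: "integrable lborel (\<lambda>z. indicator K z *\<^sub>R sup_partial a b \<phi>)"
    by (intro borel_integrable_compact K continuous_intros)
  have "cmod (LINT z|lborel. cis (z \<bullet> \<xi>) * partial a b \<phi> z) \<le> (LINT z|lborel. cmod (cis (z \<bullet> \<xi>) * partial a b \<phi> z))"
    by (rule integral_norm_bound)
  also have "\<dots> \<le> (LINT z|lborel. indicator K z *\<^sub>R sup_partial a b \<phi>)"
  proof (rule integral_mono)
    show "integrable lborel (\<lambda>z. cmod (cis (z \<bullet> \<xi>) * partial a b \<phi> z))"
      by (intro integrable_norm integrable_mult_partial \<phi> continuous_cis_inner)
    fix z
    show "cmod (cis (z \<bullet> \<xi>) * partial a b \<phi> z) \<le> indicator K z *\<^sub>R sup_partial a b \<phi>"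
      using norm_partial_le_sup[OF \<phi>, of a b z] partial_outside_supp[of z \<phi> a b] K(2)
      by (cases "z \<in> K") (auto simp: norm_mult)
  qed (rule iK)
  also have "\<dots> = measure lborel K * sup_partial a b \<phi>"
    using compact_imp_closed[OF K(1)] emeasure_compact_finite[OF K(1)] by simp
  finally have "cmod (LINT z|lborel. cis (z \<bullet> \<xi>) * partial a b \<phi> z) \<le> measure lborel K * sup_partial a b \<phi>" .
  moreover have "1 / (2 * pi)\<^sup>2 \<le> 1"
  proof -
    have "(1::real)\<^sup>2 \<le> (2 * pi)\<^sup>2" using pi_gt3 by (intro power_mono) auto
    then show ?thesis by simp
  qed
  then have "1 / (2 * pi)\<^sup>2 * cmod (LINT z|lborel. cis (z \<bullet> \<xi>) * partial a b \<phi> z)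
      \<le> cmod (LINT z|lborel. cis (z \<bullet> \<xi>) * partial a b \<phi> z)"
    by (intro mult_left_le_one_le) auto
  ultimately show ?thesis
    unfolding inv_fourier_alt norm_mult norm_of_real by simp
qed

text \<open>Fubini and the fundamental theorem of calculus on a segment that reaches beyond the support.\<close>

lemma integral_derivative_fst_zero:
  fixes f f' :: "real \<times> real \<Rightarrow> complex"
  assumes der: "\<And>t x. ((\<lambda>t. f (t, x)) has_vector_derivative f' (t, x)) (at t)"
    and cont: "continuous_on UNIV f'" and K: "compact K"
    and zero: "\<And>z. z \<notin> K \<Longrightarrow> f z = 0" "\<And>z. z \<notin> K \<Longrightarrow> f' z = 0"
  shows "(LINT z|lborel. f' z) = 0"
proof -
  obtain R where R: "\<And>z. z \<in> K \<Longrightarrow> norm z < R" "R > 0"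
    using compact_imp_bounded[OF K] by (auto simp: bounded_pos_less)
  have inner: "(LINT t|lborel. f' (t, x)) = 0" for x
  proof -
    have "(LINT t|lborel. indicator {- R..R} t *\<^sub>R f' (t, x)) = f (R, x) - f (- R, x)"
    proof (rule integral_FTC_Icc)
      show "- R \<le> R" using R(2) by simp
      show "((\<lambda>t. f (t, x)) has_vector_derivative f' (t, x)) (at t within {- R..R})" for t
        using der has_vector_derivative_at_within by blast
      show "continuous_on {- R..R} (\<lambda>t. f' (t, x))"
        by (rule continuous_on_compose2[OF cont]) (auto intro!: continuous_intros)
    qed
    also have "f (R, x) - f (- R, x) = 0"
    proof -
      have "norm (s, x) \<ge> R" if "\<bar>s\<bar> = R" for s using norm_fst_le[of s x] that by simp
      then have "R \<le> norm (R, x)" "R \<le> norm (- R, x)" using R(2) by simp_all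
      then have "(R, x) \<notin> K" "(- R, x) \<notin> K" using R(1)[of "(R, x)"] R(1)[of "(- R, x)"] by linarith+
      then show ?thesis using zero by simp
    qed
    also have "(\<lambda>t. indicator {- R..R} t *\<^sub>R f' (t, x)) = (\<lambda>t. f' (t, x))"
    proof
      fix t
      have "f' (t, x) = 0" if "t \<notin> {- R..R}"
      proof -
        have "norm (t, x) \<ge> R" using norm_fst_le[of t x] that by auto
        then show ?thesis using R(1)[of "(t, x)"] zero(2)[of "(t, x)"] by linarith
      qed
      then show "indicator {- R..R} t *\<^sub>R f' (t, x) = f' (t, x)" by (simp add: indicator_def)
    qed
    finally show ?thesis .
  qed
  have int: "integrable (lborel \<Otimes>\<^sub>M lborel) f'"
  proof -
    have "integrable lborel (\<lambda>z. indicator K z *\<^sub>R f' z)"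
      by (intro borel_integrable_compact K continuous_on_subset[OF cont]) auto
    also have "(\<lambda>z. indicator K z *\<^sub>R f' z) = f'"
      by (rule ext) (simp add: indicator_def zero)
    finally show ?thesis by (simp only: lborel_prod)
  qed
  have "(LINT z|(lborel \<Otimes>\<^sub>M lborel). f' z) = (LINT x|lborel. (LINT t|lborel. f' (t, x)))"
    using lborel_pair.integral_snd[of "\<lambda>t x. f' (t, x)"] int by simp
  then show ?thesis by (simp only: lborel_prod inner Bochner_Integration.integral_zero)
qed

text \<open>The coordinates are exchanged to reduce this to the first variable.\<close>

lemma integral_derivative_snd_zero:
  fixes f f' :: "real \<times> real \<Rightarrow> complex"
  assumes der: "\<And>t x. ((\<lambda>x. f (t, x)) has_vector_derivative f' (t, x)) (at x)"
    and cont: "continuous_on UNIV f'" and K: "compact K"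
    and zero: "\<And>z. z \<notin> K \<Longrightarrow> f z = 0" "\<And>z. z \<notin> K \<Longrightarrow> f' z = 0"
  shows "(LINT z|lborel. f' z) = 0"
proof -
  have sw: "continuous_on A (prod.swap :: real \<times> real \<Rightarrow> real \<times> real)" for A
    unfolding prod.swap_def by (intro continuous_intros)
  have z: "prod.swap z \<notin> K" if "z \<notin> prod.swap ` K" for z
    using that by (metis imageI swap_swap)
  have "(LINT z|lborel. f' (prod.swap z)) = 0"
  proof (rule integral_derivative_fst_zero[where f = "\<lambda>z. f (prod.swap z)" and K = "prod.swap ` K"])
    show "((\<lambda>t. f (prod.swap (t, x))) has_vector_derivative f' (prod.swap (t, x))) (at t)" for t x
      using der by simp
    show "continuous_on UNIV (\<lambda>z. f' (prod.swap z))"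
      by (rule continuous_on_compose2[OF cont sw]) auto
    show "compact (prod.swap ` K)" by (rule compact_continuous_image[OF sw K])
  qed (use zero z in blast)+
  moreover have "(LINT z|lborel. f' (prod.swap z)) = (LINT z|lborel. f' z)"
  proof -
    have [measurable]: "f' \<in> borel_measurable (lborel \<Otimes>\<^sub>M lborel)"
      unfolding lborel_prod using borel_measurable_continuous_onI[OF cont] by simp
    have "(LINT z|(lborel \<Otimes>\<^sub>M lborel). f' z)
        = (LINT z|distr (lborel \<Otimes>\<^sub>M lborel) (lborel \<Otimes>\<^sub>M lborel) (\<lambda>(x, y). (y, x)). f' z)"
      by (simp only: lborel_pair.distr_pair_swap[symmetric])
    also have "\<dots> = (LINT z|(lborel \<Otimes>\<^sub>M lborel). f' ((\<lambda>(x, y). (y, x)) z))"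
      by (rule integral_distr) measurable
    finally show ?thesis by (simp add: lborel_prod prod.swap_def case_prod_beta)
  qed
  ultimately show ?thesis by simp
qed

lemma has_derivative_imp_has_vector_derivative:
  fixes g :: "real \<Rightarrow> 'a :: real_normed_vector"
  assumes "(g has_derivative D) (at t)"
  shows "(g has_vector_derivative D 1) (at t)"
proof -
  have "D h = h *\<^sub>R D 1" for h
    using linear_scale[OF has_derivative_linear[OF assms], of h 1] by simp
  then have "D = (\<lambda>h. h *\<^sub>R D 1)" by (rule ext)
  with assms show ?thesis unfolding has_vector_derivative_def by (rule back_subst)
qed

text \<open>Integration by parts: the derivative of \<open>cis (z \<bullet> \<xi>) * partial a b \<phi> z\<close> integrates to \<open>0\<close>.\<close>

lemma inv_fourier_partial:
  assumes \<phi>: "\<phi> \<in> test_functions"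
  shows "inv_fourier (partial (Suc a) b \<phi>) \<xi> = - \<i> * of_real (fst \<xi>) * inv_fourier (partial a b \<phi>) \<xi>"
    and "inv_fourier (partial 0 (Suc b) \<phi>) \<xi> = - \<i> * of_real (snd \<xi>) * inv_fourier (partial 0 b \<phi>) \<xi>"
proof -
  have c: "((\<lambda>z. cis (z \<bullet> \<xi>)) has_derivative (\<lambda>h. (h \<bullet> \<xi>) *\<^sub>R (\<i> * cis (z \<bullet> \<xi>)))) (at z)" for z
    by (intro has_derivative_cis has_derivative_inner_left has_derivative_ident)
  have prod: "((\<lambda>z. cis (z \<bullet> \<xi>) * partial a b \<phi> z) has_derivative
     (\<lambda>h. cis (z \<bullet> \<xi>) * frechet_derivative (partial a b \<phi>) (at z) h + (h \<bullet> \<xi>) *\<^sub>R (\<i> * cis (z \<bullet> \<xi>)) * partial a b \<phi> z)) (at z)" for a b z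
    by (rule has_derivative_mult[OF c has_derivative_partial[OF \<phi>]])
  have i: "integrable lborel (\<lambda>z. cis (z \<bullet> \<xi>) * partial a b \<phi> z)" for a b
    by (rule integrable_mult_partial[OF \<phi> continuous_cis_inner])
  have split: "(LINT z|lborel. cis (z \<bullet> \<xi>) * partial a' b' \<phi> z + (\<i> * of_real k * cis (z \<bullet> \<xi>)) * partial a b \<phi> z)
     = (LINT z|lborel. cis (z \<bullet> \<xi>) * partial a' b' \<phi> z) + \<i> * of_real k * (LINT z|lborel. cis (z \<bullet> \<xi>) * partial a b \<phi> z)"
    for a b a' b' k
    unfolding mult.assoc[of _ "cis _"] by (simp add: Bochner_Integration.integral_add i)
  have line1: "((\<lambda>t. cis ((t, x) \<bullet> \<xi>) * partial a b \<phi> (t, x)) has_vector_derivative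
     (cis ((t, x) \<bullet> \<xi>) * partial (Suc a) b \<phi> (t, x) + (\<i> * of_real (fst \<xi>) * cis ((t, x) \<bullet> \<xi>)) * partial a b \<phi> (t, x))) (at t)" for a b t x
  proof -
    have "((\<lambda>t. (t, x)) has_derivative (\<lambda>h. (h, 0))) (at t)" by (auto intro!: derivative_eq_intros)
    from has_derivative_imp_has_vector_derivative[OF has_derivative_compose[OF this prod[of a b "(t, x)"]]]
    show ?thesis
      by (cases \<xi>) (simp add: partial_Suc d1_def scaleR_conv_of_real mult_ac)
  qed
  have line2: "((\<lambda>x. cis ((t, x) \<bullet> \<xi>) * partial 0 b \<phi> (t, x)) has_vector_derivative
     (cis ((t, x) \<bullet> \<xi>) * partial 0 (Suc b) \<phi> (t, x) + (\<i> * of_real (snd \<xi>) * cis ((t, x) \<bullet> \<xi>)) * partial 0 b \<phi> (t, x))) (at x)" for b t x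
  proof -
    have "((\<lambda>x. (t, x)) has_derivative (\<lambda>h. (0, h))) (at x)" by (auto intro!: derivative_eq_intros)
    from has_derivative_imp_has_vector_derivative[OF has_derivative_compose[OF this prod[of 0 b "(t, x)"]]]
    show ?thesis
      by (cases \<xi>) (simp add: partial_0_Suc d2_def scaleR_conv_of_real mult_ac)
  qed
  have cont: "continuous_on UNIV (\<lambda>z. cis (z \<bullet> \<xi>) * partial a' b' \<phi> z + (\<i> * of_real k * cis (z \<bullet> \<xi>)) * partial a b \<phi> z)" for a b a' b' k
    by (intro continuous_intros partial_continuous \<phi>)
  have "(LINT z|lborel. cis (z \<bullet> \<xi>) * partial (Suc a) b \<phi> z + (\<i> * of_real (fst \<xi>) * cis (z \<bullet> \<xi>)) * partial a b \<phi> z) = 0"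
    by (rule integral_derivative_fst_zero[OF line1 cont test_functionsD(2)[OF \<phi>]])
      (simp_all add: partial_outside_supp)
  then have "(LINT z|lborel. cis (z \<bullet> \<xi>) * partial (Suc a) b \<phi> z)
      = - (\<i> * of_real (fst \<xi>) * (LINT z|lborel. cis (z \<bullet> \<xi>) * partial a b \<phi> z))"
    unfolding split by (rule eq_neg_iff_add_eq_0[THEN iffD2])
  then show "inv_fourier (partial (Suc a) b \<phi>) \<xi> = - \<i> * of_real (fst \<xi>) * inv_fourier (partial a b \<phi>) \<xi>"
    by (simp add: inv_fourier_alt)
  have "(LINT z|lborel. cis (z \<bullet> \<xi>) * partial 0 (Suc b) \<phi> z + (\<i> * of_real (snd \<xi>) * cis (z \<bullet> \<xi>)) * partial 0 b \<phi> z) = 0"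
    by (rule integral_derivative_snd_zero[OF line2 cont test_functionsD(2)[OF \<phi>]])
      (simp_all add: partial_outside_supp)
  then have "(LINT z|lborel. cis (z \<bullet> \<xi>) * partial 0 (Suc b) \<phi> z)
      = - (\<i> * of_real (snd \<xi>) * (LINT z|lborel. cis (z \<bullet> \<xi>) * partial 0 b \<phi> z))"
    unfolding split by (rule eq_neg_iff_add_eq_0[THEN iffD2])
  then show "inv_fourier (partial 0 (Suc b) \<phi>) \<xi> = - \<i> * of_real (snd \<xi>) * inv_fourier (partial 0 b \<phi>) \<xi>"
    by (simp add: inv_fourier_alt)
qed

section \<open>Injectivity of the Fourier transform on integrable functions\<close>

lemma integrable_cis_mult:
  fixes f :: "'a::euclidean_space \<Rightarrow> complex"
  assumes f: "integrable lborel f" and k: "k \<in> borel_measurable borel"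
  shows "integrable lborel (\<lambda>x. cis (k x) * f x)"
proof (rule Bochner_Integration.integrable_bound[OF f])
  have [measurable]: "f \<in> borel_measurable borel"
    using borel_measurable_integrable[OF f] by simp
  have c: "continuous_on UNIV cis" by (intro continuous_intros)
  have [measurable]: "cis \<in> borel_measurable borel"
    by (rule borel_measurable_continuous_onI[OF c])
  note k[measurable]
  show "(\<lambda>x. cis (k x) * f x) \<in> borel_measurable lborel" by measurable
qed (simp add: norm_mult)

text \<open>The positive and the negative part of \<open>f\<close> have the same integral \<open>c\<close> (take \<open>t = 0\<close>). If \<open>c > 0\<close>, dividing by \<open>c\<close> gives two
  probability densities with the same characteristic function, and Levy's theorem applies.\<close>

lemma fourier_injective_real:
  fixes f :: "real \<Rightarrow> real"
  assumes f: "integrable lborel f"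
    and zero: "\<And>t. (LINT x|lborel. cis (t * x) * complex_of_real (f x)) = 0"
  shows "AE x in lborel. f x = 0"
proof -
  define p n where "p x = max 0 (f x)" and "n x = max 0 (- f x)" for x
  have fm[measurable]: "f \<in> borel_measurable borel"
    using borel_measurable_integrable[OF f] by simp
  have [measurable]: "p \<in> borel_measurable borel" "n \<in> borel_measurable borel"
    by (simp_all add: p_def[abs_def] n_def[abs_def])
  have nn: "0 \<le> p x" "0 \<le> n x" and fpn: "f x = p x - n x" for x
    by (simp_all add: p_def n_def)
  have ip: "integrable lborel p" and i_n: "integrable lborel n"
    by (rule Bochner_Integration.integrable_bound[OF f]; simp add: p_def n_def)+
  have ic: "integrable lborel (\<lambda>x. cis (t * x) * complex_of_real (g x))" if "integrable lborel g" for g t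
    by (rule integrable_cis_mult) (use that in auto)
  have eq: "(LINT x|lborel. cis (t * x) * complex_of_real (p x)) = (LINT x|lborel. cis (t * x) * complex_of_real (n x))" for t
  proof -
    have "(LINT x|lborel. cis (t * x) * complex_of_real (p x)) - (LINT x|lborel. cis (t * x) * complex_of_real (n x))
      = (LINT x|lborel. cis (t * x) * complex_of_real (p x) - cis (t * x) * complex_of_real (n x))"
      by (rule Bochner_Integration.integral_diff[symmetric]) (intro ic ip i_n)+
    also have "\<dots> = (LINT x|lborel. cis (t * x) * complex_of_real (f x))"
      by (simp add: fpn right_diff_distrib)
    finally show ?thesis using zero by simp
  qed
  define c where "c = (LINT x|lborel. p x)"
  have cn: "(LINT x|lborel. n x) = c"
    using eq[of 0] by (simp add: c_def)
  show ?thesis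
  proof (cases "c = 0")
    case True
    have "AE x in lborel. p x = 0"
      using integral_nonneg_eq_0_iff_AE[OF ip] nn True by (simp add: c_def)
    moreover have "AE x in lborel. n x = 0"
      using integral_nonneg_eq_0_iff_AE[OF i_n] nn True cn by simp
    ultimately show ?thesis by eventually_elim (simp add: fpn)
  next
    case False
    then have c: "c > 0" using integral_nonneg_AE[of p lborel] nn by (simp add: c_def less_le)
    define P where "P g = density lborel (\<lambda>x. ennreal (g x / c))" for g :: "real \<Rightarrow> real"
    have rd: "real_distribution (P g)" if g: "integrable lborel g" "\<And>x. 0 \<le> g x" "(LINT x|lborel. g x) = c" for g
    proof -
      have [measurable]: "g \<in> borel_measurable borel"
        using borel_measurable_integrable[OF g(1)] by simp
      have "(\<integral>\<^sup>+ x. ennreal (g x / c) \<partial>lborel) = ennreal (LINT x|lborel. g x / c)"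
        by (rule nn_integral_eq_integral) (use g c in auto)
      also have "(LINT x|lborel. g x / c) = 1" using g(3) c by simp
      finally have "prob_space (P g)"
        by (intro prob_spaceI) (simp add: P_def emeasure_density)
      then show ?thesis
        by (intro real_distribution.intro real_distribution_axioms.intro) (simp_all add: P_def)
    qed
    have ch: "char (P g) t = (1 / complex_of_real c) * (LINT x|lborel. cis (t * x) * complex_of_real (g x))"
      if g: "integrable lborel g" "\<And>x. 0 \<le> g x" for g t
    proof -
      have [measurable]: "g \<in> borel_measurable borel"
        using borel_measurable_integrable[OF g(1)] by simp
      have "char (P g) t = (LINT x|lborel. (g x / c) *\<^sub>R iexp (t * x))"
        unfolding char_def P_def by (rule integral_density) (use g c in auto)
      also have "\<dots> = (LINT x|lborel. (1 / complex_of_real c) * (cis (t * x) * complex_of_real (g x)))"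
        by (simp add: cis_conv_exp scaleR_conv_of_real mult.commute)
      also have "\<dots> = (1 / complex_of_real c) * (LINT x|lborel. cis (t * x) * complex_of_real (g x))"
        by (rule integral_mult_right_zero)
      finally show ?thesis .
    qed
    have "char (P p) = char (P n)"
      by (rule ext) (simp only: ch[OF ip nn(1)] ch[OF i_n nn(2)] eq)
    then have "P p = P n"
      using rd[OF ip nn(1) c_def[symmetric]] rd[OF i_n nn(2) cn] by (intro Levy_uniqueness)
    then have "AE x in lborel. ennreal (p x / c) = ennreal (n x / c)"
      unfolding P_def by (subst (asm) sigma_finite_measure.density_unique_iff[OF sigma_finite_lborel]) auto
    then show ?thesis
      by eventually_elim (use c nn in \<open>simp add: fpn ennreal_inj\<close>)
  qed
qed

text \<open>Conjugation shows that the transform of \<open>cnj f\<close> vanishes as well, so real and imaginary part can be treated separately.\<close>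

lemma fourier_injective_1:
  fixes f :: "real \<Rightarrow> complex"
  assumes f: "integrable lborel f"
    and zero: "\<And>t. (LINT x|lborel. cis (t * x) * f x) = 0"
  shows "AE x in lborel. f x = 0"
proof -
  have conj: "(LINT x|lborel. cis (t * x) * cnj (f x)) = 0" for t
  proof -
    have "(LINT x|lborel. cnj (cis ((- t) * x) * f x)) = cnj (LINT x|lborel. cis ((- t) * x) * f x)"
      by (rule Bochner_Integration.integral_cnj)
    then show ?thesis by (simp only: zero[of "- t"]) (simp add: cis_cnj)
  qed
  have i: "integrable lborel (\<lambda>x. cis (t * x) * f x)" "integrable lborel (\<lambda>x. cis (t * x) * cnj (f x))" for t
    by (rule integrable_cis_mult; use f in simp)+
  have "AE x in lborel. Re (f x) = 0"
  proof (rule fourier_injective_real)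
    show "integrable lborel (\<lambda>x. Re (f x))" using f by simp
    fix t
    have "(LINT x|lborel. cis (t * x) * complex_of_real (Re (f x)))
        = (LINT x|lborel. (1/2) * (cis (t * x) * f x + cis (t * x) * cnj (f x)))"
    proof (rule Bochner_Integration.integral_cong[OF refl])
      fix x
      have "complex_of_real (Re (f x)) = (1/2) * (f x + cnj (f x))" by (simp add: complex_add_cnj)
      then show "cis (t * x) * complex_of_real (Re (f x)) = (1/2) * (cis (t * x) * f x + cis (t * x) * cnj (f x))"
        by (simp only: distrib_left mult.left_commute)
    qed
    also have "\<dots> = (1/2) * ((LINT x|lborel. cis (t * x) * f x) + (LINT x|lborel. cis (t * x) * cnj (f x)))"
      by (simp add: i)
    finally show "(LINT x|lborel. cis (t * x) * complex_of_real (Re (f x))) = 0" by (simp add: zero conj)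
  qed
  moreover have "AE x in lborel. Im (f x) = 0"
  proof (rule fourier_injective_real)
    show "integrable lborel (\<lambda>x. Im (f x))" using f by simp
    fix t
    have "(LINT x|lborel. cis (t * x) * complex_of_real (Im (f x)))
        = (LINT x|lborel. (- \<i>/2) * (cis (t * x) * f x - cis (t * x) * cnj (f x)))"
    proof (rule Bochner_Integration.integral_cong[OF refl])
      fix x
      have "complex_of_real (Im (f x)) = (- \<i>/2) * (f x - cnj (f x))" by (simp add: complex_eq_iff)
      then show "cis (t * x) * complex_of_real (Im (f x)) = (- \<i>/2) * (cis (t * x) * f x - cis (t * x) * cnj (f x))"
        by (simp only: right_diff_distrib mult.left_commute)
    qed
    also have "\<dots> = (- \<i>/2) * ((LINT x|lborel. cis (t * x) * f x) - (LINT x|lborel. cis (t * x) * cnj (f x)))"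
      by (simp add: i)
    finally show "(LINT x|lborel. cis (t * x) * complex_of_real (Im (f x))) = 0" by (simp add: zero conj)
  qed
  ultimately show ?thesis by eventually_elim (simp add: complex_eq_iff)
qed

text \<open>One variable at a time. For fixed \<open>b\<close> the partial transform \<open>K b\<close> in the second variable is an integrable function of the
  first with vanishing transform. The exceptional null set depends on \<open>b\<close>; rational \<open>b\<close> share one, and
  dominated convergence extends the conclusion to all real \<open>b\<close>.\<close>

lemma fourier_injective_2:
  fixes h :: "real \<times> real \<Rightarrow> complex"
  assumes h: "integrable lborel h"
    and zero: "\<And>a. (LINT \<xi>|lborel. cis (a \<bullet> \<xi>) * h \<xi>) = 0"
  shows "AE \<xi> in lborel. h \<xi> = 0"
proof -
  have hm[measurable]: "h \<in> borel_measurable (lborel \<Otimes>\<^sub>M lborel)"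
    using borel_measurable_integrable[OF h] by (simp add: lborel_prod)
  have ic: "integrable (lborel \<Otimes>\<^sub>M lborel) (\<lambda>\<xi>. cis (a \<bullet> \<xi>) * h \<xi>)" for a
    unfolding lborel_prod by (rule integrable_cis_mult[OF h]) simp
  define K where "K b x = (LINT y|lborel. cis (b * y) * h (x, y))" for b x
  have K0: "AE x in lborel. K b x = 0" for b
  proof (rule fourier_injective_1)
    have "integrable lborel (\<lambda>x. LINT y|lborel. cis ((0, b) \<bullet> (x, y)) * h (x, y))"
      by (rule lborel_pair.integrable_fst'[OF ic])
    then show "integrable lborel (K b)" by (simp add: K_def[abs_def])
    fix t
    have "(LINT x|lborel. cis (t * x) * K b x) = (LINT x|lborel. (LINT y|lborel. cis ((t, b) \<bullet> (x, y)) * h (x, y)))"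
      unfolding K_def
      by (simp add: cis_mult[symmetric] mult.assoc)
    also have "\<dots> = (LINT \<xi>|(lborel \<Otimes>\<^sub>M lborel). cis ((t, b) \<bullet> \<xi>) * h \<xi>)"
      by (rule lborel_pair.integral_fst'[OF ic])
    also have "\<dots> = 0" by (simp only: lborel_prod zero)
    finally show "(LINT x|lborel. cis (t * x) * K b x) = 0" .
  qed
  have "AE x in lborel. \<forall>q::rat. K (real_of_rat q) x = 0"
    by (simp add: AE_all_countable K0)
  moreover have "AE x in lborel. integrable lborel (\<lambda>y. h (x, y))"
    using lborel_pair.AE_integrable_fst'[of h] h by (simp add: lborel_prod)
  ultimately have "AE x in lborel. AE y in lborel. h (x, y) = 0"
  proof eventually_elim
    case (elim x)
    note hx = elim(2)
    show ?case
    proof (rule fourier_injective_1[OF hx])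
      fix b :: real
      have "b \<in> closure \<rat>" by (simp add: Rats_closure_real)
      then obtain q where q: "\<And>n. q n \<in> \<rat>" "q \<longlonglongrightarrow> b"
        unfolding closure_sequential by blast
      have lim: "(\<lambda>n. LINT y|lborel. cis (q n * y) * h (x, y)) \<longlonglongrightarrow> (LINT y|lborel. cis (b * y) * h (x, y))"
      proof (rule integral_dominated_convergence[where w = "\<lambda>y. norm (h (x, y))"])
        show "(\<lambda>y. cis (b * y) * h (x, y)) \<in> borel_measurable lborel"
          "(\<lambda>y. cis (q n * y) * h (x, y)) \<in> borel_measurable lborel" for n
          by (rule borel_measurable_integrable, rule integrable_cis_mult[OF hx], simp)+
        show "integrable lborel (\<lambda>y. norm (h (x, y)))" using hx by simp
        show "AE y in lborel. (\<lambda>n. cis (q n * y) * h (x, y)) \<longlonglongrightarrow> cis (b * y) * h (x, y)"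
          by (auto intro!: tendsto_intros q)
        show "AE y in lborel. norm (cis (q n * y) * h (x, y)) \<le> norm (h (x, y))" for n
          by (simp add: norm_mult)
      qed
      have "(LINT y|lborel. cis (q n * y) * h (x, y)) = 0" for n
      proof -
        obtain r where "q n = real_of_rat r" using q(1)[of n] by (auto elim: Rats_cases)
        then show ?thesis using elim(1) unfolding K_def by simp
      qed
      with lim have "(\<lambda>n::nat. 0) \<longlonglongrightarrow> (LINT y|lborel. cis (b * y) * h (x, y))" by simp
      then show "(LINT y|lborel. cis (b * y) * h (x, y)) = 0"
        by (simp add: LIMSEQ_const_iff)
    qed
  qed
  moreover have "{\<xi> \<in> space (lborel \<Otimes>\<^sub>M lborel). h \<xi> = 0} \<in> sets (lborel \<Otimes>\<^sub>M lborel)"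
    by measurable
  ultimately have "AE \<xi> in lborel \<Otimes>\<^sub>M lborel. h \<xi> = 0"
    by (intro lborel_pair.AE_pair_measure)
  then show ?thesis by (simp only: lborel_prod)
qed

section \<open>Fourier transforms of distributions\<close>

lemma has_fourierD:
  assumes "has_fourier v g"
  shows "v \<in> distributions" "g \<in> borel_measurable borel"
    "\<phi> \<in> test_functions \<Longrightarrow> integrable lborel (\<lambda>\<xi>. g \<xi> * inv_fourier \<phi> \<xi>)"
    "\<phi> \<in> test_functions \<Longrightarrow> v \<phi> = (LINT \<xi>|lborel. g \<xi> * inv_fourier \<phi> \<xi>)"
proof -
  note a = assms[unfolded has_fourier_def]
  show "v \<in> distributions" "g \<in> borel_measurable borel"
    by (rule a[THEN conjunct1], rule a[THEN conjunct2, THEN conjunct1])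
  show "\<phi> \<in> test_functions \<Longrightarrow> integrable lborel (\<lambda>\<xi>. g \<xi> * inv_fourier \<phi> \<xi>)"
    "\<phi> \<in> test_functions \<Longrightarrow> v \<phi> = (LINT \<xi>|lborel. g \<xi> * inv_fourier \<phi> \<xi>)"
    by (rule a[THEN conjunct2, THEN conjunct2, rule_format, THEN conjunct1], assumption,
        rule a[THEN conjunct2, THEN conjunct2, rule_format, THEN conjunct2], assumption)
qed

lemma inv_fourier_translate:
  assumes "\<phi> \<in> test_functions"
  shows "inv_fourier (\<lambda>z. \<phi> (z - p)) \<xi> = cis (p \<bullet> \<xi>) * inv_fourier \<phi> \<xi>"
proof -
  have m: "(\<lambda>z. cis (z \<bullet> \<xi>) * \<phi> (z - p)) \<in> borel_measurable borel"
  proof (rule borel_measurable_continuous_onI)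
    have "continuous_on UNIV \<phi>" using partial_continuous[OF assms, of UNIV 0 0] by simp
    then have "continuous_on UNIV (\<lambda>z. \<phi> (z - p))"
      by (rule continuous_on_compose2) (auto intro!: continuous_intros)
    then show "continuous_on UNIV (\<lambda>z. cis (z \<bullet> \<xi>) * \<phi> (z - p))"
      by (intro continuous_on_mult continuous_cis_inner)
  qed
  have "(LINT z|lborel. cis (z \<bullet> \<xi>) * \<phi> (z - p)) = (LINT z|distr lborel borel ((+) p). cis (z \<bullet> \<xi>) * \<phi> (z - p))"
    by (simp only: lborel_distr_plus)
  also have "\<dots> = (LINT z|lborel. cis ((p + z) \<bullet> \<xi>) * \<phi> (p + z - p))"
    by (rule integral_distr) (use m in auto)
  also have "\<dots> = (LINT z|lborel. cis (p \<bullet> \<xi>) * (cis (z \<bullet> \<xi>) * \<phi> z))"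
    by (simp add: inner_add_left cis_mult[symmetric] mult.assoc)
  also have "\<dots> = cis (p \<bullet> \<xi>) * (LINT z|lborel. cis (z \<bullet> \<xi>) * \<phi> z)"
    by (rule integral_mult_right_zero)
  finally show ?thesis by (simp only: inv_fourier_alt mult.left_commute)
qed

text \<open>On the support the phase \<open>z \<bullet> \<xi>\<close> is at most \<open>1\<close> in absolute value, so its cosine is positive.\<close>

lemma inv_fourier_bump_nonzero:
  assumes r: "r > 0" and \<xi>: "r * (\<bar>fst \<xi>\<bar> + \<bar>snd \<xi>\<bar>) \<le> 1"
  shows "inv_fourier (\<lambda>z. complex_of_real (bump r z)) \<xi> \<noteq> 0"
proof
  assume 0: "inv_fourier (\<lambda>z. complex_of_real (bump r z)) \<xi> = 0"
  have i: "integrable lborel (\<lambda>z. cis (z \<bullet> \<xi>) * complex_of_real (bump r z))"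
    using integrable_mult_partial[OF bump_test_function[OF r] continuous_cis_inner, where a = 0 and b = 0] by simp
  have i': "integrable lborel (\<lambda>z. cos (z \<bullet> \<xi>) * bump r z)"
    using integrable_Re[OF i] by simp
  have "(LINT z|lborel. cis (z \<bullet> \<xi>) * complex_of_real (bump r z)) = 0"
    using 0 by (simp add: inv_fourier_alt)
  then have "Re (LINT z|lborel. cis (z \<bullet> \<xi>) * complex_of_real (bump r z)) = 0" by simp
  then have int0: "(LINT z|lborel. cos (z \<bullet> \<xi>) * bump r z) = 0"
    by (subst (asm) integral_Re[OF i, symmetric]) simp
  have pos: "cos (z \<bullet> \<xi>) > 0" if "\<bar>fst z\<bar> < r \<and> \<bar>snd z\<bar> < r" for z
  proof -
    have "\<bar>z \<bullet> \<xi>\<bar> \<le> \<bar>fst z\<bar> * \<bar>fst \<xi>\<bar> + \<bar>snd z\<bar> * \<bar>snd \<xi>\<bar>"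
      unfolding inner_prod_def by (rule order_trans[OF abs_triangle_ineq]) (simp add: abs_mult)
    also have "\<dots> \<le> r * \<bar>fst \<xi>\<bar> + r * \<bar>snd \<xi>\<bar>"
      using that by (intro add_mono mult_right_mono) auto
    also have "\<dots> \<le> 1" using \<xi> by (simp add: distrib_left)
    finally show ?thesis using pi_gt3 by (intro cos_gt_zero_pi) linarith+
  qed
  have nn: "0 \<le> cos (z \<bullet> \<xi>) * bump r z" for z
    using pos[of z] bump_nonneg[of r z] bump_nonzero_iff[OF r, of z]
    by (cases "bump r z = 0") (auto intro!: mult_nonneg_nonneg less_imp_le)
  have "AE z in lborel. cos (z \<bullet> \<xi>) * bump r z = 0"
    using integral_nonneg_eq_0_iff_AE[OF i'] nn int0 by simp
  then have "AE z in lborel. z \<notin> {- r<..<r} \<times> {- r<..<r}"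
  proof eventually_elim
    case (elim z)
    show ?case
    proof
      assume "z \<in> {- r<..<r} \<times> {- r<..<r}"
      then have z: "\<bar>fst z\<bar> < r \<and> \<bar>snd z\<bar> < r" by (auto simp: mem_Times_iff)
      then have "bump r z \<noteq> 0" using bump_nonzero_iff[OF r] by simp
      then show False using elim pos[OF z] by simp
    qed
  qed
  then have "emeasure lborel ({- r<..<r} \<times> {- r<..<r}) = 0"
    by (subst (asm) AE_iff_measurable[OF _ refl]) (auto simp: borel_Times Collect_conv_if)
  moreover have "emeasure (lborel \<Otimes>\<^sub>M lborel) ({- r<..<r} \<times> {- r<..<r}) = ennreal (2 * r) * ennreal (2 * r)"
    using r by (subst lborel.emeasure_pair_measure_Times) auto
  ultimately show False using r by (simp add: lborel_prod)
qed

text \<open>For the difference \<open>h\<close> of two transforms and a test function \<open>\<phi>\<close>, translating \<open>\<phi>\<close> by \<open>p\<close> multiplies its inverse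
  transform by \<open>cis (p \<bullet> \<xi>)\<close>. Hence the integrable function \<open>h * inv_fourier \<phi>\<close> has vanishing Fourier transform and is
  \<open>0\<close> almost everywhere. Bumps of radius \<open>1 / (n + 1)\<close> have inverse transforms without a common
  zero, and countably many of them suffice.\<close>

lemma has_fourier_unique:
  assumes g: "has_fourier v g" and g': "has_fourier v g'"
  shows "AE \<xi> in lborel. g \<xi> = g' \<xi>"
proof -
  define h where "h \<xi> = g \<xi> - g' \<xi>" for \<xi>
  have int: "integrable lborel (\<lambda>\<xi>. h \<xi> * inv_fourier \<phi> \<xi>)" and zero: "(LINT \<xi>|lborel. h \<xi> * inv_fourier \<phi> \<xi>) = 0"
    if \<phi>: "\<phi> \<in> test_functions" for \<phi>
  proof -
    have eq: "(\<lambda>\<xi>. h \<xi> * inv_fourier \<phi> \<xi>) = (\<lambda>\<xi>. g \<xi> * inv_fourier \<phi> \<xi> - g' \<xi> * inv_fourier \<phi> \<xi>)"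
      by (simp add: h_def left_diff_distrib)
    show "integrable lborel (\<lambda>\<xi>. h \<xi> * inv_fourier \<phi> \<xi>)"
      unfolding eq by (intro Bochner_Integration.integrable_diff has_fourierD(3)[OF g \<phi>] has_fourierD(3)[OF g' \<phi>])
    show "(LINT \<xi>|lborel. h \<xi> * inv_fourier \<phi> \<xi>) = 0"
      unfolding eq Bochner_Integration.integral_diff[OF has_fourierD(3)[OF g \<phi>] has_fourierD(3)[OF g' \<phi>]]
      by (simp only: has_fourierD(4)[OF g \<phi>, symmetric] has_fourierD(4)[OF g' \<phi>, symmetric] diff_self)
  qed
  have ae: "AE \<xi> in lborel. h \<xi> * inv_fourier \<phi> \<xi> = 0" if \<phi>: "\<phi> \<in> test_functions" for \<phi>
  proof (rule fourier_injective_2[OF int[OF \<phi>]])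
    fix p
    have "(LINT \<xi>|lborel. h \<xi> * inv_fourier (\<lambda>z. \<phi> (z - p)) \<xi>) = 0"
      by (rule zero[OF test_functions_translate[OF \<phi>]])
    then show "(LINT \<xi>|lborel. cis (p \<bullet> \<xi>) * (h \<xi> * inv_fourier \<phi> \<xi>)) = 0"
      by (simp only: inv_fourier_translate[OF \<phi>] mult.left_commute)
  qed
  have "AE \<xi> in lborel. \<forall>n. h \<xi> * inv_fourier (\<lambda>z. complex_of_real (bump (1 / (1 + real n)) z)) \<xi> = 0"
    unfolding AE_all_countable by (intro allI ae bump_test_function) (simp add: add_pos_nonneg)
  then show ?thesis
  proof eventually_elim
    case (elim \<xi>)
    obtain n :: nat where "\<bar>fst \<xi>\<bar> + \<bar>snd \<xi>\<bar> \<le> real n" using real_arch_simple by blast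
    then have "1 / (1 + real n) * (\<bar>fst \<xi>\<bar> + \<bar>snd \<xi>\<bar>) \<le> 1" by (simp add: divide_simps)
    then have "inv_fourier (\<lambda>z. complex_of_real (bump (1 / (1 + real n)) z)) \<xi> \<noteq> 0"
      by (intro inv_fourier_bump_nonzero) (simp_all add: add_pos_nonneg)
    then show ?case using elim[rule_format, of n] by (simp add: h_def)
  qed
qed

lemma fourier_works: "has_fourier v g \<Longrightarrow> has_fourier v (fourier v)"
  unfolding fourier_def by (rule someI[of "has_fourier v" g])

lemma fourier_AE_eq: "has_fourier v g \<Longrightarrow> AE \<xi> in lborel. fourier v \<xi> = g \<xi>"
  by (rule has_fourier_unique[OF fourier_works[of v g], of g])

lemma has_fourier_determines:
  assumes "has_fourier v g" "has_fourier v' g'" "AE \<xi> in lborel. g \<xi> = g' \<xi>"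
  shows "v = v'"
proof (rule extensionalityI)
  show "v \<in> extensional test_functions" "v' \<in> extensional test_functions"
    by (rule distributions_extensional, rule has_fourierD(1), rule assms)+
  fix \<phi> assume \<phi>: "\<phi> \<in> test_functions"
  have "(LINT \<xi>|lborel. g \<xi> * inv_fourier \<phi> \<xi>) = (LINT \<xi>|lborel. g' \<xi> * inv_fourier \<phi> \<xi>)"
  proof (rule integral_cong_AE)
    show "AE \<xi> in lborel. g \<xi> * inv_fourier \<phi> \<xi> = g' \<xi> * inv_fourier \<phi> \<xi>"
      using assms(3) by eventually_elim simp
  qed (use has_fourierD(3)[OF assms(1) \<phi>] has_fourierD(3)[OF assms(2) \<phi>] in \<open>auto dest: borel_measurable_integrable\<close>)
  then show "v \<phi> = v' \<phi>"
    by (simp only: has_fourierD(4)[OF assms(1) \<phi>] has_fourierD(4)[OF assms(2) \<phi>])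
qed

text \<open>The square of the Japanese bracket of \<open>\<xi>\<close>.\<close>

definition bracket_sq :: "real \<times> real \<Rightarrow> real"
  where "bracket_sq \<xi> = 1 + (fst \<xi>)\<^sup>2 + (snd \<xi>)\<^sup>2"

lemma bracket_sq_ge_1: "1 \<le> bracket_sq \<xi>" and bracket_sq_pos: "0 < bracket_sq \<xi>"
  by (simp_all add: bracket_sq_def add_pos_nonneg)

lemma bracket_sq_measurable [measurable]: "bracket_sq \<in> borel_measurable borel"
  unfolding bracket_sq_def[abs_def] by (intro borel_measurable_continuous_onI continuous_intros)

lemma integrable_bracket_sq:
  assumes "p \<le> - 2"
  shows "integrable lborel (\<lambda>\<xi>. bracket_sq \<xi> powr p)"
proof -
  have i1: "integrable lborel (\<lambda>x::real. inverse (1 + x\<^sup>2))"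
    using integrable_inverse_1_plus_square by (simp add: set_integrable_def)
  have "integrable (lborel \<Otimes>\<^sub>M lborel) (\<lambda>\<xi>::real \<times> real. inverse (1 + (fst \<xi>)\<^sup>2) * inverse (1 + (snd \<xi>)\<^sup>2))"
  proof (rule lborel_pair.Fubini_integrable)
    show "(\<lambda>\<xi>::real \<times> real. inverse (1 + (fst \<xi>)\<^sup>2) * inverse (1 + (snd \<xi>)\<^sup>2)) \<in> borel_measurable (lborel \<Otimes>\<^sub>M lborel)"
      by measurable
    show "integrable lborel (\<lambda>x::real. LINT y|lborel. norm (inverse (1 + (fst (x, y))\<^sup>2) * inverse (1 + (snd (x, y))\<^sup>2) :: real))"
      by (simp add: abs_mult i1)
    show "AE x::real in lborel. integrable lborel (\<lambda>y::real. inverse (1 + (fst (x, y))\<^sup>2) * inverse (1 + (snd (x, y))\<^sup>2))"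
      using i1 by simp
  qed
  then have i2: "integrable lborel (\<lambda>\<xi>::real \<times> real. inverse (1 + (fst \<xi>)\<^sup>2) * inverse (1 + (snd \<xi>)\<^sup>2))"
    by (simp only: lborel_prod)
  show ?thesis
  proof (rule Bochner_Integration.integrable_bound[OF i2])
    show "(\<lambda>\<xi>. bracket_sq \<xi> powr p) \<in> borel_measurable lborel" by measurable
    have "bracket_sq \<xi> powr p \<le> inverse (1 + (fst \<xi>)\<^sup>2) * inverse (1 + (snd \<xi>)\<^sup>2)" for \<xi>
    proof -
      have "bracket_sq \<xi> powr p \<le> bracket_sq \<xi> powr (- 2)"
        using assms bracket_sq_ge_1 by (intro powr_mono) auto
      also have "\<dots> = inverse ((bracket_sq \<xi>)\<^sup>2)"
        using bracket_sq_pos[of \<xi>] by (simp add: powr_minus)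
      also have "\<dots> \<le> inverse ((1 + (fst \<xi>)\<^sup>2) * (1 + (snd \<xi>)\<^sup>2))"
      proof (rule le_imp_inverse_le)
        have "(1 + (fst \<xi>)\<^sup>2) * (1 + (snd \<xi>)\<^sup>2) \<le> bracket_sq \<xi> * bracket_sq \<xi>"
          by (intro mult_mono) (auto simp: bracket_sq_def add_nonneg_nonneg)
        then show "(1 + (fst \<xi>)\<^sup>2) * (1 + (snd \<xi>)\<^sup>2) \<le> (bracket_sq \<xi>)\<^sup>2" by (simp add: power2_eq_square)
      qed (simp add: add_pos_nonneg)
      finally show ?thesis by simp
    qed
    then show "AE \<xi> in lborel. norm (bracket_sq \<xi> powr p) \<le> norm (inverse (1 + (fst \<xi>)\<^sup>2) * inverse (1 + (snd \<xi>)\<^sup>2))"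
      by (simp add: abs_mult)
  qed
qed

lemma inv_fourier_power:
  assumes "\<phi> \<in> test_functions"
  shows "cmod (inv_fourier (partial a 0 \<phi>) \<xi>) = \<bar>fst \<xi>\<bar> ^ a * cmod (inv_fourier \<phi> \<xi>)"
    and "cmod (inv_fourier (partial 0 b \<phi>) \<xi>) = \<bar>snd \<xi>\<bar> ^ b * cmod (inv_fourier \<phi> \<xi>)"
proof -
  show "cmod (inv_fourier (partial a 0 \<phi>) \<xi>) = \<bar>fst \<xi>\<bar> ^ a * cmod (inv_fourier \<phi> \<xi>)"
    by (induction a) (simp_all add: inv_fourier_partial(1)[OF assms] norm_mult)
  show "cmod (inv_fourier (partial 0 b \<phi>) \<xi>) = \<bar>snd \<xi>\<bar> ^ b * cmod (inv_fourier \<phi> \<xi>)"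
    by (induction b) (simp_all add: inv_fourier_partial(2)[OF assms] norm_mult)
qed

text \<open>Only pure derivatives of order \<open>2N\<close> enter, since \<open>(1 + x + y)\<^sup>N \<le> 3\<^sup>N (1 + x\<^sup>N + y\<^sup>N)\<close>.\<close>

lemma inv_fourier_decay:
  assumes \<phi>: "\<phi> \<in> test_functions" and K: "compact K" "supp \<phi> \<subseteq> K"
  shows "bracket_sq \<xi> ^ N * cmod (inv_fourier \<phi> \<xi>) \<le> 3 ^ Suc N * measure lborel K * sum_sup (2 * N) \<phi>"
proof -
  let ?F = "cmod (inv_fourier \<phi> \<xi>)" and ?B = "measure lborel K * sum_sup (2 * N) \<phi>"
  have b: "cmod (inv_fourier (partial a b \<phi>) \<xi>) \<le> ?B" if "a + b \<le> 2 * N" for a b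
    by (rule order_trans[OF inv_fourier_bound[OF \<phi> K]])
      (intro mult_left_mono sup_partial_le_sum_sup[OF \<phi> that] measure_nonneg)
  define x y where "x = (fst \<xi>)\<^sup>2" and "y = (snd \<xi>)\<^sup>2"
  have xy: "0 \<le> x" "0 \<le> y" by (simp_all add: x_def y_def)
  have "bracket_sq \<xi> \<le> 3 * max 1 (max x y)" by (simp add: bracket_sq_def x_def y_def)
  then have "bracket_sq \<xi> ^ N \<le> (3 * max 1 (max x y)) ^ N"
    using bracket_sq_pos[of \<xi>] by (intro power_mono) auto
  also have "\<dots> = 3 ^ N * max 1 (max x y) ^ N" by (simp add: power_mult_distrib)
  also have "max 1 (max x y) ^ N \<le> 1 + x ^ N + y ^ N"
    using xy by (auto simp: max_def)
  finally have "bracket_sq \<xi> ^ N \<le> 3 ^ N * (1 + x ^ N + y ^ N)" by simp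
  then have "bracket_sq \<xi> ^ N * ?F \<le> 3 ^ N * (1 + x ^ N + y ^ N) * ?F"
    by (rule mult_right_mono) simp
  also have "\<dots> = 3 ^ N * (?F + x ^ N * ?F + y ^ N * ?F)" by (simp add: algebra_simps)
  also have "\<dots> \<le> 3 ^ N * (?B + ?B + ?B)"
  proof (intro mult_left_mono add_mono)
    show "?F \<le> ?B" using b[of 0 0] by simp
    show "x ^ N * ?F \<le> ?B"
      using b[of "2 * N" 0] unfolding inv_fourier_power(1)[OF \<phi>] by (simp add: x_def power_mult)
    show "y ^ N * ?F \<le> ?B"
      using b[of 0 "2 * N"] unfolding inv_fourier_power(2)[OF \<phi>] by (simp add: y_def power_mult)
  qed simp
  finally show ?thesis by (simp add: algebra_simps)
qed

lemma inv_fourier_measurable: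
  assumes "\<phi> \<in> test_functions"
  shows "inv_fourier \<phi> \<in> borel_measurable borel"
proof -
  have [measurable]: "\<phi> \<in> borel_measurable borel"
    using borel_measurable_continuous_onI partial_continuous[OF assms, of UNIV 0 0] by simp
  have "continuous_on UNIV cis" by (intro continuous_intros)
  then have [measurable]: "cis \<in> borel_measurable borel"
    by (rule borel_measurable_continuous_onI)
  have "(\<lambda>\<xi>. LINT z|lborel. cis (z \<bullet> \<xi>) * \<phi> z) \<in> borel_measurable lborel"
    by (rule lborel.borel_measurable_lebesgue_integral) measurable
  then show ?thesis unfolding inv_fourier_alt[abs_def] by simp
qed

text \<open>Pairing with \<open>g\<close> converges absolutely because \<open>|g| / \<langle>\<xi>\<rangle>\<^bsup>2N\<^esup>\<close> is integrable for large \<open>N\<close>: it is the product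
  of the square integrable functions \<open>\<langle>\<xi>\<rangle>\<^bsup>s\<^esup> |g|\<close> and \<open>\<langle>\<xi>\<rangle>\<^bsup>- 2N - s\<^esup>\<close>, where \<open>\<langle>\<xi>\<rangle>\<^sup>2\<close> is \<^const>\<open>bracket_sq\<close>. The decay estimate is
  linear in the seminorms of \<open>\<phi>\<close>, which gives continuity.\<close>

lemma has_fourier_exists:
  fixes g :: "real \<times> real \<Rightarrow> complex"
  assumes g[measurable]: "g \<in> borel_measurable borel"
    and int: "integrable lborel (\<lambda>\<xi>. bracket_sq \<xi> powr s * (cmod (g \<xi>))\<^sup>2)"
  shows "\<exists>v. has_fourier v g"
proof -
  \<comment> \<open>large enough for the exponent \<open>- 2N - s\<close> to be at most \<open>- 2\<close>, hence integrable in the plane\<close>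
  define N where "N = nat \<lceil>\<bar>s\<bar>\<rceil> + 1"
  have N: "real N \<ge> 1 - s / 2"
    unfolding N_def by linarith
  have gN: "integrable lborel (\<lambda>\<xi>. cmod (g \<xi>) / bracket_sq \<xi> ^ N)"
  proof (rule Bochner_Integration.integrable_bound)
    show "integrable lborel (\<lambda>\<xi>. bracket_sq \<xi> powr s * (cmod (g \<xi>))\<^sup>2 + bracket_sq \<xi> powr (- 2 * real N - s))"
      using N by (intro Bochner_Integration.integrable_add int integrable_bracket_sq) simp
    show "(\<lambda>\<xi>. cmod (g \<xi>) / bracket_sq \<xi> ^ N) \<in> borel_measurable lborel" by measurable
    have "cmod (g \<xi>) / bracket_sq \<xi> ^ N \<le> bracket_sq \<xi> powr s * (cmod (g \<xi>))\<^sup>2 + bracket_sq \<xi> powr (- 2 * real N - s)" for \<xi>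
    proof -
      let ?w = "bracket_sq \<xi>"
      define a b where "a = ?w powr (s / 2) * cmod (g \<xi>)" and "b = ?w powr (- real N - s / 2)"
      have w: "?w > 0" by (rule bracket_sq_pos)
      have "a * b = cmod (g \<xi>) * (?w powr (s / 2) * ?w powr (- real N - s / 2))"
        unfolding a_def b_def by (simp only: mult_ac)
      also have "?w powr (s / 2) * ?w powr (- real N - s / 2) = ?w powr (- real N)"
        unfolding powr_add[symmetric] by simp
      also have "cmod (g \<xi>) * ?w powr (- real N) = cmod (g \<xi>) / ?w ^ N"
        using w by (simp only: powr_minus powr_realpow divide_inverse)
      finally have ab: "a * b = cmod (g \<xi>) / ?w ^ N" .
      have sq: "(?w powr e)\<^sup>2 = ?w powr (2 * e)" for e
        unfolding power2_eq_square powr_add[symmetric] by simp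
      have "a\<^sup>2 = ?w powr s * (cmod (g \<xi>))\<^sup>2"
        unfolding a_def power_mult_distrib sq by simp
      moreover have "b\<^sup>2 = ?w powr (- 2 * real N - s)"
        unfolding b_def sq by (simp add: right_diff_distrib)
      moreover have "a * b \<le> a\<^sup>2 + b\<^sup>2"
        using sum_squares_bound[of a b] zero_le_power2[of a] zero_le_power2[of b] by linarith
      ultimately show ?thesis using ab by simp
    qed
    then show "AE \<xi> in lborel. norm (cmod (g \<xi>) / bracket_sq \<xi> ^ N)
        \<le> norm (bracket_sq \<xi> powr s * (cmod (g \<xi>))\<^sup>2 + bracket_sq \<xi> powr (- 2 * real N - s))"
      using bracket_sq_pos by (intro AE_I2) (simp add: abs_of_nonneg less_imp_le)
  qed
  define C where "C K = 3 ^ Suc N * measure lborel K" for K :: "(real \<times> real) set"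
  have bound: "cmod (g \<xi> * inv_fourier \<phi> \<xi>) \<le> C K * sum_sup (2 * N) \<phi> * (cmod (g \<xi>) / bracket_sq \<xi> ^ N)"
    if \<phi>: "\<phi> \<in> test_functions" and K: "compact K" "supp \<phi> \<subseteq> K" for \<phi> K \<xi>
  proof -
    have w: "bracket_sq \<xi> ^ N > 0" using bracket_sq_pos by simp
    have "cmod (inv_fourier \<phi> \<xi>) \<le> C K * sum_sup (2 * N) \<phi> / bracket_sq \<xi> ^ N"
      using inv_fourier_decay[OF \<phi> K, of \<xi> N] w by (simp add: C_def pos_le_divide_eq mult.commute)
    then have "cmod (g \<xi>) * cmod (inv_fourier \<phi> \<xi>) \<le> cmod (g \<xi>) * (C K * sum_sup (2 * N) \<phi> / bracket_sq \<xi> ^ N)"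
      by (rule mult_left_mono) simp
    then show ?thesis by (simp add: norm_mult mult_ac)
  qed
  have intg: "integrable lborel (\<lambda>\<xi>. g \<xi> * inv_fourier \<phi> \<xi>)" if \<phi>: "\<phi> \<in> test_functions" for \<phi>
  proof (rule Bochner_Integration.integrable_bound)
    show "integrable lborel (\<lambda>\<xi>. C (supp \<phi>) * sum_sup (2 * N) \<phi> * (cmod (g \<xi>) / bracket_sq \<xi> ^ N))"
      by (intro integrable_mult_right gN)
    note inv_fourier_measurable[OF \<phi>, measurable]
    show "(\<lambda>\<xi>. g \<xi> * inv_fourier \<phi> \<xi>) \<in> borel_measurable lborel" by measurable
    show "AE \<xi> in lborel. cmod (g \<xi> * inv_fourier \<phi> \<xi>)
        \<le> norm (C (supp \<phi>) * sum_sup (2 * N) \<phi> * (cmod (g \<xi>) / bracket_sq \<xi> ^ N))"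
      unfolding real_norm_def
      by (intro AE_I2 order_trans[OF bound[OF \<phi> test_functionsD(2)[OF \<phi>] order_refl] abs_ge_self])
  qed
  define v where "v = restrict (\<lambda>\<phi>. LINT \<xi>|lborel. g \<xi> * inv_fourier \<phi> \<xi>) test_functions"
  have v: "v \<phi> = (LINT \<xi>|lborel. g \<xi> * inv_fourier \<phi> \<xi>)" if "\<phi> \<in> test_functions" for \<phi>
    unfolding v_def by (rule restrict_apply'[OF that])
  have "v \<in> distributions"
    unfolding distributions_iff
  proof (intro conjI ballI allI impI)
    show "v \<in> extensional test_functions" unfolding v_def by (rule restrict_extensional)
  next
    fix \<phi> \<psi> :: "real \<times> real \<Rightarrow> complex" and a b
    assume T: "\<phi> \<in> test_functions" "\<psi> \<in> test_functions"
    have "v (\<lambda>z. a * \<phi> z + b * \<psi> z) = (LINT \<xi>|lborel. a * (g \<xi> * inv_fourier \<phi> \<xi>) + b * (g \<xi> * inv_fourier \<psi> \<xi>))"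
      unfolding v[OF test_functions_linear[OF T]] inv_fourier_linear[OF T]
      by (simp only: distrib_left mult.left_commute)
    also have "\<dots> = a * v \<phi> + b * v \<psi>"
      unfolding v[OF T(1)] v[OF T(2)]
      by (subst Bochner_Integration.integral_add) (simp_all add: intg T)
    finally show "v (\<lambda>z. a * \<phi> z + b * \<psi> z) = a * v \<phi> + b * v \<psi>" .
  next
    fix K :: "(real \<times> real) set"
    assume K: "compact K"
    define J where "J = (LINT \<xi>|lborel. cmod (g \<xi>) / bracket_sq \<xi> ^ N)"
    have "cmod (v \<phi>) \<le> (C K * J) * sum_sup (2 * N) \<phi>" if \<phi>: "\<phi> \<in> test_functions" "supp \<phi> \<subseteq> K" for \<phi>
    proof -
      have "cmod (v \<phi>) \<le> (LINT \<xi>|lborel. cmod (g \<xi> * inv_fourier \<phi> \<xi>))"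
        unfolding v[OF \<phi>(1)] by (rule integral_norm_bound)
      also have "\<dots> \<le> (LINT \<xi>|lborel. C K * sum_sup (2 * N) \<phi> * (cmod (g \<xi>) / bracket_sq \<xi> ^ N))"
        by (intro integral_mono integrable_norm intg \<phi> integrable_mult_right gN bound K)
      also have "\<dots> = C K * sum_sup (2 * N) \<phi> * J" unfolding J_def by (rule integral_mult_right_zero)
      finally show ?thesis by (simp only: mult_ac)
    qed
    then show "\<exists>C N. \<forall>\<phi>\<in>test_functions. supp \<phi> \<subseteq> K \<longrightarrow> cmod (v \<phi>) \<le> C * sum_sup N \<phi>"
      by (intro exI ballI impI)
  qed
  then have "has_fourier v g"
    unfolding has_fourier_def by (intro conjI ballI g intg v)
  then show ?thesis by (rule exI[of _ v])
qed

section \<open>Weighted norms on the Fourier side\<close>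

abbreviation Lam :: "real \<Rightarrow> real \<times> real \<Rightarrow> real"
  where "Lam \<gamma> \<xi> \<equiv> Lambda (Complex \<gamma> (fst \<xi>)) (snd \<xi>)"

abbreviation energy :: "real \<Rightarrow> real \<Rightarrow> (real \<times> real \<Rightarrow> complex) \<Rightarrow> ennreal"
  where "energy \<gamma> p g \<equiv> (\<integral>\<^sup>+\<xi>. ennreal (Lam \<gamma> \<xi> powr p * (cmod (g \<xi>))\<^sup>2) \<partial>lborel)"

abbreviation line_energy :: "real set \<Rightarrow> (real \<times> real \<times> real \<Rightarrow> complex) \<Rightarrow> real \<times> real \<Rightarrow> ennreal"
  where "line_energy J G \<xi> \<equiv> (\<integral>\<^sup>+y. indicator J y * ennreal ((cmod (G (y, \<xi>)))\<^sup>2) \<partial>lborel)"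

lemma Lam_sq: "(Lam \<gamma> \<xi>)\<^sup>2 = \<gamma>\<^sup>2 + (fst \<xi>)\<^sup>2 + (snd \<xi>)\<^sup>2"
  unfolding Lambda_def cmod_power2 complex.sel
  by (rule real_sqrt_pow2) (intro add_nonneg_nonneg zero_le_power2)

lemma Lam_pos: "\<gamma> > 0 \<Longrightarrow> Lam \<gamma> \<xi> > 0"
  unfolding Lambda_def cmod_power2 complex.sel
  by (rule real_sqrt_gt_zero) (intro add_pos_nonneg zero_le_power2 zero_less_power)

lemma Lam_measurable [measurable]: "Lam \<gamma> \<in> borel_measurable borel"
  unfolding Lambda_def cmod_power2 complex.sel
  by (intro borel_measurable_continuous_onI continuous_intros)

lemma powr_comparable:
  fixes a b c s :: real
  assumes "0 < a" "a \<le> b" "b \<le> c * a" "1 \<le> c"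
  shows "a powr s \<le> c powr \<bar>s\<bar> * b powr s" "b powr s \<le> c powr \<bar>s\<bar> * a powr s"
proof -
  have c1: "1 \<le> c powr \<bar>s\<bar>" using assms by (simp add: ge_one_powr_ge_zero)
  have b: "b > 0" using assms by linarith
  have "a powr s \<le> c powr \<bar>s\<bar> * b powr s \<and> b powr s \<le> c powr \<bar>s\<bar> * a powr s"
  proof (cases "s \<ge> 0")
    case True
    have "a powr s \<le> 1 * b powr s" using assms True by (simp add: powr_mono2)
    also have "\<dots> \<le> c powr \<bar>s\<bar> * b powr s" using c1 by (intro mult_right_mono) auto
    finally have "a powr s \<le> c powr \<bar>s\<bar> * b powr s" .
    moreover have "b powr s \<le> (c * a) powr s" using assms b True by (intro powr_mono2) auto
    ultimately show ?thesis using assms True by (simp add: powr_mult)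
  next
    case False
    have "b powr s \<le> 1 * a powr s" using assms False by (simp add: powr_mono2')
    also have "\<dots> \<le> c powr \<bar>s\<bar> * a powr s" using c1 by (intro mult_right_mono) auto
    finally have "b powr s \<le> c powr \<bar>s\<bar> * a powr s" .
    moreover have "(c * a) powr s \<le> b powr s" using assms b False by (intro powr_mono2') auto
    then have "c powr \<bar>s\<bar> * (c powr s * a powr s) \<le> c powr \<bar>s\<bar> * b powr s"
      using assms by (intro mult_left_mono) (auto simp: powr_mult)
    then have "a powr s \<le> c powr \<bar>s\<bar> * b powr s"
      using assms False by (simp add: mult.assoc[symmetric] powr_add[symmetric])
    ultimately show ?thesis by simp
  qed
  then show "a powr s \<le> c powr \<bar>s\<bar> * b powr s" "b powr s \<le> c powr \<bar>s\<bar> * a powr s" by simp_all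
qed

text \<open>For fixed \<open>\<gamma>\<close> the two weights define the same space; the constant depends on \<open>\<gamma>\<close> and therefore serves only
  to pass between membership and finiteness of the norm, never in an estimate.\<close>

lemma Lam_powr_comparable:
  assumes \<gamma>: "\<gamma> \<ge> 1"
  shows "bracket_sq \<xi> powr s \<le> (\<gamma>\<^sup>2) powr \<bar>s\<bar> * Lam \<gamma> \<xi> powr (2 * s)"
    and "Lam \<gamma> \<xi> powr (2 * s) \<le> (\<gamma>\<^sup>2) powr \<bar>s\<bar> * bracket_sq \<xi> powr s"
proof -
  have g: "1 \<le> \<gamma>\<^sup>2" using \<gamma> by simp
  have eq: "Lam \<gamma> \<xi> powr (2 * s) = ((Lam \<gamma> \<xi>)\<^sup>2) powr s"
  proof -
    have "Lam \<gamma> \<xi> > 0" using \<gamma> by (intro Lam_pos) simp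
    then have "(Lam \<gamma> \<xi>)\<^sup>2 = Lam \<gamma> \<xi> powr 2" by simp
    then show ?thesis by (simp only: powr_powr)
  qed
  have le: "bracket_sq \<xi> \<le> (Lam \<gamma> \<xi>)\<^sup>2" using g by (simp add: bracket_sq_def Lam_sq)
  have "1 * ((fst \<xi>)\<^sup>2 + (snd \<xi>)\<^sup>2) \<le> \<gamma>\<^sup>2 * ((fst \<xi>)\<^sup>2 + (snd \<xi>)\<^sup>2)"
    using g by (intro mult_right_mono) auto
  then have "(Lam \<gamma> \<xi>)\<^sup>2 \<le> \<gamma>\<^sup>2 * bracket_sq \<xi>" by (simp add: bracket_sq_def Lam_sq distrib_left)
  from powr_comparable[OF bracket_sq_pos le this g]
  show "bracket_sq \<xi> powr s \<le> (\<gamma>\<^sup>2) powr \<bar>s\<bar> * Lam \<gamma> \<xi> powr (2 * s)"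
    "Lam \<gamma> \<xi> powr (2 * s) \<le> (\<gamma>\<^sup>2) powr \<bar>s\<bar> * bracket_sq \<xi> powr s"
    unfolding eq by auto
qed

lemma sobolev_iff:
  "v \<in> sobolev s \<longleftrightarrow> (\<exists>g. has_fourier v g \<and> integrable lborel (\<lambda>\<xi>. bracket_sq \<xi> powr s * (cmod (g \<xi>))\<^sup>2))"
  unfolding sobolev_def bracket_sq_def case_prod_beta by simp

lemma norm_s_def': "norm_s s \<gamma> v = sqrt ((1 / (2 * pi)\<^sup>2) *
    (LINT \<xi>|lborel. Lam \<gamma> \<xi> powr (2 * s) * (cmod (fourier v \<xi>))\<^sup>2))"
  unfolding norm_s_def case_prod_beta by simp

lemma sobolev_fourier:
  assumes v: "v \<in> sobolev s" and \<gamma>: "\<gamma> \<ge> 1"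
  shows "has_fourier v (fourier v)"
    and "integrable lborel (\<lambda>\<xi>. Lam \<gamma> \<xi> powr (2 * s) * (cmod (fourier v \<xi>))\<^sup>2)"
proof -
  obtain g where g: "has_fourier v g" and i: "integrable lborel (\<lambda>\<xi>. bracket_sq \<xi> powr s * (cmod (g \<xi>))\<^sup>2)"
    using v unfolding sobolev_iff by (elim exE conjE)
  show f: "has_fourier v (fourier v)" by (rule fourier_works[OF g])
  note has_fourierD(2)[OF f, measurable]
  show "integrable lborel (\<lambda>\<xi>. Lam \<gamma> \<xi> powr (2 * s) * (cmod (fourier v \<xi>))\<^sup>2)"
  proof (rule Bochner_Integration.integrable_bound)
    show "integrable lborel (\<lambda>\<xi>. (\<gamma>\<^sup>2) powr \<bar>s\<bar> * (bracket_sq \<xi> powr s * (cmod (g \<xi>))\<^sup>2))"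
      by (rule integrable_mult_right[OF i])
    show "AE \<xi> in lborel. norm (Lam \<gamma> \<xi> powr (2 * s) * (cmod (fourier v \<xi>))\<^sup>2)
        \<le> norm ((\<gamma>\<^sup>2) powr \<bar>s\<bar> * (bracket_sq \<xi> powr s * (cmod (g \<xi>))\<^sup>2))"
      using fourier_AE_eq[OF g]
    proof eventually_elim
      case (elim \<xi>)
      have "Lam \<gamma> \<xi> powr (2 * s) * (cmod (g \<xi>))\<^sup>2 \<le> (\<gamma>\<^sup>2) powr \<bar>s\<bar> * bracket_sq \<xi> powr s * (cmod (g \<xi>))\<^sup>2"
        by (intro mult_right_mono Lam_powr_comparable(2) \<gamma>) simp
      then show ?case by (simp add: elim abs_mult mult.assoc)
    qed
  qed measurable
qed

lemma norm_s_nn_integral: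
  assumes v: "v \<in> sobolev s" and \<gamma>: "\<gamma> \<ge> 1"
  shows "ennreal ((norm_s s \<gamma> v)\<^sup>2)
    = ennreal (1 / (2 * pi)\<^sup>2) * energy \<gamma> (2 * s) (fourier v)"
proof -
  have nn: "0 \<le> (LINT \<xi>|lborel. Lam \<gamma> \<xi> powr (2 * s) * (cmod (fourier v \<xi>))\<^sup>2)"
    by (intro integral_nonneg_AE AE_I2) simp
  have "(norm_s s \<gamma> v)\<^sup>2 = (1 / (2 * pi)\<^sup>2) * (LINT \<xi>|lborel. Lam \<gamma> \<xi> powr (2 * s) * (cmod (fourier v \<xi>))\<^sup>2)"
    unfolding norm_s_def' using nn by (intro real_sqrt_pow2 mult_nonneg_nonneg) auto
  then have "ennreal ((norm_s s \<gamma> v)\<^sup>2) = ennreal (1 / (2 * pi)\<^sup>2)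
      * ennreal (LINT \<xi>|lborel. Lam \<gamma> \<xi> powr (2 * s) * (cmod (fourier v \<xi>))\<^sup>2)"
    using nn by (simp only: ennreal_mult zero_le_divide_1_iff zero_le_power2)
  also have "ennreal (LINT \<xi>|lborel. Lam \<gamma> \<xi> powr (2 * s) * (cmod (fourier v \<xi>))\<^sup>2)
      = energy \<gamma> (2 * s) (fourier v)"
    by (rule nn_integral_eq_integral[OF sobolev_fourier(2)[OF v \<gamma>], symmetric]) simp
  finally show ?thesis .
qed

lemma integrable_bracket_of_Lam:
  assumes g[measurable]: "g \<in> borel_measurable borel" and \<gamma>: "\<gamma> \<ge> 1"
    and fin: "energy \<gamma> (2 * s) g < \<infinity>"
  shows "integrable lborel (\<lambda>\<xi>. bracket_sq \<xi> powr s * (cmod (g \<xi>))\<^sup>2)"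
proof (rule Bochner_Integration.integrable_bound)
  have i: "integrable lborel (\<lambda>\<xi>. Lam \<gamma> \<xi> powr (2 * s) * (cmod (g \<xi>))\<^sup>2)"
    by (rule integrableI_nonneg) (use fin in auto)
  show "integrable lborel (\<lambda>\<xi>. (\<gamma>\<^sup>2) powr \<bar>s\<bar> * (Lam \<gamma> \<xi> powr (2 * s) * (cmod (g \<xi>))\<^sup>2))"
    by (rule integrable_mult_right[OF i])
  have "bracket_sq \<xi> powr s * (cmod (g \<xi>))\<^sup>2 \<le> (\<gamma>\<^sup>2) powr \<bar>s\<bar> * Lam \<gamma> \<xi> powr (2 * s) * (cmod (g \<xi>))\<^sup>2" for \<xi>
    by (intro mult_right_mono Lam_powr_comparable(1) \<gamma>) simp
  then show "AE \<xi> in lborel. norm (bracket_sq \<xi> powr s * (cmod (g \<xi>))\<^sup>2)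
      \<le> norm ((\<gamma>\<^sup>2) powr \<bar>s\<bar> * (Lam \<gamma> \<xi> powr (2 * s) * (cmod (g \<xi>))\<^sup>2))"
    by (simp add: abs_mult mult.assoc)
qed measurable

lemma L2H_partial_fourier:
  assumes u: "u \<in> L2H J s \<gamma>"
  shows "has_partial_fourier J \<gamma> u (partial_fourier J \<gamma> u)"
proof -
  have "\<exists>G. has_partial_fourier J \<gamma> u G" using u unfolding L2H_def by simp
  then show ?thesis unfolding partial_fourier_def by (rule someI_ex)
qed

text \<open>The norm at almost every \<open>x\<^sub>3\<close> is computed from \<^const>\<open>fourier\<close>, a choice made separately for each \<open>x\<^sub>3\<close>. By uniqueness of
  the transform it may be replaced by the jointly measurable choice \<open>G\<close>, to which Tonelli's theorem applies.\<close>

lemma norm_L2H_nn_integral: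
  assumes u: "u \<in> L2H J s \<gamma>" and J: "J \<in> sets borel" and \<gamma>: "\<gamma> \<ge> 1"
  defines "G \<equiv> partial_fourier J \<gamma> u"
  shows "G \<in> borel_measurable borel"
    and "(\<integral>\<^sup>+y. indicator J y * energy \<gamma> (2 * s) (\<lambda>\<xi>. G (y, \<xi>)) \<partial>lborel)
      = ennreal ((2 * pi)\<^sup>2 * (norm_L2H J s \<gamma> u)\<^sup>2)"
proof -
  have pf: "has_partial_fourier J \<gamma> u G" unfolding G_def by (rule L2H_partial_fourier[OF u])
  show [measurable]: "G \<in> borel_measurable borel" using pf by (simp add: has_partial_fourier_def)
  have Gae: "AE y in lborel. y \<in> J \<longrightarrow> has_fourier (exp_mult \<gamma> (u y)) (\<lambda>\<xi>. G (y, \<xi>))"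
    using pf by (simp add: has_partial_fourier_def)
  have H: "AE y in lborel. y \<in> J \<longrightarrow> u y \<in> H s \<gamma>" using u by (simp add: L2H_def)
  have si: "set_integrable lebesgue J (\<lambda>y. (norm_H s \<gamma> (u y))\<^sup>2)" using u by (simp add: L2H_def)
  have nn: "0 \<le> (LINT y:J|lebesgue. (norm_H s \<gamma> (u y))\<^sup>2)"
    unfolding set_lebesgue_integral_def by (intro integral_nonneg_AE AE_I2) simp
  have "ennreal ((norm_L2H J s \<gamma> u)\<^sup>2) = ennreal (LINT y:J|lebesgue. (norm_H s \<gamma> (u y))\<^sup>2)"
    unfolding norm_L2H_def using nn by simp
  also have "\<dots> = (\<integral>\<^sup>+y. ennreal (indicator J y *\<^sub>R (norm_H s \<gamma> (u y))\<^sup>2) \<partial>lebesgue)"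
    unfolding set_lebesgue_integral_def
    by (rule nn_integral_eq_integral[symmetric]) (use si in \<open>simp_all add: set_integrable_def\<close>)
  also have "\<dots> = (\<integral>\<^sup>+y. ennreal (indicator J y *\<^sub>R (norm_H s \<gamma> (u y))\<^sup>2) \<partial>lborel)"
    by (rule nn_integral_completion)
  also have "\<dots> = (\<integral>\<^sup>+y. ennreal (1 / (2 * pi)\<^sup>2) * (indicator J y * energy \<gamma> (2 * s) (\<lambda>\<xi>. G (y, \<xi>))) \<partial>lborel)"
  proof (rule nn_integral_cong_AE)
    show "AE y in lborel. ennreal (indicator J y *\<^sub>R (norm_H s \<gamma> (u y))\<^sup>2)
       = ennreal (1 / (2 * pi)\<^sup>2) * (indicator J y * energy \<gamma> (2 * s) (\<lambda>\<xi>. G (y, \<xi>)))"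
      using Gae H
    proof eventually_elim
      case (elim y)
      show ?case
      proof (cases "y \<in> J")
        case True
        then have hf: "has_fourier (exp_mult \<gamma> (u y)) (\<lambda>\<xi>. G (y, \<xi>))" and so: "exp_mult \<gamma> (u y) \<in> sobolev s"
          using elim by (simp_all add: H_def)
        have "ennreal ((norm_H s \<gamma> (u y))\<^sup>2) = ennreal (1 / (2 * pi)\<^sup>2)
            * energy \<gamma> (2 * s) (fourier (exp_mult \<gamma> (u y)))"
          unfolding norm_H_def by (rule norm_s_nn_integral[OF so \<gamma>])
        also have "energy \<gamma> (2 * s) (fourier (exp_mult \<gamma> (u y)))
            = energy \<gamma> (2 * s) (\<lambda>\<xi>. G (y, \<xi>))"
          by (rule nn_integral_cong_AE) (use fourier_AE_eq[OF hf] in eventually_elim, simp)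
        finally show ?thesis using True by simp
      qed simp
    qed
  qed
  also have "\<dots> = ennreal (1 / (2 * pi)\<^sup>2) * (\<integral>\<^sup>+y. indicator J y * energy \<gamma> (2 * s) (\<lambda>\<xi>. G (y, \<xi>)) \<partial>lborel)"
  proof (rule nn_integral_cmult)
    have [measurable]: "(\<lambda>z :: real \<times> real \<times> real. Lam \<gamma> (snd z)) \<in> borel_measurable borel"
      unfolding Lambda_def cmod_power2 complex.sel
      by (intro borel_measurable_continuous_onI continuous_intros)
    have "(\<lambda>z. ennreal (Lam \<gamma> (snd z) powr (2 * s) * (cmod (G z))\<^sup>2)) \<in> borel_measurable (lborel \<Otimes>\<^sub>M lborel)"
      unfolding lborel_prod by measurable
    from lborel.borel_measurable_nn_integral_fst[OF this]
    have [measurable]: "(\<lambda>y. \<integral>\<^sup>+\<xi>. ennreal (Lam \<gamma> \<xi> powr (2 * s) * (cmod (G (y, \<xi>)))\<^sup>2) \<partial>lborel) \<in> borel_measurable lborel"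
      by simp
    show "(\<lambda>y. indicator J y * energy \<gamma> (2 * s) (\<lambda>\<xi>. G (y, \<xi>))) \<in> borel_measurable lborel"
      using J by measurable
  qed
  finally have eq: "ennreal ((norm_L2H J s \<gamma> u)\<^sup>2) = ennreal (1 / (2 * pi)\<^sup>2) * (\<integral>\<^sup>+y. indicator J y * energy \<gamma> (2 * s) (\<lambda>\<xi>. G (y, \<xi>)) \<partial>lborel)" (is "_ = _ * ?I") .
  have "ennreal ((2 * pi)\<^sup>2 * (norm_L2H J s \<gamma> u)\<^sup>2) = ennreal ((2 * pi)\<^sup>2) * ennreal ((norm_L2H J s \<gamma> u)\<^sup>2)"
    by (rule ennreal_mult) auto
  also have "\<dots> = (ennreal ((2 * pi)\<^sup>2) * ennreal (1 / (2 * pi)\<^sup>2)) * ?I"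
    unfolding eq by (simp only: mult.assoc)
  also have "ennreal ((2 * pi)\<^sup>2) * ennreal (1 / (2 * pi)\<^sup>2) = 1"
    by (subst ennreal_mult[symmetric]) auto
  finally show "?I = ennreal ((2 * pi)\<^sup>2 * (norm_L2H J s \<gamma> u)\<^sup>2)" by simp
qed

section \<open>The front symbol and the Laplace integrals\<close>

lemma mu_root_pair:
  assumes CB: "CB > 0" and \<tau>: "Re \<tau> > 0"
  shows "root_pair (v / CB) (\<tau> / of_real CB) \<eta> (mu CB v \<tau> \<eta>) (mu CB (- v) \<tau> \<eta>)"
proof -
  have p: "(mu CB v \<tau> \<eta>)\<^sup>2 = (\<tau> + \<i> * v * \<eta>)\<^sup>2 / CB\<^sup>2 + \<eta>\<^sup>2 \<and> Re (mu CB v \<tau> \<eta>) > 0"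
    and m: "(mu CB (- v) \<tau> \<eta>)\<^sup>2 = (\<tau> + \<i> * (- v) * \<eta>)\<^sup>2 / CB\<^sup>2 + \<eta>\<^sup>2 \<and> Re (mu CB (- v) \<tau> \<eta>) > 0"
    using mu_unique[OF assms] by blast+
  have q: "(\<tau> + \<i> * of_real w * of_real \<eta>)\<^sup>2 / of_real (CB\<^sup>2) = (\<tau> / of_real CB + \<i> * of_real (w / CB * \<eta>))\<^sup>2" for w
  proof -
    have "\<tau> / of_real CB + \<i> * of_real (w / CB * \<eta>) = (\<tau> + \<i> * of_real w * of_real \<eta>) / of_real CB"
      using CB by (simp add: add_divide_distrib)
    then show ?thesis by (simp add: power_divide)
  qed
  have "Re (\<tau> / of_real CB) > 0" using assms by simp
  then show ?thesis
    unfolding root_pair_def using p m q[of v] q[of "- v"] by simp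
qed

text \<open>With \<open>S\<close> and \<open>D\<close> the sum and the difference of the roots, \<open>S D = 4\<i>X w\<close> for \<open>w = M\<eta>\<close>, so the quotient term is \<open>D\<^sup>2 / 2\<close> up to
  the factor \<open>C\<^sub>B\<^sup>2\<close>, and \<open>D\<^sup>2\<close> is again a polynomial up to the product of the roots.\<close>

lemma front_symbol_eq:
  fixes CB v \<eta> :: real and \<tau> :: complex
  assumes CB: "CB > 0" and \<tau>: "Re \<tau> > 0"
  defines "\<mu>p \<equiv> mu CB v \<tau> \<eta>" and "\<mu>m \<equiv> mu CB (- v) \<tau> \<eta>"
  shows "\<tau>\<^sup>2 - v\<^sup>2 * \<eta>\<^sup>2 - 2 * \<i> * \<tau> * \<eta> * v * ((\<mu>p - \<mu>m) / (\<mu>p + \<mu>m))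
    = of_real (CB\<^sup>2) * (\<mu>p * \<mu>m - of_real (\<eta>\<^sup>2))"
proof -
  have rp: "root_pair (v / CB) (\<tau> / of_real CB) \<eta> \<mu>p \<mu>m"
    unfolding \<mu>p_def \<mu>m_def by (rule mu_root_pair[OF CB \<tau>])
  define X w e where "X = \<tau> / of_real CB" and "w = complex_of_real (v / CB * \<eta>)" and "e = complex_of_real \<eta>"
  have C0: "complex_of_real CB \<noteq> 0" using CB by simp
  have \<tau>X: "\<tau> = of_real CB * X" and vw: "complex_of_real v * e = of_real CB * w"
    using CB by (simp_all add: X_def w_def e_def)
  have p: "\<mu>p\<^sup>2 = X\<^sup>2 + 2 * \<i> * X * w - w\<^sup>2 + e\<^sup>2" and m: "\<mu>m\<^sup>2 = X\<^sup>2 - 2 * \<i> * X * w - w\<^sup>2 + e\<^sup>2"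
  proof -
    have "\<mu>p\<^sup>2 = (X + \<i> * w)\<^sup>2 + e\<^sup>2 \<and> \<mu>m\<^sup>2 = (X - \<i> * w)\<^sup>2 + e\<^sup>2"
      using rp unfolding root_pair_def X_def w_def e_def by (elim conjE) (rule conjI)
    then show "\<mu>p\<^sup>2 = X\<^sup>2 + 2 * \<i> * X * w - w\<^sup>2 + e\<^sup>2" "\<mu>m\<^sup>2 = X\<^sup>2 - 2 * \<i> * X * w - w\<^sup>2 + e\<^sup>2"
      by (simp_all add: power2_sum power2_diff power_mult_distrib)
  qed
  define S D where "S = \<mu>p + \<mu>m" and "D = \<mu>p - \<mu>m"
  have "Re S > 0" using rp by (simp add: root_pair_def S_def)
  then have S: "S \<noteq> 0" by auto
  have SD: "S * D = 4 * (\<i> * X * w)"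
  proof -
    have "S * D = \<mu>p\<^sup>2 - \<mu>m\<^sup>2" by (simp add: S_def D_def power2_eq_square algebra_simps)
    then show ?thesis by (simp add: p m)
  qed
  have DD: "D\<^sup>2 = 2 * (X\<^sup>2 - w\<^sup>2 + e\<^sup>2) - 2 * (\<mu>p * \<mu>m)"
    unfolding D_def power2_diff p m by simp
  have cross0: "2 * (\<i> * X * w) * (D / S) = D\<^sup>2 / 2"
  proof -
    have "4 * (\<i> * X * w) * (D / S) = D\<^sup>2"
      unfolding SD[symmetric] using S by (simp add: power2_eq_square)
    moreover have "2 * (\<i> * X * w) * (D / S) = (4 * (\<i> * X * w) * (D / S)) / 2" by simp
    ultimately show ?thesis by (simp only:)
  qed
  have "D\<^sup>2 / 2 = X\<^sup>2 - w\<^sup>2 + e\<^sup>2 - \<mu>p * \<mu>m"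
    unfolding DD by (simp add: diff_divide_distrib)
  with cross0 have cross: "2 * (\<i> * X * w) * (D / S) = X\<^sup>2 - w\<^sup>2 + e\<^sup>2 - \<mu>p * \<mu>m"
    by (rule trans)
  have "2 * \<i> * \<tau> * e * of_real v * (D / S) = (of_real CB)\<^sup>2 * (2 * (\<i> * X * w) * (D / S))"
  proof -
    have "2 * \<i> * \<tau> * e * of_real v = 2 * \<i> * (of_real CB * X) * (of_real v * e)"
      unfolding \<tau>X by (simp only: mult_ac)
    also have "\<dots> = (of_real CB)\<^sup>2 * (2 * (\<i> * X * w))"
      unfolding vw by (simp only: power2_eq_square mult_ac)
    finally show ?thesis by (simp only: mult.assoc)
  qed
  moreover have "complex_of_real (v\<^sup>2 * \<eta>\<^sup>2) = (of_real CB)\<^sup>2 * w\<^sup>2"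
  proof -
    have "complex_of_real (v\<^sup>2 * \<eta>\<^sup>2) = (of_real v * e)\<^sup>2" by (simp add: e_def power_mult_distrib)
    then show ?thesis unfolding vw by (simp add: power_mult_distrib)
  qed
  moreover have "\<tau>\<^sup>2 = (of_real CB)\<^sup>2 * X\<^sup>2" unfolding \<tau>X by (simp add: power_mult_distrib)
  moreover have "of_real (CB\<^sup>2) * (\<mu>p * \<mu>m - of_real (\<eta>\<^sup>2))
      = (of_real CB)\<^sup>2 * X\<^sup>2 - (of_real CB)\<^sup>2 * w\<^sup>2 - (of_real CB)\<^sup>2 * (X\<^sup>2 - w\<^sup>2 + e\<^sup>2 - \<mu>p * \<mu>m)"
    by (simp add: e_def algebra_simps)
  ultimately show ?thesis
    unfolding cross unfolding e_def S_def D_def by simp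
qed

lemma front_symbol_lower:
  assumes CB: "CB > 0" and M: "v / CB > sqrt 2"
  shows "\<exists>c>0. \<forall>\<tau> \<eta>. Re \<tau> > 0 \<longrightarrow>
    (let \<mu>p = mu CB v \<tau> \<eta>; \<mu>m = mu CB (- v) \<tau> \<eta>;
         \<Sigma> = of_real (CB\<^sup>2) * (\<mu>p * \<mu>m - of_real (\<eta>\<^sup>2)) in
      c * Re \<tau> * Lambda \<tau> \<eta> * cmod \<mu>p \<le> cmod \<Sigma> * cmod (\<mu>p + \<mu>m) \<and>
      c * Re \<tau> * Lambda \<tau> \<eta> * cmod \<mu>m \<le> cmod \<Sigma> * cmod (\<mu>p + \<mu>m))"
proof -
  obtain c where c: "c > 0" and est: "\<And>X \<eta> mp mm. root_pair (v / CB) X \<eta> mp mm \<Longrightarrow>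
    c * Re X * Lambda X \<eta> * cmod mp \<le> cmod (mp * mm - of_real (\<eta>\<^sup>2)) * cmod (mp + mm) \<and>
    c * Re X * Lambda X \<eta> * cmod mm \<le> cmod (mp * mm - of_real (\<eta>\<^sup>2)) * cmod (mp + mm)"
    using symbol_estimate[OF M] by blast
  \<comment> \<open>rescaling \<open>\<tau>\<close> by \<open>1 / C\<^sub>B\<close> shrinks \<open>\<Lambda>\<close> by no more than this factor\<close>
  define k where "k = min 1 (1 / CB)"
  have k: "k > 0" "k \<le> 1" "k \<le> 1 / CB" using CB by (simp_all add: k_def)
  define c' where "c' = CB\<^sup>2 * (c * (1 / CB) * k)"
  have c': "c' > 0" using c k CB by (simp add: c'_def)
  have "c' * Re \<tau> * Lambda \<tau> \<eta> * cmod m \<le> cmod (of_real (CB\<^sup>2) * (\<mu>p * \<mu>m - of_real (\<eta>\<^sup>2))) * cmod (\<mu>p + \<mu>m)"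
    if \<tau>: "Re \<tau> > 0" and \<mu>: "\<mu>p = mu CB v \<tau> \<eta>" "\<mu>m = mu CB (- v) \<tau> \<eta>" and m: "m = \<mu>p \<or> m = \<mu>m" for \<tau> \<eta> \<mu>p \<mu>m m
  proof -
    let ?X = "\<tau> / of_real CB"
    have rp: "root_pair (v / CB) ?X \<eta> \<mu>p \<mu>m" unfolding \<mu> by (rule mu_root_pair[OF CB \<tau>])
    have L: "k * Lambda \<tau> \<eta> \<le> Lambda ?X \<eta>"
      unfolding Lambda_def[of ?X]
    proof (rule real_le_rsqrt)
      have "k * cmod \<tau> \<le> 1 / CB * cmod \<tau>" using k by (intro mult_right_mono) auto
      then have "(k * cmod \<tau>)\<^sup>2 \<le> (cmod ?X)\<^sup>2"
        using k CB by (intro power_mono) (auto simp: norm_divide)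
      moreover have "k\<^sup>2 * \<eta>\<^sup>2 \<le> 1 * \<eta>\<^sup>2"
        using k power_mono[of k 1 2] by (intro mult_right_mono) auto
      ultimately show "(k * Lambda \<tau> \<eta>)\<^sup>2 \<le> (cmod ?X)\<^sup>2 + \<eta>\<^sup>2"
        by (simp add: Lambda_def power_mult_distrib distrib_left)
    qed
    have "c * (Re \<tau> / CB) * (k * Lambda \<tau> \<eta>) * cmod m \<le> c * (Re \<tau> / CB) * Lambda ?X \<eta> * cmod m"
      using L c CB \<tau> by (intro mult_right_mono mult_left_mono) auto
    also have "\<dots> \<le> cmod (\<mu>p * \<mu>m - of_real (\<eta>\<^sup>2)) * cmod (\<mu>p + \<mu>m)"
      using est[OF rp] m by auto
    finally have "CB\<^sup>2 * (c * (Re \<tau> / CB) * (k * Lambda \<tau> \<eta>) * cmod m)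
        \<le> CB\<^sup>2 * (cmod (\<mu>p * \<mu>m - of_real (\<eta>\<^sup>2)) * cmod (\<mu>p + \<mu>m))"
      by (rule mult_left_mono) simp
    then show ?thesis
      by (simp add: c'_def norm_mult norm_power mult_ac)
  qed
  with c' show ?thesis unfolding Let_def by blast
qed

text \<open>The square of the decaying exponential has integral \<open>1 / (2 Re m)\<close>. If the integrand on the left is not integrable, its integral is \<open>0\<close> by
  convention and the bound is trivial.\<close>

lemma laplace_Cauchy_Schwarz:
  fixes G :: "real \<Rightarrow> complex"
  assumes [measurable]: "G \<in> borel_measurable borel" and m: "Re m > 0"
  shows "ennreal ((cmod (LINT y:{0<..}|lborel. exp (- m * of_real y) * G y))\<^sup>2)
    \<le> ennreal (1 / (2 * Re m)) * (\<integral>\<^sup>+y. indicator {0<..} y * ennreal ((cmod (G y))\<^sup>2) \<partial>lborel)"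
proof (cases "set_integrable lborel {0<..} (\<lambda>y. exp (- m * of_real y) * G y)")
  case False
  then have "(LINT y:{0<..}|lborel. exp (- m * of_real y) * G y) = 0"
    unfolding set_integrable_def set_lebesgue_integral_def by (rule not_integrable_integral_eq)
  then show ?thesis by simp
next
  case True
  let ?e = "\<lambda>y. indicator {0<..} y * ennreal (exp (- Re m * y))" and ?g = "\<lambda>y. indicator {0<..} y * ennreal (cmod (G y))"
  have "ennreal (cmod (LINT y:{0<..}|lborel. exp (- m * of_real y) * G y))
      \<le> (\<integral>\<^sup>+y. ennreal (norm (indicator {0<..} y *\<^sub>R (exp (- m * of_real y) * G y))) \<partial>lborel)"
    using integral_norm_bound_ennreal[OF True[unfolded set_integrable_def]]
    unfolding set_lebesgue_integral_def .
  also have "\<dots> = (\<integral>\<^sup>+y. ?e y * ?g y \<partial>lborel)"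
    by (intro nn_integral_cong) (auto simp: indicator_def norm_mult ennreal_mult)
  finally have "ennreal (cmod (LINT y:{0<..}|lborel. exp (- m * of_real y) * G y)) ^ 2
      \<le> (\<integral>\<^sup>+y. ?e y * ?g y \<partial>lborel) ^ 2"
    by (rule power_mono) simp
  also have "\<dots> \<le> (\<integral>\<^sup>+y. (?e y)\<^sup>2 \<partial>lborel) * (\<integral>\<^sup>+y. (?g y)\<^sup>2 \<partial>lborel)"
    by (rule Cauchy_Schwarz_nn_integral) measurable
  also have "(\<integral>\<^sup>+y. (?g y)\<^sup>2 \<partial>lborel) = (\<integral>\<^sup>+y. indicator {0<..} y * ennreal ((cmod (G y))\<^sup>2) \<partial>lborel)"
    by (intro nn_integral_cong) (auto simp: indicator_def ennreal_power)
  also have "(\<integral>\<^sup>+y. (?e y)\<^sup>2 \<partial>lborel) \<le> (\<integral>\<^sup>+y. ennreal (exp (- (2 * Re m) * y)) * indicator {0..} y \<partial>lborel)"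
    by (intro nn_integral_mono) (auto simp: indicator_def ennreal_power exp_of_nat_mult[symmetric] algebra_simps simp flip: exp_double)
  also have "\<dots> = ennreal (0 - (- exp (- (2 * Re m) * 0) / (2 * Re m)))"
  proof (rule nn_integral_FTC_atLeast)
    show "((\<lambda>y. - exp (- (2 * Re m) * y) / (2 * Re m)) has_real_derivative exp (- (2 * Re m) * y)) (at y)" for y
      using m by (auto intro!: derivative_eq_intros)
    have "((\<lambda>y. exp (- (2 * Re m) * y)) \<longlongrightarrow> 0) at_top"
      using m by (intro filterlim_compose[OF exp_at_bot] filterlim_tendsto_neg_mult_at_bot[OF tendsto_const _ filterlim_ident]) auto
    from tendsto_divide[OF tendsto_minus[OF this] tendsto_const, of "2 * Re m"]
    show "((\<lambda>y. - exp (- (2 * Re m) * y) / (2 * Re m)) \<longlongrightarrow> 0) at_top" using m by simp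
  qed auto
  also have "0 - (- exp (- (2 * Re m) * 0) / (2 * Re m)) = 1 / (2 * Re m)" by simp
  finally show ?thesis by (simp add: ennreal_power mult_right_mono)
qed

section \<open>The solution of the front equation\<close>

text \<open>The transform of \<open>f\<close> that the front equation prescribes, with the coefficient in the reduced form of \<open>front_symbol_eq\<close>.\<close>

definition front_solution ::
  "real \<Rightarrow> real \<Rightarrow> real \<Rightarrow> (real \<Rightarrow> (real \<times> real \<Rightarrow> complex) \<Rightarrow> complex) \<Rightarrow>
   (real \<Rightarrow> (real \<times> real \<Rightarrow> complex) \<Rightarrow> complex) \<Rightarrow> real \<times> real \<Rightarrow> complex"
  where "front_solution CB v \<gamma> Kp Km \<xi> =
    (let \<mu>p = mu CB v (Complex \<gamma> (fst \<xi>)) (snd \<xi>); \<mu>m = mu CB (- v) (Complex \<gamma> (fst \<xi>)) (snd \<xi>) in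
      - (\<mu>p * \<mu>m / (\<mu>p + \<mu>m) * W CB v (- v) \<gamma> Kp Km (fst \<xi>) (snd \<xi>))
        / (of_real (CB\<^sup>2) * (\<mu>p * \<mu>m - of_real ((snd \<xi>)\<^sup>2))))"

lemma mu_Re_pos:
  assumes "CB > 0" "Re \<tau> > 0"
  shows "Re (mu CB v \<tau> \<eta>) > 0"
  using mu_unique[OF assms] by blast

lemma mu_Re_ge:
  assumes CB: "CB > 0" and \<tau>: "Re \<tau> > 0"
  shows "Re \<tau> / CB \<le> Re (mu CB v \<tau> \<eta>)"
proof -
  have rp: "root_pair (v / CB) (\<tau> / of_real CB) \<eta> (mu CB v \<tau> \<eta>) (mu CB (- v) \<tau> \<eta>)"
    by (rule mu_root_pair[OF CB \<tau>])
  have "Re (\<tau> / of_real CB) \<le> Re (mu CB v \<tau> \<eta>)"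
  proof (rule Re_root_ge_Re)
    show "(mu CB v \<tau> \<eta>)\<^sup>2 = (\<tau> / of_real CB + \<i> * of_real (v / CB * \<eta>))\<^sup>2 + (of_real \<eta>)\<^sup>2"
      "Re (mu CB v \<tau> \<eta>) > 0" "Re (\<tau> / of_real CB) > 0"
      using rp unfolding root_pair_def by blast+
  qed
  then show ?thesis by simp
qed

text \<open>The argument of the root never meets the cut along the negative real axis, since it is the square of a number with positive real part.\<close>

lemma mu_measurable:
  assumes CB: "CB > 0" and \<gamma>: "\<gamma> > 0"
  shows "(\<lambda>\<xi>. mu CB v (Complex \<gamma> (fst \<xi>)) (snd \<xi>)) \<in> borel_measurable borel"
proof (rule borel_measurable_continuous_onI)
  let ?w = "\<lambda>\<xi>. (Complex \<gamma> (fst \<xi>) + \<i> * of_real v * of_real (snd \<xi>))\<^sup>2 / of_real (CB\<^sup>2) + of_real ((snd \<xi>)\<^sup>2)"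
  have "continuous_on UNIV (\<lambda>\<xi>. csqrt (?w \<xi>))"
  proof (rule continuous_on_compose2[OF continuous_on_csqrt])
    show "continuous_on UNIV ?w"
      using CB by (intro continuous_intros) auto
    have "?w \<xi> \<notin> \<real>\<^sub>\<le>\<^sub>0" for \<xi>
    proof
      assume neg: "?w \<xi> \<in> \<real>\<^sub>\<le>\<^sub>0"
      define m where "m = mu CB v (Complex \<gamma> (fst \<xi>)) (snd \<xi>)"
      have m: "m\<^sup>2 = ?w \<xi>" "Re m > 0"
        using mu_unique[of CB "Complex \<gamma> (fst \<xi>)" m v "snd \<xi>"] CB \<gamma> by (simp_all add: m_def)
      have "Im (m\<^sup>2) = 0" "Re (m\<^sup>2) \<le> 0"
        using neg unfolding m(1)[symmetric] complex_nonpos_Reals_iff by auto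
      then show False using m(2) by (auto simp: Im_power2 Re_power2 mult_le_0_iff)
    qed
    then show "?w ` UNIV \<subseteq> - \<real>\<^sub>\<le>\<^sub>0" by blast
  qed
  then show "continuous_on UNIV (\<lambda>\<xi>. mu CB v (Complex \<gamma> (fst \<xi>)) (snd \<xi>))"
    by (simp add: mu_def)
qed

lemma laplace_measurable:
  fixes G :: "real \<times> real \<times> real \<Rightarrow> complex" and m :: "real \<times> real \<Rightarrow> complex"
  assumes G: "G \<in> borel_measurable borel" and m[measurable]: "m \<in> borel_measurable borel"
    and k: "continuous_on UNIV k"
  shows "(\<lambda>\<xi>. LINT y:{0<..}|lborel. exp (- m \<xi> * of_real y) * G (k y, fst \<xi>, snd \<xi>)) \<in> borel_measurable borel"
proof -
  have "continuous_on UNIV (exp :: complex \<Rightarrow> complex)" by (intro continuous_intros)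
  then have [measurable]: "(exp :: complex \<Rightarrow> complex) \<in> borel_measurable borel"
    by (rule borel_measurable_continuous_onI)
  have "continuous_on UNIV (\<lambda>z :: (real \<times> real) \<times> real. (k (snd z), fst z))"
    by (intro continuous_intros continuous_on_compose2[OF k]) auto
  then have "(\<lambda>z :: (real \<times> real) \<times> real. (k (snd z), fst z)) \<in> borel_measurable borel"
    by (rule borel_measurable_continuous_onI)
  from measurable_compose[OF this G]
  have [measurable]: "(\<lambda>z :: (real \<times> real) \<times> real. G (k (snd z), fst z)) \<in> borel_measurable (lborel \<Otimes>\<^sub>M lborel)"
    by (simp add: lborel_prod)
  have "(\<lambda>z. indicator {0<..} (snd z) *\<^sub>R (exp (- m (fst z) * of_real (snd z)) * G (k (snd z), fst z)))
      \<in> borel_measurable (lborel \<Otimes>\<^sub>M lborel)"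
    by measurable
  then have "(\<lambda>(\<xi>, y). indicator {0<..} y *\<^sub>R (exp (- m \<xi> * of_real y) * G (k y, \<xi>)))
      \<in> borel_measurable (lborel \<Otimes>\<^sub>M lborel)"
    by (simp only: case_prod_beta')
  from lborel.borel_measurable_lebesgue_integral[OF this]
  show ?thesis unfolding set_lebesgue_integral_def by simp
qed

lemma front_solution_measurable:
  assumes CB: "CB > 0" and \<gamma>: "\<gamma> > 0"
    and Gp: "partial_fourier {0<..} \<gamma> Kp \<in> borel_measurable borel"
    and Gm: "partial_fourier {..<0} \<gamma> Km \<in> borel_measurable borel"
  shows "front_solution CB v \<gamma> Kp Km \<in> borel_measurable borel"
proof -
  note [measurable] = mu_measurable[OF CB \<gamma>, of v] mu_measurable[OF CB \<gamma>, of "- v"]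
  have [measurable]: "(\<lambda>\<xi>. LINT y:{0<..}|lborel. exp (- mu CB v (Complex \<gamma> (fst \<xi>)) (snd \<xi>) * of_real y)
      * partial_fourier {0<..} \<gamma> Kp (y, fst \<xi>, snd \<xi>)) \<in> borel_measurable borel"
    by (rule laplace_measurable[OF Gp mu_measurable[OF CB \<gamma>] continuous_on_id])
  have [measurable]: "(\<lambda>\<xi>. LINT y:{0<..}|lborel. exp (- mu CB (- v) (Complex \<gamma> (fst \<xi>)) (snd \<xi>) * of_real y)
      * partial_fourier {..<0} \<gamma> Km (- y, fst \<xi>, snd \<xi>)) \<in> borel_measurable borel"
    by (rule laplace_measurable[OF Gm mu_measurable[OF CB \<gamma>]]) (intro continuous_intros)
  have [measurable]: "(\<lambda>\<xi>::real \<times> real. complex_of_real ((snd \<xi>)\<^sup>2)) \<in> borel_measurable borel"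
    by (intro borel_measurable_continuous_onI continuous_intros)
  show ?thesis
    unfolding front_solution_def[abs_def] W_def Let_def by measurable
qed

lemma front_symbol_nonzero:
  assumes CB: "CB > 0" and M: "v / CB > sqrt 2" and \<tau>: "Re \<tau> > 0"
  shows "of_real (CB\<^sup>2) * (mu CB v \<tau> \<eta> * mu CB (- v) \<tau> \<eta> - of_real (\<eta>\<^sup>2)) \<noteq> (0 :: complex)"
proof
  assume 0: "of_real (CB\<^sup>2) * (mu CB v \<tau> \<eta> * mu CB (- v) \<tau> \<eta> - of_real (\<eta>\<^sup>2)) = (0 :: complex)"
  obtain c where c: "c > 0" and est: "c * Re \<tau> * Lambda \<tau> \<eta> * cmod (mu CB v \<tau> \<eta>) \<le> 0"
    using front_symbol_lower[OF CB M] \<tau> unfolding Let_def by (metis 0 norm_zero mult_zero_left)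
  have "Lambda \<tau> \<eta> > 0"
    using \<tau> unfolding Lambda_def by (intro real_sqrt_gt_zero add_pos_nonneg) auto
  moreover have "mu CB v \<tau> \<eta> \<noteq> 0" using mu_Re_pos[OF CB \<tau>, of v \<eta>] by auto
  ultimately have "0 < c * Re \<tau> * Lambda \<tau> \<eta> * cmod (mu CB v \<tau> \<eta>)"
    using c \<tau> by simp
  with est show False by simp
qed

lemma solves_front_iff:
  assumes CB: "CB > 0" and M: "v / CB > sqrt 2" and \<gamma>: "\<gamma> > 0"
  shows "solves_front CB v (- v) \<gamma> Kp Km f \<longleftrightarrow>
    (AE \<xi> in lborel. fourier (exp_mult \<gamma> f) \<xi> = front_solution CB v \<gamma> Kp Km \<xi>)"
proof -
  have pt: "\<Sigma> * F + A = 0 \<longleftrightarrow> F = - A / \<Sigma>" if "\<Sigma> \<noteq> 0" for \<Sigma> F A :: complex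
    using that by (auto simp: field_simps eq_neg_iff_add_eq_0)
  have \<tau>: "Re (Complex \<gamma> \<delta>) > 0" for \<delta> using \<gamma> by simp
  show ?thesis
    unfolding solves_front_def front_solution_def Let_def case_prod_beta front_symbol_eq[OF CB \<tau>]
    unfolding pt[OF front_symbol_nonzero[OF CB M \<tau>]]
    by simp
qed

lemma nn_integral_reflect:
  fixes h :: "real \<Rightarrow> complex"
  assumes [measurable]: "h \<in> borel_measurable borel"
  shows "(\<integral>\<^sup>+y. indicator {..<0} y * ennreal ((cmod (h y))\<^sup>2) \<partial>lborel)
    = (\<integral>\<^sup>+y. indicator {0<..} y * ennreal ((cmod (h (- y)))\<^sup>2) \<partial>lborel)"
proof -
  have "(\<lambda>y. indicator {..<0 :: real} y * ennreal ((cmod (h y))\<^sup>2)) \<in> borel_measurable borel"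
    by (intro borel_measurable_times_ennreal borel_measurable_indicator) (simp, measurable)
  from nn_integral_real_affine[OF this, of "- 1" 0] show ?thesis
    by (simp add: indicator_def)
qed

text \<open>After cancelling, the solution is \<open>- (\<mu>m A - \<mu>p B) / (S (\<mu>p + \<mu>m))\<close> with \<open>S\<close> the symbol and \<open>A\<close>, \<open>B\<close> the two Laplace
  integrals. The symbol estimate turns this into \<open>\<gamma> \<Lambda> |f| \<le> (|A| + |B|) / c\<close>, and each of \<open>|A|\<^sup>2\<close>, \<open>|B|\<^sup>2\<close> gains another factor \<open>1 / \<gamma>\<close>.\<close>

lemma front_solution_bound:
  assumes CB: "CB > 0" and M: "v / CB > sqrt 2"
  shows "\<exists>C>0. \<forall>\<gamma>>0. \<forall>Kp Km \<xi>.
    partial_fourier {0<..} \<gamma> Kp \<in> borel_measurable borel \<longrightarrow> partial_fourier {..<0} \<gamma> Km \<in> borel_measurable borel \<longrightarrow>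
    ennreal (\<gamma> ^ 3 * (Lam \<gamma> \<xi>)\<^sup>2 * (cmod (front_solution CB v \<gamma> Kp Km \<xi>))\<^sup>2) \<le>
      ennreal C * (line_energy {0<..} (partial_fourier {0<..} \<gamma> Kp) \<xi>
        + line_energy {..<0} (partial_fourier {..<0} \<gamma> Km) \<xi>)"
proof -
  obtain c where c: "c > 0" and est: "\<And>\<tau> \<eta>. Re \<tau> > 0 \<Longrightarrow>
    (let \<mu>p = mu CB v \<tau> \<eta>; \<mu>m = mu CB (- v) \<tau> \<eta>;
         \<Sigma> = of_real (CB\<^sup>2) * (\<mu>p * \<mu>m - of_real (\<eta>\<^sup>2)) in
      c * Re \<tau> * Lambda \<tau> \<eta> * cmod \<mu>p \<le> cmod \<Sigma> * cmod (\<mu>p + \<mu>m) \<and>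
      c * Re \<tau> * Lambda \<tau> \<eta> * cmod \<mu>m \<le> cmod \<Sigma> * cmod (\<mu>p + \<mu>m))"
    using front_symbol_lower[OF CB M] by blast
  have "ennreal (\<gamma> ^ 3 * (Lam \<gamma> \<xi>)\<^sup>2 * (cmod (front_solution CB v \<gamma> Kp Km \<xi>))\<^sup>2) \<le>
      ennreal (CB / c\<^sup>2) * (line_energy {0<..} (partial_fourier {0<..} \<gamma> Kp) \<xi>
        + line_energy {..<0} (partial_fourier {..<0} \<gamma> Km) \<xi>)"
    if \<gamma>: "\<gamma> > 0" and Gp: "partial_fourier {0<..} \<gamma> Kp \<in> borel_measurable borel"
      and Gm: "partial_fourier {..<0} \<gamma> Km \<in> borel_measurable borel" for \<gamma> Kp Km \<xi>
  proof -
    define \<tau> \<eta> where "\<tau> = Complex \<gamma> (fst \<xi>)" and "\<eta> = snd \<xi>"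
    define \<mu>p \<mu>m where "\<mu>p = mu CB v \<tau> \<eta>" and "\<mu>m = mu CB (- v) \<tau> \<eta>"
    define S where "S = of_real (CB\<^sup>2) * (\<mu>p * \<mu>m - of_real (\<eta>\<^sup>2))"
    define gp gm where "gp y = partial_fourier {0<..} \<gamma> Kp (y, \<xi>)" and "gm y = partial_fourier {..<0} \<gamma> Km (- y, \<xi>)" for y
    define A B where "A = (LINT y:{0<..}|lborel. exp (- \<mu>p * of_real y) * gp y)"
      and "B = (LINT y:{0<..}|lborel. exp (- \<mu>m * of_real y) * gm y)"
    define P N where "P = (\<integral>\<^sup>+y. indicator {0<..} y * ennreal ((cmod (gp y))\<^sup>2) \<partial>lborel)"
      and "N = (\<integral>\<^sup>+y. indicator {0<..} y * ennreal ((cmod (gm y))\<^sup>2) \<partial>lborel)"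
    have \<tau>: "Re \<tau> > 0" "Re \<tau> = \<gamma>" using \<gamma> by (simp_all add: \<tau>_def)
    have pos: "Re \<mu>p > 0" "Re \<mu>m > 0" unfolding \<mu>p_def \<mu>m_def by (rule mu_Re_pos[OF CB \<tau>(1)])+
    then have nz: "\<mu>p \<noteq> 0" "\<mu>m \<noteq> 0" by auto
    have "Re (\<mu>p + \<mu>m) > 0" using pos by simp
    then have nzs: "\<mu>p + \<mu>m \<noteq> 0" by (metis less_irrefl zero_complex.sel(1))
    have S0: "S \<noteq> 0" unfolding S_def \<mu>p_def \<mu>m_def by (rule front_symbol_nonzero[OF CB M \<tau>(1)])
    let ?L = "Lam \<gamma> \<xi>" and ?D = "cmod S * cmod (\<mu>p + \<mu>m)" and ?F = "front_solution CB v \<gamma> Kp Km \<xi>"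
    have L: "?L > 0" by (rule Lam_pos[OF \<gamma>])
    have D: "?D > 0" using S0 nzs by simp
    have e: "c * \<gamma> * ?L * cmod \<mu>p \<le> ?D" "c * \<gamma> * ?L * cmod \<mu>m \<le> ?D"
      using est[OF \<tau>(1), of \<eta>] \<tau>(2)
      unfolding Let_def \<mu>p_def[symmetric] \<mu>m_def[symmetric] S_def[symmetric]
      by (simp_all add: \<tau>_def \<eta>_def)
    have "W CB v (- v) \<gamma> Kp Km (fst \<xi>) (snd \<xi>) = 1 / \<mu>p * A - 1 / \<mu>m * B"
      unfolding W_def Let_def A_def B_def \<mu>p_def \<mu>m_def \<tau>_def \<eta>_def gp_def gm_def prod.collapse ..
    then have F: "?F = - (\<mu>p * \<mu>m / (\<mu>p + \<mu>m) * (1 / \<mu>p * A - 1 / \<mu>m * B)) / S"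
      unfolding front_solution_def Let_def S_def \<mu>p_def \<mu>m_def \<tau>_def \<eta>_def by simp
    also have "\<dots> = - (\<mu>m * A - \<mu>p * B) / (S * (\<mu>p + \<mu>m))"
      using nz nzs S0 by (simp add: divide_simps)
    finally have F: "?F = - (\<mu>m * A - \<mu>p * B) / (S * (\<mu>p + \<mu>m))" .
    have "cmod ?F * ?D = cmod (\<mu>m * A - \<mu>p * B)"
      unfolding F norm_divide norm_minus_cancel norm_mult[of S] using S0 nzs by simp
    also have "\<dots> \<le> cmod \<mu>m * cmod A + cmod \<mu>p * cmod B"
      by (rule order_trans[OF norm_triangle_ineq4]) (simp add: norm_mult)
    finally have FD: "cmod ?F * ?D \<le> cmod \<mu>m * cmod A + cmod \<mu>p * cmod B" .
    have "(c * \<gamma> * ?L * cmod ?F) * ?D \<le> c * \<gamma> * ?L * (cmod \<mu>m * cmod A + cmod \<mu>p * cmod B)"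
      using mult_left_mono[OF FD, of "c * \<gamma> * ?L"] c \<gamma> L by (simp add: mult.assoc)
    also have "\<dots> = (c * \<gamma> * ?L * cmod \<mu>m) * cmod A + (c * \<gamma> * ?L * cmod \<mu>p) * cmod B"
      by (simp only: distrib_left mult.assoc)
    also have "\<dots> \<le> ?D * cmod A + ?D * cmod B"
      by (intro add_mono mult_right_mono e) auto
    also have "\<dots> = (cmod A + cmod B) * ?D" by (simp only: distrib_left distrib_right mult.commute)
    finally have FAB: "c * \<gamma> * ?L * cmod ?F \<le> cmod A + cmod B"
      by (rule mult_right_le_imp_le) (rule D)
    have AB2: "(cmod A + cmod B)\<^sup>2 \<le> 2 * ((cmod A)\<^sup>2 + (cmod B)\<^sup>2)"
    proof -
      have "2 * ((cmod A)\<^sup>2 + (cmod B)\<^sup>2) - (cmod A + cmod B)\<^sup>2 = (cmod A - cmod B)\<^sup>2"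
        by (simp add: power2_eq_square algebra_simps)
      moreover have "0 \<le> (cmod A - cmod B)\<^sup>2" by simp
      ultimately show ?thesis by linarith
    qed
    have "(c * \<gamma> * ?L * cmod ?F)\<^sup>2 \<le> (cmod A + cmod B)\<^sup>2"
      using FAB c \<gamma> L by (intro power_mono) auto
    then have "(c * \<gamma> * ?L * cmod ?F)\<^sup>2 \<le> 2 * ((cmod A)\<^sup>2 + (cmod B)\<^sup>2)" using AB2 by (rule order_trans)
    then have "(\<gamma> / c\<^sup>2) * (c * \<gamma> * ?L * cmod ?F)\<^sup>2 \<le> (\<gamma> / c\<^sup>2) * (2 * ((cmod A)\<^sup>2 + (cmod B)\<^sup>2))"
      using \<gamma> by (intro mult_left_mono) auto
    moreover have "(\<gamma> / c\<^sup>2) * (c * \<gamma> * ?L * cmod ?F)\<^sup>2 = \<gamma> ^ 3 * ?L\<^sup>2 * (cmod ?F)\<^sup>2"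
      using c by (simp add: power_mult_distrib power2_eq_square power3_eq_cube)
    ultimately have real_bound: "\<gamma> ^ 3 * ?L\<^sup>2 * (cmod ?F)\<^sup>2 \<le> (2 * \<gamma> / c\<^sup>2) * ((cmod A)\<^sup>2 + (cmod B)\<^sup>2)"
      by (simp add: mult_ac)
    have cont: "continuous_on UNIV (\<lambda>y :: real. (y, \<xi>))" "continuous_on UNIV (\<lambda>y :: real. (- y, \<xi>))"
      by (intro continuous_intros)+
    have gpm: "gp \<in> borel_measurable borel" and gmm: "gm \<in> borel_measurable borel"
      unfolding gp_def[abs_def] gm_def[abs_def]
      by (rule measurable_compose[OF borel_measurable_continuous_onI[OF cont(1)] Gp],
          rule measurable_compose[OF borel_measurable_continuous_onI[OF cont(2)] Gm])
    have lap: "ennreal ((cmod (LINT y:{0<..}|lborel. exp (- m * of_real y) * g y))\<^sup>2)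
        \<le> ennreal (CB / (2 * \<gamma>)) * (\<integral>\<^sup>+y. indicator {0<..} y * ennreal ((cmod (g y))\<^sup>2) \<partial>lborel)"
      if g: "g \<in> borel_measurable borel" and m: "\<gamma> / CB \<le> Re m" for m g
    proof -
      have "0 < \<gamma> / CB" using \<gamma> CB by simp
      then have m0: "Re m > 0" using m by linarith
      have "\<gamma> \<le> Re m * CB" using m CB by (simp add: pos_divide_le_eq)
      then have "1 / (2 * Re m) \<le> CB / (2 * \<gamma>)" using m0 \<gamma> CB by (simp add: field_simps)
      then show ?thesis
        by (intro order_trans[OF laplace_Cauchy_Schwarz[OF g m0]] mult_right_mono ennreal_leI) auto
    qed
    have Are: "\<gamma> / CB \<le> Re \<mu>p" "\<gamma> / CB \<le> Re \<mu>m"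
      unfolding \<mu>p_def \<mu>m_def using mu_Re_ge[OF CB \<tau>(1)] \<tau>(2) by auto
    have A: "ennreal ((cmod A)\<^sup>2) \<le> ennreal (CB / (2 * \<gamma>)) * P" and B: "ennreal ((cmod B)\<^sup>2) \<le> ennreal (CB / (2 * \<gamma>)) * N"
      unfolding A_def B_def P_def N_def by (rule lap[OF gpm Are(1)], rule lap[OF gmm Are(2)])
    have Nm: "N = line_energy {..<0} (partial_fourier {..<0} \<gamma> Km) \<xi>"
    proof -
      have "(\<lambda>y. partial_fourier {..<0} \<gamma> Km (y, \<xi>)) \<in> borel_measurable borel"
        by (rule measurable_compose[OF borel_measurable_continuous_onI[OF cont(1)] Gm])
      from nn_integral_reflect[OF this] show ?thesis unfolding N_def gm_def by (rule sym)
    qed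
    have "ennreal (\<gamma> ^ 3 * ?L\<^sup>2 * (cmod ?F)\<^sup>2) \<le> ennreal ((2 * \<gamma> / c\<^sup>2) * ((cmod A)\<^sup>2 + (cmod B)\<^sup>2))"
      by (rule ennreal_leI[OF real_bound])
    also have "\<dots> = ennreal (2 * \<gamma> / c\<^sup>2) * (ennreal ((cmod A)\<^sup>2) + ennreal ((cmod B)\<^sup>2))"
      using \<gamma> by (subst ennreal_mult) (auto simp only: ennreal_plus zero_le_power2 intro!: divide_nonneg_nonneg add_nonneg_nonneg mult_nonneg_nonneg)
    also have "\<dots> \<le> ennreal (2 * \<gamma> / c\<^sup>2) * (ennreal (CB / (2 * \<gamma>)) * P + ennreal (CB / (2 * \<gamma>)) * N)"
      by (intro mult_left_mono add_mono A B) simp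
    also have "\<dots> = (ennreal (2 * \<gamma> / c\<^sup>2) * ennreal (CB / (2 * \<gamma>))) * (P + N)"
      by (simp only: distrib_left mult.assoc)
    also have "ennreal (2 * \<gamma> / c\<^sup>2) * ennreal (CB / (2 * \<gamma>)) = ennreal (CB / c\<^sup>2)"
      using \<gamma> CB by (subst ennreal_mult[symmetric]) auto
    finally show ?thesis unfolding Nm P_def gp_def .
  qed
  moreover have "CB / c\<^sup>2 > 0" using CB c by simp
  ultimately show ?thesis by blast
qed

lemma nn_integral_swap:
  fixes G :: "real \<times> real \<times> real \<Rightarrow> complex"
  assumes G[measurable]: "G \<in> borel_measurable borel" and J: "J \<in> sets borel"
  shows "(\<integral>\<^sup>+\<xi>. ennreal (Lam \<gamma> \<xi> powr p) * line_energy J G \<xi> \<partial>lborel)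
    = (\<integral>\<^sup>+y. indicator J y * energy \<gamma> p (\<lambda>\<xi>. G (y, \<xi>)) \<partial>lborel)"
    and "(\<lambda>\<xi>. \<integral>\<^sup>+y. indicator J y * ennreal ((cmod (G (y, \<xi>)))\<^sup>2) \<partial>lborel) \<in> borel_measurable borel"
proof -
  note J[measurable]
  have Gp[measurable]: "G \<in> borel_measurable (lborel \<Otimes>\<^sub>M lborel)" by (simp add: lborel_prod)
  have "(\<lambda>z :: real \<times> real \<times> real. Lam \<gamma> (snd z)) \<in> borel_measurable borel"
    unfolding Lambda_def cmod_power2 complex.sel
    by (intro borel_measurable_continuous_onI continuous_intros)
  then have [measurable]: "(\<lambda>z :: real \<times> real \<times> real. Lam \<gamma> (snd z)) \<in> borel_measurable (lborel \<Otimes>\<^sub>M lborel)"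
    by (simp add: lborel_prod)
  have "(\<lambda>z :: (real \<times> real) \<times> real. indicator J (snd z) * ennreal ((cmod (G (snd z, fst z)))\<^sup>2))
      \<in> borel_measurable (lborel \<Otimes>\<^sub>M lborel)"
    by measurable
  from lborel.borel_measurable_nn_integral_fst[OF this]
  show mm: "(\<lambda>\<xi>. \<integral>\<^sup>+y. indicator J y * ennreal ((cmod (G (y, \<xi>)))\<^sup>2) \<partial>lborel) \<in> borel_measurable borel"
    by simp
  have yG: "(\<lambda>y. G (y, \<xi>)) \<in> borel_measurable lborel" and \<xi>G: "(\<lambda>\<xi>. G (y, \<xi>)) \<in> borel_measurable lborel" for y \<xi>
    by (rule measurable_compose[OF measurable_Pair2' Gp] measurable_compose[OF measurable_Pair1' Gp], simp)+
  have "(\<integral>\<^sup>+\<xi>. ennreal (Lam \<gamma> \<xi> powr p) * line_energy J G \<xi> \<partial>lborel)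
      = (\<integral>\<^sup>+\<xi>. (\<integral>\<^sup>+y. indicator J y * ennreal (Lam \<gamma> \<xi> powr p * (cmod (G (y, \<xi>)))\<^sup>2) \<partial>lborel) \<partial>lborel)"
  proof (rule nn_integral_cong)
    fix \<xi>
    note yG[of \<xi>, measurable]
    have "ennreal (Lam \<gamma> \<xi> powr p) * line_energy J G \<xi>
      = (\<integral>\<^sup>+y. ennreal (Lam \<gamma> \<xi> powr p) * (indicator J y * ennreal ((cmod (G (y, \<xi>)))\<^sup>2)) \<partial>lborel)"
      by (rule nn_integral_cmult[symmetric]) measurable
    then show "ennreal (Lam \<gamma> \<xi> powr p) * line_energy J G \<xi>
      = (\<integral>\<^sup>+y. indicator J y * ennreal (Lam \<gamma> \<xi> powr p * (cmod (G (y, \<xi>)))\<^sup>2) \<partial>lborel)"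
      by (simp add: ennreal_mult mult_ac)
  qed
  also have "\<dots> = (\<integral>\<^sup>+y. (\<integral>\<^sup>+\<xi>. indicator J y * ennreal (Lam \<gamma> \<xi> powr p * (cmod (G (y, \<xi>)))\<^sup>2) \<partial>lborel) \<partial>lborel)"
  proof (rule lborel_pair.Fubini')
    have "(\<lambda>z. indicator J (fst z) * ennreal (Lam \<gamma> (snd z) powr p * (cmod (G z))\<^sup>2)) \<in> borel_measurable (lborel \<Otimes>\<^sub>M lborel)"
      by measurable
    then show "(\<lambda>(y, \<xi>). indicator J y * ennreal (Lam \<gamma> \<xi> powr p * (cmod (G (y, \<xi>)))\<^sup>2)) \<in> borel_measurable (lborel \<Otimes>\<^sub>M lborel)"
      by (simp add: case_prod_beta)
  qed
  also have "\<dots> = (\<integral>\<^sup>+y. indicator J y * energy \<gamma> p (\<lambda>\<xi>. G (y, \<xi>)) \<partial>lborel)"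
  proof (rule nn_integral_cong)
    fix y
    note \<xi>G[of y, measurable]
    show "(\<integral>\<^sup>+\<xi>. indicator J y * ennreal (Lam \<gamma> \<xi> powr p * (cmod (G (y, \<xi>)))\<^sup>2) \<partial>lborel)
      = indicator J y * energy \<gamma> p (\<lambda>\<xi>. G (y, \<xi>))"
      by (rule nn_integral_cmult) measurable
  qed
  finally show "(\<integral>\<^sup>+\<xi>. ennreal (Lam \<gamma> \<xi> powr p) * line_energy J G \<xi> \<partial>lborel)
    = (\<integral>\<^sup>+y. indicator J y * energy \<gamma> p (\<lambda>\<xi>. G (y, \<xi>)) \<partial>lborel)" .
qed

text \<open>The pointwise bound, multiplied by \<open>\<Lambda>\<close> to the power \<open>2s\<close> and integrated over all frequencies.\<close>

lemma front_solution_norm_bound: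
  assumes CB: "CB > 0" and M: "v / CB > sqrt 2"
  shows "\<exists>C>0. \<forall>\<gamma>\<ge>1. \<forall>Km \<in> L2H {..<0} s \<gamma>. \<forall>Kp \<in> L2H {0<..} s \<gamma>.
    front_solution CB v \<gamma> Kp Km \<in> borel_measurable borel \<and>
    ennreal (\<gamma> ^ 3) * energy \<gamma> (2 * (s + 1)) (front_solution CB v \<gamma> Kp Km)
      \<le> ennreal (C * ((2 * pi)\<^sup>2 * ((norm_L2H {0<..} s \<gamma> Kp)\<^sup>2 + (norm_L2H {..<0} s \<gamma> Km)\<^sup>2)))"
proof -
  obtain C where C: "C > 0" and bound: "\<And>\<gamma> Kp Km \<xi>. \<gamma> > 0 \<Longrightarrow>
    partial_fourier {0<..} \<gamma> Kp \<in> borel_measurable borel \<Longrightarrow> partial_fourier {..<0} \<gamma> Km \<in> borel_measurable borel \<Longrightarrow>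
    ennreal (\<gamma> ^ 3 * (Lam \<gamma> \<xi>)\<^sup>2 * (cmod (front_solution CB v \<gamma> Kp Km \<xi>))\<^sup>2) \<le>
      ennreal C * (line_energy {0<..} (partial_fourier {0<..} \<gamma> Kp) \<xi>
        + line_energy {..<0} (partial_fourier {..<0} \<gamma> Km) \<xi>)"
    using front_solution_bound[OF CB M] by blast
  show ?thesis
  proof (intro exI[of _ C] conjI C allI impI ballI)
    fix \<gamma> Km Kp
    assume \<gamma>: "\<gamma> \<ge> 1" and Km: "Km \<in> L2H {..<0} s \<gamma>" and Kp: "Kp \<in> L2H {0<..} s \<gamma>"
    let ?F = "front_solution CB v \<gamma> Kp Km"
    let ?G = "partial_fourier {0<..} \<gamma> Kp" and ?G' = "partial_fourier {..<0} \<gamma> Km"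
    have \<gamma>0: "\<gamma> > 0" using \<gamma> by simp
    have J: "{0<..} \<in> sets (borel :: real measure)" "{..<0} \<in> sets (borel :: real measure)" by auto
    note Np = norm_L2H_nn_integral[OF Kp J(1) \<gamma>] and Nm = norm_L2H_nn_integral[OF Km J(2) \<gamma>]
    show Fm: "?F \<in> borel_measurable borel"
      by (rule front_solution_measurable[OF CB \<gamma>0 Np(1) Nm(1)])
    define P N where "P \<xi> = line_energy {0<..} ?G \<xi>"
      and "N \<xi> = line_energy {..<0} ?G' \<xi>" for \<xi>
    have [measurable]: "P \<in> borel_measurable borel" "N \<in> borel_measurable borel"
      unfolding P_def[abs_def] N_def[abs_def]
      by (rule nn_integral_swap(2)[OF Np(1) J(1)], rule nn_integral_swap(2)[OF Nm(1) J(2)])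
    note Fm[measurable]
    have pt: "ennreal (\<gamma> ^ 3) * ennreal (Lam \<gamma> \<xi> powr (2 * (s + 1)) * (cmod (?F \<xi>))\<^sup>2)
        \<le> ennreal C * (ennreal (Lam \<gamma> \<xi> powr (2 * s)) * P \<xi> + ennreal (Lam \<gamma> \<xi> powr (2 * s)) * N \<xi>)" for \<xi>
    proof -
      have L: "Lam \<gamma> \<xi> > 0" by (rule Lam_pos[OF \<gamma>0])
      have "Lam \<gamma> \<xi> powr (2 * (s + 1)) = Lam \<gamma> \<xi> powr (2 * s) * (Lam \<gamma> \<xi>)\<^sup>2"
        using L by (simp add: distrib_left powr_add)
      then have "\<gamma> ^ 3 * (Lam \<gamma> \<xi> powr (2 * (s + 1)) * (cmod (?F \<xi>))\<^sup>2)
          = Lam \<gamma> \<xi> powr (2 * s) * (\<gamma> ^ 3 * (Lam \<gamma> \<xi>)\<^sup>2 * (cmod (?F \<xi>))\<^sup>2)"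
        by (simp only: mult_ac)
      then have "ennreal (\<gamma> ^ 3) * ennreal (Lam \<gamma> \<xi> powr (2 * (s + 1)) * (cmod (?F \<xi>))\<^sup>2)
          = ennreal (Lam \<gamma> \<xi> powr (2 * s)) * ennreal (\<gamma> ^ 3 * (Lam \<gamma> \<xi>)\<^sup>2 * (cmod (?F \<xi>))\<^sup>2)"
        using \<gamma>0 by (subst (1 2) ennreal_mult[symmetric]) auto
      also have "\<dots> \<le> ennreal (Lam \<gamma> \<xi> powr (2 * s)) * (ennreal C * (P \<xi> + N \<xi>))"
        unfolding P_def N_def by (intro mult_left_mono bound \<gamma>0 Np(1) Nm(1)) simp
      finally show ?thesis by (simp only: distrib_left mult.left_commute)
    qed
    have "ennreal (\<gamma> ^ 3) * energy \<gamma> (2 * (s + 1)) ?F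
        = (\<integral>\<^sup>+\<xi>. ennreal (\<gamma> ^ 3) * ennreal (Lam \<gamma> \<xi> powr (2 * (s + 1)) * (cmod (?F \<xi>))\<^sup>2) \<partial>lborel)"
      by (rule nn_integral_cmult[symmetric]) measurable
    also have "\<dots> \<le> (\<integral>\<^sup>+\<xi>. ennreal C * (ennreal (Lam \<gamma> \<xi> powr (2 * s)) * P \<xi> + ennreal (Lam \<gamma> \<xi> powr (2 * s)) * N \<xi>) \<partial>lborel)"
      by (intro nn_integral_mono pt)
    also have "\<dots> = ennreal C * ((\<integral>\<^sup>+\<xi>. ennreal (Lam \<gamma> \<xi> powr (2 * s)) * P \<xi> \<partial>lborel)
        + (\<integral>\<^sup>+\<xi>. ennreal (Lam \<gamma> \<xi> powr (2 * s)) * N \<xi> \<partial>lborel))"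
      by (subst nn_integral_cmult, measurable) (subst nn_integral_add, measurable)
    also have "(\<integral>\<^sup>+\<xi>. ennreal (Lam \<gamma> \<xi> powr (2 * s)) * P \<xi> \<partial>lborel) = ennreal ((2 * pi)\<^sup>2 * (norm_L2H {0<..} s \<gamma> Kp)\<^sup>2)"
      unfolding P_def nn_integral_swap(1)[OF Np(1) J(1)] by (rule Np(2))
    also have "(\<integral>\<^sup>+\<xi>. ennreal (Lam \<gamma> \<xi> powr (2 * s)) * N \<xi> \<partial>lborel) = ennreal ((2 * pi)\<^sup>2 * (norm_L2H {..<0} s \<gamma> Km)\<^sup>2)"
      unfolding N_def nn_integral_swap(1)[OF Nm(1) J(2)] by (rule Nm(2))
    also have "ennreal C * (ennreal ((2 * pi)\<^sup>2 * (norm_L2H {0<..} s \<gamma> Kp)\<^sup>2) + ennreal ((2 * pi)\<^sup>2 * (norm_L2H {..<0} s \<gamma> Km)\<^sup>2))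
        = ennreal (C * ((2 * pi)\<^sup>2 * ((norm_L2H {0<..} s \<gamma> Kp)\<^sup>2 + (norm_L2H {..<0} s \<gamma> Km)\<^sup>2)))"
      using C by (subst ennreal_plus[symmetric], simp, simp, subst ennreal_mult[symmetric])
        (simp_all only: distrib_left, simp_all)
    finally show "ennreal (\<gamma> ^ 3) * energy \<gamma> (2 * (s + 1)) ?F
      \<le> ennreal (C * ((2 * pi)\<^sup>2 * ((norm_L2H {0<..} s \<gamma> Kp)\<^sup>2 + (norm_L2H {..<0} s \<gamma> Km)\<^sup>2)))" .
  qed
qed

lemma H_fourier:
  assumes f: "f \<in> H s \<gamma>" and \<gamma>: "\<gamma> \<ge> 1"
  shows "f \<in> distributions" "has_fourier (exp_mult \<gamma> f) (fourier (exp_mult \<gamma> f))" "exp_mult \<gamma> f \<in> sobolev s"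
proof -
  have a: "f \<in> distributions \<and> exp_mult \<gamma> f \<in> sobolev s" using f unfolding H_def by (rule CollectD)
  show "f \<in> distributions" "exp_mult \<gamma> f \<in> sobolev s" by (rule a[THEN conjunct1], rule a[THEN conjunct2])
  then show "has_fourier (exp_mult \<gamma> f) (fourier (exp_mult \<gamma> f))" by (intro sobolev_fourier(1)[OF _ \<gamma>])
qed

theorem theorem2p2:
  fixes p :: "real \<Rightarrow> real" and \<rho> v1p v1m B2p B2m s :: real
  assumes "\<rho> > 0"
    and "p differentiable (at \<rho>)" and "deriv p \<rho> > 0"
    and "v1m = - v1p"
    and "\<bar>B2p\<bar> = \<bar>B2m\<bar>"
    and "v1p / C_B p \<rho> B2p > sqrt 2"
  shows "\<exists>C>0. \<forall>\<gamma>\<ge>1. \<forall>Km \<in> L2H {..<0} s \<gamma>. \<forall>Kp \<in> L2H {0<..} s \<gamma>.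
    (\<exists>!f. f \<in> H (s + 1) \<gamma> \<and> solves_front (C_B p \<rho> B2p) v1p v1m \<gamma> Kp Km f) \<and>
    (\<forall>f \<in> H (s + 1) \<gamma>. solves_front (C_B p \<rho> B2p) v1p v1m \<gamma> Kp Km f \<longrightarrow>
       \<gamma> ^ 3 * (norm_H (s + 1) \<gamma> f)\<^sup>2
         \<le> C * ((norm_L2H {0<..} s \<gamma> Kp)\<^sup>2 + (norm_L2H {..<0} s \<gamma> Km)\<^sup>2))"
proof -
  define CB where "CB = C_B p \<rho> B2p"
  have CB: "CB > 0"
    using assms(1,3) unfolding CB_def C_B_def sound_speed_def
    by (intro real_sqrt_gt_zero add_pos_nonneg) auto
  have M: "v1p / CB > sqrt 2" unfolding CB_def by (rule assms(6))
  obtain C where C: "C > 0" and sol: "\<And>\<gamma> Km Kp. \<gamma> \<ge> 1 \<Longrightarrow> Km \<in> L2H {..<0} s \<gamma> \<Longrightarrow> Kp \<in> L2H {0<..} s \<gamma> \<Longrightarrow>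
    front_solution CB v1p \<gamma> Kp Km \<in> borel_measurable borel \<and>
    ennreal (\<gamma> ^ 3) * energy \<gamma> (2 * (s + 1)) (front_solution CB v1p \<gamma> Kp Km)
      \<le> ennreal (C * ((2 * pi)\<^sup>2 * ((norm_L2H {0<..} s \<gamma> Kp)\<^sup>2 + (norm_L2H {..<0} s \<gamma> Km)\<^sup>2)))"
    using front_solution_norm_bound[OF CB M, of s] by blast
  show ?thesis
    unfolding CB_def[symmetric] assms(4)
  proof (intro exI[of _ C] conjI C allI impI ballI)
    fix \<gamma> Km Kp
    assume \<gamma>: "\<gamma> \<ge> 1" and Km: "Km \<in> L2H {..<0} s \<gamma>" and Kp: "Kp \<in> L2H {0<..} s \<gamma>"
    let ?F = "front_solution CB v1p \<gamma> Kp Km"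
    let ?N = "(norm_L2H {0<..} s \<gamma> Kp)\<^sup>2 + (norm_L2H {..<0} s \<gamma> Km)\<^sup>2"
    let ?I = "energy \<gamma> (2 * (s + 1)) ?F"
    have \<gamma>0: "\<gamma> > 0" using \<gamma> by simp
    have Fm: "?F \<in> borel_measurable borel" and FI: "ennreal (\<gamma> ^ 3) * ?I \<le> ennreal (C * ((2 * pi)\<^sup>2 * ?N))"
      using sol[OF \<gamma> Km Kp] by blast+
    note solves = solves_front_iff[OF CB M \<gamma>0, of Kp Km]
    have fin: "?I < \<infinity>"
    proof -
      have "ennreal 1 * ?I \<le> ennreal (\<gamma> ^ 3) * ?I"
        using \<gamma> by (intro mult_right_mono ennreal_leI) (auto simp: one_le_power)
      also have "\<dots> < \<infinity>" using FI by (rule order_le_less_trans) simp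
      finally show ?thesis by simp
    qed
    have int: "integrable lborel (\<lambda>\<xi>. bracket_sq \<xi> powr (s + 1) * (cmod (?F \<xi>))\<^sup>2)"
      by (rule integrable_bracket_of_Lam[OF Fm \<gamma> fin])
    obtain w where w: "has_fourier w ?F"
      using has_fourier_exists[OF Fm int] by (elim exE)
    have wd: "w \<in> distributions" by (rule has_fourierD(1)[OF w])
    have ww: "exp_mult \<gamma> (exp_mult (- \<gamma>) w) = w"
      using exp_mult_inverse[OF wd, of "- \<gamma>"] by simp
    show "\<exists>!f. f \<in> H (s + 1) \<gamma> \<and> solves_front CB v1p (- v1p) \<gamma> Kp Km f"
    proof (rule ex1I)
      have "exp_mult (- \<gamma>) w \<in> H (s + 1) \<gamma>"
        unfolding H_def mem_Collect_eq ww sobolev_iff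
        by (intro conjI exI[of _ ?F] exp_mult_distributions wd w int)
      moreover have "solves_front CB v1p (- v1p) \<gamma> Kp Km (exp_mult (- \<gamma>) w)"
        unfolding solves ww by (rule fourier_AE_eq[OF w])
      ultimately show "exp_mult (- \<gamma>) w \<in> H (s + 1) \<gamma> \<and> solves_front CB v1p (- v1p) \<gamma> Kp Km (exp_mult (- \<gamma>) w)"
        by (rule conjI)
    next
      fix f assume f: "f \<in> H (s + 1) \<gamma> \<and> solves_front CB v1p (- v1p) \<gamma> Kp Km f"
      note fH = H_fourier[OF f[THEN conjunct1] \<gamma>]
      have "exp_mult \<gamma> f = w"
        by (rule has_fourier_determines[OF fH(2) w f[THEN conjunct2, unfolded solves]])
      then show "f = exp_mult (- \<gamma>) w"
        using exp_mult_inverse[OF fH(1), of \<gamma>] by simp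
    qed
    fix f assume f: "f \<in> H (s + 1) \<gamma>" and s: "solves_front CB v1p (- v1p) \<gamma> Kp Km f"
    note fH = H_fourier[OF f \<gamma>]
    have N0: "0 \<le> ?N" by simp
    have "ennreal (\<gamma> ^ 3 * (norm_H (s + 1) \<gamma> f)\<^sup>2) = ennreal (\<gamma> ^ 3) * ennreal ((norm_H (s + 1) \<gamma> f)\<^sup>2)"
      using \<gamma>0 by (intro ennreal_mult) auto
    also have "ennreal ((norm_H (s + 1) \<gamma> f)\<^sup>2) = ennreal (1 / (2 * pi)\<^sup>2) *
        energy \<gamma> (2 * (s + 1)) (fourier (exp_mult \<gamma> f))"
      unfolding norm_H_def by (rule norm_s_nn_integral[OF fH(3) \<gamma>])
    also have "energy \<gamma> (2 * (s + 1)) (fourier (exp_mult \<gamma> f)) = ?I"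
      by (rule nn_integral_cong_AE) (use s[unfolded solves] in eventually_elim, simp)
    also have "ennreal (\<gamma> ^ 3) * (ennreal (1 / (2 * pi)\<^sup>2) * ?I) = ennreal (1 / (2 * pi)\<^sup>2) * (ennreal (\<gamma> ^ 3) * ?I)"
      by (rule mult.left_commute)
    also have "\<dots> \<le> ennreal (1 / (2 * pi)\<^sup>2) * ennreal (C * ((2 * pi)\<^sup>2 * ?N))"
      by (rule mult_left_mono[OF FI]) simp
    also have "\<dots> = ennreal (1 / (2 * pi)\<^sup>2 * (C * ((2 * pi)\<^sup>2 * ?N)))"
      using C N0 by (intro ennreal_mult[symmetric]) (auto intro!: mult_nonneg_nonneg)
    also have "1 / (2 * pi)\<^sup>2 * (C * ((2 * pi)\<^sup>2 * ?N)) = C * ?N" by simp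
    finally show "\<gamma> ^ 3 * (norm_H (s + 1) \<gamma> f)\<^sup>2 \<le> C * ?N"
      by (rule ennreal_le_iff[THEN iffD1, rotated]) (use C N0 in \<open>auto intro!: mult_nonneg_nonneg\<close>)
  qed
qed

end
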